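(* Let $k,m\ge1$ and $r\ge2$ be integers, $q=2r-1>1$, $R=\mathbb Q[x,y]$, and let $I=E_2(L)\cap R=\langle A_q(x),G_k(x,y),H_m(x,y)\rangle$ for the oriented ordered two-component pretzel link $L=P(2k,2r-1,2m)$ (with $y=t_1$, $x=t_2$). With $\mathcal D$, $\mathcal S$, $\Pi_j$, $h$, $Q_j$, $\mathcal B$ as defined in the context, assume $g=\gcd(m,k)>1$. Then $$\mathcal D=\{\delta>1:\ \delta\mid q,\ \delta\mid\operatorname{lcm}(m,k)\}.$$ If $\mathcal D=\varnothing$, then $\mathrm{AG}_2(L)=\{1\}$. Otherwise, the set $\mathcal B$, which is a Gröbner basis of $I$ for the lexicographic order with $y>x$, consists of $\{\Pi_0(x),\,y^g-h(x)\}$, together with $\Pi_{g-1}Q_{g-1}$ when $g-1\in\mathcal S$, and with $\Pi_{g-2}Q_{g-2}$ when $g\ge3$ and $g-2\in\mathcal S$. In particular, it has at most four elements. The initial ideal of $I$ is generated by $y^g$ and $x^{\deg\Pi_0}$, together with $x^{\deg\Pi_{g-1}}y^{g-1}$ when $g-1\in\mathcal S$, and with $x^{\deg\Pi_{g-2}}y^{g-2}$ when $g\ge3$ and $g-2\in\mathcal S$. Moreover, $$\Pi_{g-1}=\prod_{\delta\in\mathcal D,\ \delta\nmid m,\ \delta\nmid k}\Phi_{2\delta}.$$ When $g\ge3$, one also has $$\Pi_{g-2}=\prod_{\delta\in\mathcal D,\ \delta\nmid m\ \text{or}\ \delta\nmid k}\Phi_{2\delta}.$$ Consequently, $\mathrm{AG}_2(L)$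 is obtained by interreducing an at-most-four-element Gröbner basis.
   Context: $A_q(x)=\frac{1+x^q}{1+x}$, $G_k(x,y)=\frac{1-(xy)^k}{1-xy}$, $H_m(x,y)=\frac{x^m-y^m}{x-y}$ (polynomials). $\Phi_n(x)$ is the $n$th cyclotomic polynomial. For $\delta\mid q$, $\delta>1$: $\mathcal K_\delta=\mathbb Q[x]/(\Phi_{2\delta}(x))$, $x_\delta$ is the class of $x$, $p_\delta(y)\in\mathcal K_\delta[y]$ is the monic gcd of $G_k(x_\delta,y)$ and $H_m(x_\delta,y)$, and $d_\delta=\deg_y p_\delta$ (one has $d_\delta\le g$). Put $\mathcal D=\{\delta>1:\delta\mid q,\ d_\delta>0\}$. Suppose $\mathcal D\neq\varnothing$. For $0\le n\le g$ let $\Pi_n(x)=\prod_{\delta\in\mathcal D,\ d_\delta>n}\Phi_{2\delta}(x)$ (empty product $=1$), and $\mathcal S=\{0,g\}\cup\{d_\delta:\delta\in\mathcal D\}$. Choose $u,v\in\mathbb Z$ with $um+vk=g$ and put $e=um-vk$. Since $\Pi_0(0)=1$, $x$ is invertible modulo $\Pi_0$; let $h(x)\in\mathbb Q[x]$ be the unique polynomial with $\deg h<\deg\Pi_0$ and $h\equiv x^e\pmod{\Pi_0}$ (negative powers interpreted in $\mathbb Q[x]/(\Pi_0)$; independent of the choice of $u,v$). For $j\in\mathcal S\setminus\{0,g\}$ let $Q_j(x,y)\in\mathbb Q[x,y]$ be the unique polynomial, monic in $y$ of $y$-degree $j$, each of whose coefficients (as polynomial in $y$) has $x$-degree less than $\deg(\Pi_0/\Pi_j)$,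 such that $Q_j(x_\delta,y)=y^{\,j-d_\delta}p_\delta(y)$ for all $\delta\in\mathcal D$ with $d_\delta\le j$. Put $\mathcal B=\{\Pi_0(x),\,y^g-h(x)\}\cup\{\Pi_j(x)Q_j(x,y):j\in\mathcal S\setminus\{0,g\}\}$. $\mathrm{AG}_2(L)$ is the reduced Gröbner basis, for the lexicographic order $y>x$, of $E_2(L)\cap R$ (it is $\{1\}$ for the unit ideal), where $E_2(L)\subset\mathbb Q[x^{\pm1},y^{\pm1}]$ is the second elementary ideal of the link group with $\phi$ sending the positive meridian of the $i$th component to the $i$th standard basis vector of $\mathbb Z^2$: for a presentation with $n$ generators it is generated by the $(n-2)\times(n-2)$ minors of the Fox matrix evaluated under $\phi$. For $L=P(2k,2r-1,2m)$ the link group is $\langle a,b,c\mid r_1,r_2\rangle$, $r_1=(cb)^r b^{-1}(cb)^{-r}(ac^{-1})^m c(ca^{-1})^m$, $r_2=(ab)^{-k}b(ab)^k(cb)^{r-1}c^{-1}(cb)^{-(r-1)}$, with $a\mapsto y$, $b,c\mapsto x$; one has $I=E_2(L)\cap R=\langle A_q,G_k,H_m\rangle$. *)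

theory Defs
  imports
    Complex_Main
    "HOL-Library.Poly_Mapping"
    "HOL-Library.Product_Plus"
    "HOL-Computational_Algebra.Polynomial"
    "HOL-Number_Theory.Cong"
    "Jordan_Normal_Form.Determinant"
    "Jordan_Normal_Form.DL_Submatrix"
begin

section \<open>Ideals and Groebner bases in two variables\<close>

text \<open>The ideal generated by a subset of a commutative ring is its span in the
  ring, regarded as a module over itself.\<close>

abbreviation ideal_gen :: "'a::comm_ring_1 set \<Rightarrow> 'a set" where
  "ideal_gen \<equiv> module.span (*)"

text \<open>The ring of polynomials in x and y over the rationals is rendered as
  \<open>rat poly poly\<close>: the outer variable is y, the inner one is x.  An exponent pair
  \<open>(j, i)\<close> stands for the monomial \<open>y ^ j * x ^ i\<close>, so that the lexicographic order
  with y > x is the lexicographic order on these pairs.\<close>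

type_synonym bipoly = "rat poly poly"

definition X :: bipoly where "X = [:[:0, 1:]:]"
definition Y :: bipoly where "Y = [:0, 1:]"

definition mono_xy :: "nat \<times> nat \<Rightarrow> bipoly" where
  "mono_xy = (\<lambda>(j, i). Y ^ j * X ^ i)"

definition coef :: "bipoly \<Rightarrow> nat \<times> nat \<Rightarrow> rat" where
  "coef f = (\<lambda>(j, i). poly.coeff (poly.coeff f j) i)"

definition exps :: "bipoly \<Rightarrow> (nat \<times> nat) set" where
  "exps f = {t. coef f t \<noteq> 0}"

text \<open>The lexicographically largest exponent, meaningful for \<open>f \<noteq> 0\<close> only.\<close>

definition lead_exp :: "bipoly \<Rightarrow> nat \<times> nat" where
  "lead_exp f = (THE t. t \<in> exps f \<and>
     (\<forall>s\<in>exps f. s = t \<or> (s, t) \<in> less_than <*lex*> less_than))"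

definition lead_mono :: "bipoly \<Rightarrow> bipoly" where
  "lead_mono f = mono_xy (lead_exp f)"

definition lead_cf :: "bipoly \<Rightarrow> rat" where
  "lead_cf f = coef f (lead_exp f)"

definition initial_ideal :: "bipoly set \<Rightarrow> bipoly set" where
  "initial_ideal I = ideal_gen (lead_mono ` (I - {0}))"

definition is_groebner_basis :: "bipoly set \<Rightarrow> bipoly set \<Rightarrow> bool" where
  "is_groebner_basis G I \<longleftrightarrow>
     finite G \<and> G \<subseteq> I \<and> ideal_gen (lead_mono ` (G - {0})) = initial_ideal I"

definition is_reduced_groebner_basis :: "bipoly set \<Rightarrow> bipoly set \<Rightarrow> bool" where
  "is_reduced_groebner_basis G I \<longleftrightarrow>
     is_groebner_basis G I \<and>
     (\<forall>f\<in>G. f \<noteq> 0 \<and> lead_cf f = 1 \<and>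
        (\<forall>g\<in>G - {f}. \<forall>t\<in>exps f. \<not> lead_mono g dvd mono_xy t))"

definition reduced_groebner_basis :: "bipoly set \<Rightarrow> bipoly set" where
  "reduced_groebner_basis I = (THE G. is_reduced_groebner_basis G I)"

definition const_xy :: "rat \<Rightarrow> bipoly" where
  "const_xy c = [:[:c:]:]"

text \<open>One step of the division algorithm: some monomial of f is cancelled by a multiple
  of some element of G.\<close>

definition red_step :: "bipoly set \<Rightarrow> bipoly \<Rightarrow> bipoly \<Rightarrow> bool" where
  "red_step G f f' \<longleftrightarrow>
     (\<exists>g\<in>G - {0}. \<exists>t\<in>exps f. lead_mono g dvd mono_xy t \<and>
        f' = f - const_xy (coef f t / lead_cf g) * (mono_xy t div lead_mono g) * g)"

text \<open>One step of interreduction: an element is reduced modulo the other ones (and dropped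
  if it becomes zero), or it is made monic.\<close>

definition interreduction_step :: "bipoly set \<Rightarrow> bipoly set \<Rightarrow> bool" where
  "interreduction_step G G' \<longleftrightarrow>
     (\<exists>f\<in>G. \<exists>f'. (red_step (G - {f}) f f' \<or> f \<noteq> 0 \<and> f' = const_xy (1 / lead_cf f) * f) \<and>
        G' = (G - {f}) \<union> ({f'} - {0}))"

definition interreduces_to :: "bipoly set \<Rightarrow> bipoly set \<Rightarrow> bipoly set \<Rightarrow> bool" where
  "interreduces_to G G' I \<longleftrightarrow>
     interreduction_step\<^sup>*\<^sup>* G G' \<and> is_reduced_groebner_basis G' I"

section \<open>Fox calculus and elementary ideals\<close>

text \<open>A letter \<open>(i, True)\<close> is the i-th generator and \<open>(i, False)\<close> its inverse.\<close>

type_synonym gword = "(nat \<times> bool) list"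

definition winv :: "gword \<Rightarrow> gword" where
  "winv w = rev (map (\<lambda>(i, s). (i, \<not> s)) w)"

definition wpow :: "gword \<Rightarrow> nat \<Rightarrow> gword" where
  "wpow w n = concat (replicate n w)"

text \<open>The Fox derivative of a word with respect to the j-th generator, as a formal integer
  combination of words, given as a list of terms.  The equations are the product rule
  together with \<open>d x_j / d x_j = 1\<close> and \<open>d x_j^-1 / d x_j = - x_j^-1\<close>.\<close>

fun fox :: "nat \<Rightarrow> gword \<Rightarrow> (int \<times> gword) list" where
  "fox j [] = []"
| "fox j ((i, s) # w) =
     (if i = j then (if s then [(1, [])] else [(-1, [(i, False)])]) else []) @
     map (\<lambda>(c, u). (c, (i, s) # u)) (fox j w)"

text \<open>The Laurent polynomial ring is the rational group ring of \<open>int \<times> int\<close>; the first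
  standard basis vector corresponds to y and the second one to x.\<close>

type_synonym laurent = "(int \<times> int) \<Rightarrow>\<^sub>0 rat"

definition word_image :: "(nat \<Rightarrow> int \<times> int) \<Rightarrow> gword \<Rightarrow> int \<times> int" where
  "word_image \<phi> w = (\<Sum>(i, s)\<leftarrow>w. if s then \<phi> i else - \<phi> i)"

definition eval_terms :: "(nat \<Rightarrow> int \<times> int) \<Rightarrow> (int \<times> gword) list \<Rightarrow> laurent" where
  "eval_terms \<phi> ts = (\<Sum>(c, u)\<leftarrow>ts. Poly_Mapping.single (word_image \<phi> u) (of_int c))"

text \<open>A presentation consists of the number of generators and the list of relators.\<close>

type_synonym presentation = "nat \<times> gword list"

definition fox_matrix :: "(nat \<Rightarrow> int \<times> int) \<Rightarrow> presentation \<Rightarrow> laurent mat" where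
  "fox_matrix \<phi> = (\<lambda>(n, rs). mat (length rs) n (\<lambda>(i, j). eval_terms \<phi> (fox j (rs ! i))))"

definition elementary_ideal ::
    "nat \<Rightarrow> (nat \<Rightarrow> int \<times> int) \<Rightarrow> presentation \<Rightarrow> laurent set" where
  "elementary_ideal d \<phi> P = ideal_gen
     {det (submatrix (fox_matrix \<phi> P) I J) | I J.
        I \<subseteq> {..<length (snd P)} \<and> J \<subseteq> {..<fst P} \<and>
        card I = fst P - d \<and> card J = fst P - d}"

text \<open>The inclusion of the polynomial ring into the Laurent polynomial ring.\<close>

definition to_laurent :: "bipoly \<Rightarrow> laurent" where
  "to_laurent f = (\<Sum>(j, i)\<in>exps f. Poly_Mapping.single (int j, int i) (coef f (j, i)))"

section \<open>The link group of the pretzel link P(2k, 2r-1, 2m)\<close>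

abbreviation "wa \<equiv> [(0::nat, True)]"
abbreviation "wb \<equiv> [(1::nat, True)]"
abbreviation "wc \<equiv> [(2::nat, True)]"

text \<open>\<open>r\<^sub>1 = (cb)^r b^-1 (cb)^-r (a c^-1)^m c (c a^-1)^m\<close> and
  \<open>r\<^sub>2 = (ab)^-k b (ab)^k (cb)^(r-1) c^-1 (cb)^-(r-1)\<close>\<close>

definition pretzel_presentation :: "nat \<Rightarrow> nat \<Rightarrow> nat \<Rightarrow> presentation" where
  "pretzel_presentation k r m = (3,
     [wpow (wc @ wb) r @ winv wb @ winv (wpow (wc @ wb) r) @
        wpow (wa @ winv wc) m @ wc @ wpow (wc @ winv wa) m,
      winv (wpow (wa @ wb) k) @ wb @ wpow (wa @ wb) k @
        wpow (wc @ wb) (r - 1) @ winv wc @ winv (wpow (wc @ wb) (r - 1))])"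

text \<open>The generator a is a meridian of the first component, b and c are meridians of the
  second one.\<close>

definition pretzel_phi :: "nat \<Rightarrow> int \<times> int" where
  "pretzel_phi i = (if i = 0 then (1, 0) else (0, 1))"

definition pretzel_E2 :: "nat \<Rightarrow> nat \<Rightarrow> nat \<Rightarrow> laurent set" where
  "pretzel_E2 k r m = elementary_ideal 2 pretzel_phi (pretzel_presentation k r m)"

definition pretzel_E2_cap_R :: "nat \<Rightarrow> nat \<Rightarrow> nat \<Rightarrow> bipoly set" where
  "pretzel_E2_cap_R k r m = {f. to_laurent f \<in> pretzel_E2 k r m}"

definition pretzel_AG2 :: "nat \<Rightarrow> nat \<Rightarrow> nat \<Rightarrow> bipoly set" where
  "pretzel_AG2 k r m = reduced_groebner_basis (pretzel_E2_cap_R k r m)"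

section \<open>The explicit basis\<close>

text \<open>All three divisions are exact (the first one for odd q).\<close>

definition A_poly :: "nat \<Rightarrow> rat poly" where
  "A_poly q = (1 + [:0, 1:] ^ q) div (1 + [:0, 1:])"

definition G_poly :: "nat \<Rightarrow> bipoly" where
  "G_poly k = (1 - (X * Y) ^ k) div (1 - X * Y)"

definition H_poly :: "nat \<Rightarrow> bipoly" where
  "H_poly m = (X ^ m - Y ^ m) div (X - Y)"

definition cyclotomic :: "nat \<Rightarrow> rat poly" where
  "cyclotomic n = (THE p. map_poly of_rat p =
     (\<Prod>j\<in>{j. 1 \<le> j \<and> j \<le> n \<and> coprime j n}.
        [:- cis (2 * pi * real j / real n), 1:]))"

text \<open>\<open>K_\<delta> = \<rat>[x]/(\<Phi>\<^sub>2\<^sub>\<delta>)\<close>, every residue class being represented by its unique member of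
  degree less than \<open>deg \<Phi>\<^sub>2\<^sub>\<delta>\<close>.  Thus \<open>K_\<delta>[y]\<close> is the set of fixed points of the following
  reduction map, with multiplication in \<open>\<rat>[x,y]\<close> followed by reduction, and the reduction
  map itself is the substitution \<open>f \<mapsto> f(x_\<delta>, y)\<close> from \<open>\<rat>[x,y]\<close> onto \<open>K_\<delta>[y]\<close>.\<close>

definition K_red :: "nat \<Rightarrow> bipoly \<Rightarrow> bipoly" where
  "K_red \<delta> f = map_poly (\<lambda>c. c mod cyclotomic (2 * \<delta>)) f"

definition K_carrier :: "nat \<Rightarrow> bipoly set" where
  "K_carrier \<delta> = {f. K_red \<delta> f = f}"

definition K_dvd :: "nat \<Rightarrow> bipoly \<Rightarrow> bipoly \<Rightarrow> bool" where
  "K_dvd \<delta> a b \<longleftrightarrow> (\<exists>c\<in>K_carrier \<delta>. b = K_red \<delta> (a * c))"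

definition is_monic_gcd_K :: "nat \<Rightarrow> bipoly \<Rightarrow> bipoly \<Rightarrow> bipoly \<Rightarrow> bool" where
  "is_monic_gcd_K \<delta> p a b \<longleftrightarrow>
     p \<in> K_carrier \<delta> \<and> lead_coeff p = 1 \<and> K_dvd \<delta> p a \<and> K_dvd \<delta> p b \<and>
     (\<forall>c\<in>K_carrier \<delta>. K_dvd \<delta> c a \<longrightarrow> K_dvd \<delta> c b \<longrightarrow> K_dvd \<delta> c p)"

definition p_gcd :: "nat \<Rightarrow> nat \<Rightarrow> nat \<Rightarrow> bipoly" where
  "p_gcd k m \<delta> = (THE p. is_monic_gcd_K \<delta> p (K_red \<delta> (G_poly k)) (K_red \<delta> (H_poly m)))"

definition d_deg :: "nat \<Rightarrow> nat \<Rightarrow> nat \<Rightarrow> nat" where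
  "d_deg k m \<delta> = degree (p_gcd k m \<delta>)"

definition D_set :: "nat \<Rightarrow> nat \<Rightarrow> nat \<Rightarrow> nat set" where
  "D_set q k m = {\<delta>. \<delta> > 1 \<and> \<delta> dvd q \<and> d_deg k m \<delta> > 0}"

definition Pi_poly :: "nat \<Rightarrow> nat \<Rightarrow> nat \<Rightarrow> nat \<Rightarrow> rat poly" where
  "Pi_poly q k m n = (\<Prod>\<delta>\<in>{\<delta>\<in>D_set q k m. d_deg k m \<delta> > n}. cyclotomic (2 * \<delta>))"

definition S_set :: "nat \<Rightarrow> nat \<Rightarrow> nat \<Rightarrow> nat set" where
  "S_set q k m = {0, gcd m k} \<union> d_deg k m ` D_set q k m"

text \<open>The congruence says \<open>h \<equiv> x^e\<close> modulo \<open>\<Pi>\<^sub>0\<close>, negative powers of x being moved to the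
  other side.\<close>

definition h_poly :: "nat \<Rightarrow> nat \<Rightarrow> nat \<Rightarrow> int \<Rightarrow> rat poly" where
  "h_poly q k m e = (THE h. degree h < degree (Pi_poly q k m 0) \<and>
     [h * [:0, 1:] ^ nat (- e) = [:0, 1:] ^ nat e] (mod Pi_poly q k m 0))"

definition Q_poly :: "nat \<Rightarrow> nat \<Rightarrow> nat \<Rightarrow> nat \<Rightarrow> bipoly" where
  "Q_poly q k m j = (THE Q. degree Q = j \<and> lead_coeff Q = 1 \<and>
     (\<forall>i. degree (poly.coeff Q i) < degree (Pi_poly q k m 0 div Pi_poly q k m j)) \<and>
     (\<forall>\<delta>\<in>D_set q k m. d_deg k m \<delta> \<le> j \<longrightarrow>
        K_red \<delta> Q = Y ^ (j - d_deg k m \<delta>) * p_gcd k m \<delta>))"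

definition B_set :: "nat \<Rightarrow> nat \<Rightarrow> nat \<Rightarrow> int \<Rightarrow> bipoly set" where
  "B_set q k m e =
     {[:Pi_poly q k m 0:], Y ^ gcd m k - [:h_poly q k m e:]} \<union>
     (\<lambda>j. [:Pi_poly q k m j:] * Q_poly q k m j) ` (S_set q k m - {0, gcd m k})"

end

theory Submission
  imports
    Defs
    "HOL-Number_Theory.Totient"
    "HOL-Computational_Algebra.Fundamental_Theorem_Algebra"
    "HOL-Computational_Algebra.Field_as_Ring"
begin

text \<open>
  The second elementary ideal can be read off from the six Fox derivatives of the two relators.
  The derivatives with respect to \<open>a\<close> are unit multiples of \<open>(x - 1) H\<^sub>m\<close> and \<open>(x - 1) G\<^sub>k\<close>; the
  other ones are \<open>\<plusminus> A\<^sub>q\<close> plus multiples of \<open>H\<^sub>m\<close> or \<open>G\<^sub>k\<close>.  Since \<open>A\<^sub>q(1) = 1\<close>, the factor \<open>x - 1\<close> is a unit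
  modulo \<open>A\<^sub>q\<close>, so that \<open>A\<^sub>q, G\<^sub>k, H\<^sub>m\<close> generate the elementary ideal.  As \<open>G\<^sub>k\<close> is 1 plus a multiple of
  \<open>xy\<close>, both variables are units modulo \<open>I\<close>, and intersecting with \<open>\<rat>[x, y]\<close> adds nothing to
  \<open>I\<close> (\<open>pretzel_ideal\<close>).

  For odd \<open>q\<close> the polynomial \<open>A\<^sub>q\<close> is the product of the pairwise coprime cyclotomic polynomials
  \<open>\<Phi>\<^sub>2\<^sub>\<delta>\<close> with \<open>\<delta> > 1\<close> dividing \<open>q\<close>.  By the Chinese remainder theorem, \<open>f\<close> lies in \<open>I\<close> if and only if it
  lies in every fibre ideal \<open>(\<Phi>\<^sub>2\<^sub>\<delta>, G\<^sub>k, H\<^sub>m) = (\<Phi>\<^sub>2\<^sub>\<delta>, p\<^sub>\<delta>)\<close> (\<open>I_iff\<close>).  In such a fibre \<open>x\<close> behaves like a root of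
  unity of order \<open>2\<delta>\<close>, and \<open>(y - x) H\<^sub>m = y^m - x^m\<close>, while \<open>G\<^sub>k\<close> is, up to a unit, the cofactor of
  \<open>y - 1/x\<close> in \<open>y^k - x^-k\<close>.  If \<open>\<delta>\<close> divides \<open>lcm m k\<close>, the Euclidean algorithm in the
  exponents shows that the two binomials generate the same ideal as \<open>y^g - x^e\<close>; otherwise they generate the unit ideal.
  At \<open>y = x\<close> the value \<open>m x^(m-1)\<close> of \<open>H\<^sub>m\<close> is a unit, and at \<open>y = 1/x\<close> the value \<open>k\<close> of \<open>G\<^sub>k\<close> is one.  Hence
  \<open>p\<^sub>\<delta>\<close> is \<open>y^g - x^e\<close> without the factors \<open>y - x\<close> and \<open>y - 1/x\<close>, and these are factors
  exactly when \<open>\<delta>\<close> divides \<open>k\<close>, respectively \<open>m\<close>.  So \<open>d\<^sub>\<delta> = g - [\<delta> | k] - [\<delta> | m]\<close>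
  (\<open>p_gcd_fibre\<close>).  All inverses that occur come from the fact that \<open>x^j - 1\<close> is coprime to
  \<open>\<Phi>\<^sub>2\<^sub>\<delta>\<close> unless \<open>2\<delta>\<close> divides \<open>j\<close>.

  If \<open>f \<in> I\<close> has y-degree \<open>n < g\<close>, then \<open>f\<close> vanishes in every fibre with \<open>d\<^sub>\<delta> > n\<close>, because the monic
  \<open>p\<^sub>\<delta>\<close> divides it there.  So \<open>\<Pi>\<^sub>n\<close> divides the leading coefficient of \<open>f\<close> (\<open>lead_coeff_dvd\<close>), and
  the leading monomial of \<open>f\<close> is a multiple of that of \<open>\<Pi>\<^sub>j Q\<^sub>j\<close>, where \<open>j\<close> is the largest
  fibre degree not exceeding \<open>n\<close>, or of that of \<open>\<Pi>\<^sub>0\<close> if there is none.  This is the Groebner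
  basis property (\<open>groebner_B\<close>); the bound four follows since the fibre degrees lie in \<open>{g, g - 1, g - 2}\<close>.

  Finally, every finite Groebner basis without 0 interreduces to the unique reduced one
  (\<open>interreduces_to_reduced_groebner_basis\<close>): redundant elements are reduced to 0, then leading
  coefficients are normalised, then tails are reduced.
\<close>

section \<open>Ideals\<close>

interpretation ring_module: Modules.module "(*) :: 'a::comm_ring_1 \<Rightarrow> 'a \<Rightarrow> 'a"
  by unfold_locales (simp_all add: algebra_simps)

(* as a rewrite rule, scale_scale is associativity of multiplication from right to left *)
declare ring_module.scale_scale [simp del]

definition is_ideal :: "'a::comm_ring_1 set \<Rightarrow> bool" where
  "is_ideal J \<longleftrightarrow> ring_module.subspace J"

lemma is_idealI:
  assumes "0 \<in> J" "\<And>a b. a \<in> J \<Longrightarrow> b \<in> J \<Longrightarrow> a + b \<in> J" "\<And>c a. a \<in> J \<Longrightarrow> c * a \<in> J"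
  shows "is_ideal J"
  using assms unfolding is_ideal_def ring_module.subspace_def by blast

lemma is_ideal_ideal_gen [simp, intro]: "is_ideal (ideal_gen S)"
  by (simp add: is_ideal_def)

lemma ideal_0: "is_ideal J \<Longrightarrow> 0 \<in> J"
  and ideal_add: "is_ideal J \<Longrightarrow> a \<in> J \<Longrightarrow> b \<in> J \<Longrightarrow> a + b \<in> J"
  and ideal_mult: "is_ideal J \<Longrightarrow> a \<in> J \<Longrightarrow> c * a \<in> J"
  unfolding is_ideal_def ring_module.subspace_def by blast+

lemma ideal_mult_right: "is_ideal J \<Longrightarrow> a \<in> J \<Longrightarrow> a * c \<in> J"
  using ideal_mult[of J a c] by (simp add: mult.commute)

lemma ideal_uminus: "is_ideal J \<Longrightarrow> a \<in> J \<Longrightarrow> - a \<in> J"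
  using ideal_mult[of J a "-1"] by simp

lemma ideal_diff: "is_ideal J \<Longrightarrow> a \<in> J \<Longrightarrow> b \<in> J \<Longrightarrow> a - b \<in> J"
  using ideal_add[of J a "-b"] ideal_uminus[of J b] by simp

lemma ideal_gen_base: "a \<in> S \<Longrightarrow> a \<in> ideal_gen S"
  by (rule ring_module.span_base)

lemma ideal_gen_least: "S \<subseteq> J \<Longrightarrow> is_ideal J \<Longrightarrow> ideal_gen S \<subseteq> J"
  unfolding is_ideal_def by (rule ring_module.span_minimal)

lemma ideal_gen_eqI:
  assumes "S \<subseteq> ideal_gen T" "T \<subseteq> ideal_gen S"
  shows "ideal_gen S = ideal_gen T"
  using assms by (meson equalityI ideal_gen_least is_ideal_ideal_gen)

section \<open>Monomials\<close>

definition lex_less :: "nat \<times> nat \<Rightarrow> nat \<times> nat \<Rightarrow> bool" where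
  "lex_less s t \<longleftrightarrow> (s, t) \<in> less_than <*lex*> less_than"

definition exp_dvd :: "nat \<times> nat \<Rightarrow> nat \<times> nat \<Rightarrow> bool" where
  "exp_dvd s t \<longleftrightarrow> fst s \<le> fst t \<and> snd s \<le> snd t"

lemma lex_less_iff: "lex_less s t \<longleftrightarrow> fst s < fst t \<or> fst s = fst t \<and> snd s < snd t"
  by (cases s; cases t) (auto simp: lex_less_def)

lemma wf_lex_less: "wfP lex_less"
  unfolding lex_less_def wfp_def by (simp add: wf_lex_prod)

lemma lex_less_linear: "lex_less s t \<or> s = t \<or> lex_less t s"
  by (cases s; cases t) (auto simp: lex_less_iff)

lemma lex_less_trans: "lex_less s t \<Longrightarrow> lex_less t u \<Longrightarrow> lex_less s u"
  by (auto simp: lex_less_iff)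

lemma lex_less_irrefl [simp]: "\<not> lex_less s s"
  by (auto simp: lex_less_iff)

lemma exp_dvd_refl [simp]: "exp_dvd s s" by (simp add: exp_dvd_def)

lemma exp_dvd_trans: "exp_dvd s t \<Longrightarrow> exp_dvd t u \<Longrightarrow> exp_dvd s u"
  by (auto simp: exp_dvd_def)

lemma exp_dvd_antisym: "exp_dvd s t \<Longrightarrow> exp_dvd t s \<Longrightarrow> s = t"
  by (auto simp: exp_dvd_def prod_eq_iff)

lemma exp_dvd_not_lex_less: "exp_dvd s t \<Longrightarrow> \<not> lex_less t s"
  by (auto simp: exp_dvd_def lex_less_iff)

lemma X_power: "X ^ i = [:monom 1 i:]"
  by (induction i) (simp_all add: X_def monom_Suc one_pCons)

lemma Y_power: "Y ^ j = monom 1 j"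
  by (induction j) (simp_all add: Y_def monom_Suc)

lemma mono_xy_monom: "mono_xy (j, i) = monom (monom 1 i) j"
  by (simp add: mono_xy_def X_power Y_power mult.commute smult_monom)

lemma coef_ext: "(\<And>t. coef f t = coef g t) \<Longrightarrow> f = g"
  by (rule poly_eqI, rule poly_eqI) (auto simp: coef_def)

lemma coef_simps [simp]:
  "coef 0 t = 0" "coef (f + g) t = coef f t + coef g t" "coef (f - g) t = coef f t - coef g t"
  "coef (- f) t = - coef f t" "coef (const_xy c * f) t = c * coef f t"
  by (auto simp: coef_def const_xy_def split: prod.splits)

lemma coef_mono_mult:
  "coef (mono_xy s * f) t = (if exp_dvd s t then coef f (t - s) else 0)"
  by (cases s; cases t) (auto simp: mono_xy_monom coef_def exp_dvd_def coeff_monom_mult)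

lemma coef_mono_xy: "coef (mono_xy s) t = (if s = t then 1 else 0)"
  by (cases s; cases t) (auto simp: mono_xy_monom coef_def)

lemma coef_sum: "coef (sum f A) t = (\<Sum>a\<in>A. coef (f a) t)"
  by (induction A rule: infinite_finite_induct) simp_all

lemma mono_xy_nz [simp]: "mono_xy t \<noteq> 0"
  using coef_mono_xy[of t t] by auto

lemma mono_xy_add: "mono_xy (s + t) = mono_xy s * mono_xy t"
  by (cases s; cases t) (simp add: mono_xy_monom mult_monom)

lemma mono_xy_inj: "mono_xy s = mono_xy t \<longleftrightarrow> s = t"
  by (metis coef_mono_xy zero_neq_one)

lemma mono_xy_split: "exp_dvd s t \<Longrightarrow> mono_xy t = mono_xy s * mono_xy (t - s)"
  by (subst mono_xy_add[symmetric]) (auto simp: exp_dvd_def mono_xy_inj prod_eq_iff)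

lemma mono_xy_dvd_iff: "mono_xy s dvd mono_xy t \<longleftrightarrow> exp_dvd s t"
proof
  assume "mono_xy s dvd mono_xy t"
  then obtain f where f: "mono_xy t = mono_xy s * f" by (elim dvdE)
  have "coef (mono_xy t) t = 1" by (simp add: coef_mono_xy)
  then show "exp_dvd s t" unfolding f coef_mono_mult by (auto split: if_splits)
qed (auto dest: mono_xy_split)

lemma mono_xy_div: "exp_dvd s t \<Longrightarrow> mono_xy t div mono_xy s = mono_xy (t - s)"
  using nonzero_mult_div_cancel_left[OF mono_xy_nz, of s "mono_xy (t - s)"] mono_xy_split[of s t] by simp

lemma finite_exps: "finite (exps f)"
proof (rule finite_subset)
  show "exps f \<subseteq> (SIGMA j:{..degree f}. {..degree (poly.coeff f j)})"
    by (auto simp: exps_def coef_def intro!: le_degree)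
qed simp

lemma bipoly_as_sum: "f = (\<Sum>t\<in>exps f. const_xy (coef f t) * mono_xy t)"
proof (rule coef_ext)
  fix s
  have "coef (\<Sum>t\<in>exps f. const_xy (coef f t) * mono_xy t) s
      = (\<Sum>t\<in>exps f. if t = s then coef f t else 0)"
    by (simp add: coef_sum coef_mono_xy if_distrib cong: if_cong)
  also have "\<dots> = coef f s"
    using finite_exps[of f] by (subst sum.delta) (auto simp: exps_def)
  finally show "coef f s = coef (\<Sum>t\<in>exps f. const_xy (coef f t) * mono_xy t) s" by simp
qed

section \<open>Leading exponents\<close>

lemma lead_exp_eqI:
  assumes "t \<in> exps f" "\<And>s. s \<in> exps f \<Longrightarrow> s = t \<or> lex_less s t"
  shows "lead_exp f = t"
  unfolding lead_exp_def
proof (rule the_equality)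
  show "t \<in> exps f \<and> (\<forall>s\<in>exps f. s = t \<or> (s, t) \<in> less_than <*lex*> less_than)"
    using assms by (auto simp: lex_less_def)
next
  fix u assume "u \<in> exps f \<and> (\<forall>s\<in>exps f. s = u \<or> (s, u) \<in> less_than <*lex*> less_than)"
  then have "u = t \<or> lex_less u t" "t = u \<or> lex_less t u"
    using assms unfolding lex_less_def by auto
  then show "u = t"
    using lex_less_trans[of u t u] by auto
qed

lemma lead_exp_eq:
  assumes "f \<noteq> 0"
  shows "lead_exp f = (degree f, degree (lead_coeff f))"
proof (rule lead_exp_eqI)
  show "(degree f, degree (lead_coeff f)) \<in> exps f"
    using assms by (simp add: exps_def coef_def)
next
  fix s assume s: "s \<in> exps f"
  obtain j i where ji: "s = (j, i)" by (cases s)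
  have c: "poly.coeff (poly.coeff f j) i \<noteq> 0" using s by (simp add: exps_def coef_def ji)
  then have "j \<le> degree f" by (intro le_degree) auto
  moreover have "i \<le> degree (poly.coeff f j)" using c by (rule le_degree)
  ultimately show "s = (degree f, degree (lead_coeff f)) \<or> lex_less s (degree f, degree (lead_coeff f))"
    by (auto simp: ji lex_less_iff)
qed

lemma lead_exp_in: "f \<noteq> 0 \<Longrightarrow> lead_exp f \<in> exps f"
  by (simp add: lead_exp_eq exps_def coef_def)

lemma lead_cf_nz: "f \<noteq> 0 \<Longrightarrow> lead_cf f \<noteq> 0"
  using lead_exp_in[of f] by (simp add: lead_cf_def exps_def)

lemma lead_exp_max:
  assumes "s \<in> exps f"
  shows "s = lead_exp f \<or> lex_less s (lead_exp f)"
proof -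
  have f: "f \<noteq> 0" using assms by (auto simp: exps_def)
  obtain j i where ji: "s = (j, i)" by (cases s)
  have c: "poly.coeff (poly.coeff f j) i \<noteq> 0" using assms by (simp add: exps_def coef_def ji)
  then have "j \<le> degree f" by (intro le_degree) auto
  moreover have "i \<le> degree (poly.coeff f j)" using c by (rule le_degree)
  ultimately show ?thesis
    unfolding lead_exp_eq[OF f] by (auto simp: ji lex_less_iff)
qed

lemma coef_above_lead: "lex_less (lead_exp f) t \<Longrightarrow> coef f t = 0"
  using lead_exp_max[of t f] lex_less_trans[of t "lead_exp f" t] by (auto simp: exps_def)

lemma lead_exp_same:
  assumes "coef f' (lead_exp f) \<noteq> 0" "\<And>t. lex_less (lead_exp f) t \<Longrightarrow> coef f' t = 0"
  shows "lead_exp f' = lead_exp f"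
proof (rule lead_exp_eqI)
  fix s assume "s \<in> exps f'"
  then show "s = lead_exp f \<or> lex_less s (lead_exp f)"
    using assms(2)[of s] lex_less_linear[of s "lead_exp f"] by (auto simp: exps_def)
qed (use assms in \<open>simp add: exps_def\<close>)

section \<open>Groebner bases\<close>

text \<open>The polynomials all of whose exponents are divisible by an exponent in \<open>T\<close> contain the
  generators; they form an ideal, because multiplication by a monomial shifts exponents.\<close>

lemma exps_in_monomial_ideal:
  assumes "f \<in> ideal_gen (mono_xy ` T)" "t \<in> exps f"
  shows "\<exists>s\<in>T. exp_dvd s t"
proof -
  let ?J = "{f. \<forall>t\<in>exps f. \<exists>s\<in>T. exp_dvd s t}"
  have step: "const_xy c * (mono_xy u * a) \<in> ?J" if "a \<in> ?J" for c u a
  proof safe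
    fix p q assume "(p, q) \<in> exps (const_xy c * (mono_xy u * a))"
    then have "coef (mono_xy u * a) (p, q) \<noteq> 0"
      using coef_simps(5)[of c "mono_xy u * a" "(p, q)"] by (auto simp: exps_def)
    then have "exp_dvd u (p, q)" "(p, q) - u \<in> exps a"
      by (auto simp: exps_def coef_mono_mult split: if_splits)
    with that obtain s where "s \<in> T" "exp_dvd s ((p, q) - u)" by blast
    then show "\<exists>s\<in>T. exp_dvd s (p, q)" by (intro bexI[of _ s]) (auto simp: exp_dvd_def)
  qed
  have add: "a + b \<in> ?J" if "a \<in> ?J" "b \<in> ?J" for a b
  proof safe
    fix p q assume "(p, q) \<in> exps (a + b)"
    then have "(p, q) \<in> exps a \<or> (p, q) \<in> exps b" by (auto simp: exps_def)
    with that show "\<exists>s\<in>T. exp_dvd s (p, q)" by blast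
  qed
  have zero: "0 \<in> ?J" by (simp add: exps_def)
  have smult: "c * a \<in> ?J" if a: "a \<in> ?J" for c a
  proof -
    have "sum (\<lambda>u. const_xy (coef c u) * (mono_xy u * a)) A \<in> ?J" if "finite A" for A
      using that
    proof (induction A)
      case empty
      show ?case using zero by simp
    next
      case (insert u A)
      then show ?case unfolding sum.insert[OF insert.hyps] by (intro add step a)
    qed
    from this[OF finite_exps[of c]]
    have "(\<Sum>u\<in>exps c. const_xy (coef c u) * mono_xy u) * a \<in> ?J"
      unfolding sum_distrib_right by (simp only: mult.assoc)
    then show "c * a \<in> ?J" unfolding bipoly_as_sum[of c, symmetric] .
  qed
  have "is_ideal ?J" by (rule is_idealI[OF zero add smult])
  moreover have "mono_xy ` T \<subseteq> ?J"
  proof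
    fix p assume "p \<in> mono_xy ` T"
    then obtain s where s: "s \<in> T" "p = mono_xy s" by blast
    have "t = s" if "t \<in> exps p" for t
      using that unfolding s(2) exps_def coef_mono_xy by (simp split: if_splits)
    then show "p \<in> ?J" using s(1) exp_dvd_refl by blast
  qed
  ultimately show ?thesis using assms ideal_gen_least[of "mono_xy ` T" ?J] by blast
qed

lemma mono_xy_in_monomial_ideal:
  "mono_xy t \<in> ideal_gen (mono_xy ` T) \<longleftrightarrow> (\<exists>s\<in>T. exp_dvd s t)"
proof
  assume "mono_xy t \<in> ideal_gen (mono_xy ` T)"
  then show "\<exists>s\<in>T. exp_dvd s t"
    by (rule exps_in_monomial_ideal) (simp add: exps_def coef_mono_xy)
next
  assume "\<exists>s\<in>T. exp_dvd s t"
  then obtain s where "s \<in> T" "exp_dvd s t" by blast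
  then show "mono_xy t \<in> ideal_gen (mono_xy ` T)"
    by (subst mono_xy_split[of s]) (auto intro: ideal_mult_right[OF is_ideal_ideal_gen] ideal_gen_base)
qed

lemma lead_mono_image: "lead_mono ` A = mono_xy ` (lead_exp ` A)"
  by (auto simp: lead_mono_def)

text \<open>Both initial ideals are monomial, and a monomial lies in a monomial ideal only if some
  generator divides it.  The comparison of ideals thus becomes a comparison of exponents.\<close>

lemma groebner_basis_iff:
  "is_groebner_basis G I \<longleftrightarrow>
     finite G \<and> G \<subseteq> I \<and> (\<forall>f\<in>I - {0}. \<exists>g\<in>G - {0}. exp_dvd (lead_exp g) (lead_exp f))"
proof
  assume G: "is_groebner_basis G I"
  have "\<exists>g\<in>G - {0}. exp_dvd (lead_exp g) (lead_exp f)" if f: "f \<in> I - {0}" for f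
  proof -
    have "lead_mono f \<in> ideal_gen (lead_mono ` (G - {0}))"
      using G f unfolding is_groebner_basis_def by (auto simp: initial_ideal_def intro!: ideal_gen_base)
    then show ?thesis
      unfolding lead_mono_image lead_mono_def mono_xy_in_monomial_ideal by blast
  qed
  with G show "finite G \<and> G \<subseteq> I \<and> (\<forall>f\<in>I - {0}. \<exists>g\<in>G - {0}. exp_dvd (lead_exp g) (lead_exp f))"
    unfolding is_groebner_basis_def by blast
next
  assume *: "finite G \<and> G \<subseteq> I \<and> (\<forall>f\<in>I - {0}. \<exists>g\<in>G - {0}. exp_dvd (lead_exp g) (lead_exp f))"
  have "ideal_gen (lead_mono ` (G - {0})) = ideal_gen (lead_mono ` (I - {0}))"
  proof (rule ideal_gen_eqI)
    show "lead_mono ` (G - {0}) \<subseteq> ideal_gen (lead_mono ` (I - {0}))"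
      using * by (auto intro!: ideal_gen_base)
    show "lead_mono ` (I - {0}) \<subseteq> ideal_gen (lead_mono ` (G - {0}))"
    proof
      fix p assume "p \<in> lead_mono ` (I - {0})"
      then obtain f where f: "f \<in> I - {0}" "p = mono_xy (lead_exp f)" by (auto simp: lead_mono_def)
      then show "p \<in> ideal_gen (lead_mono ` (G - {0}))"
        using * unfolding lead_mono_image f(2) mono_xy_in_monomial_ideal by blast
    qed
  qed
  with * show "is_groebner_basis G I" by (simp add: is_groebner_basis_def initial_ideal_def)
qed

section \<open>Interreduction\<close>

text \<open>Reducing at \<open>t\<close> leaves the coefficients above \<open>t\<close> alone.  All termination arguments below
  rest on this.\<close>

lemma red_step_exists:
  assumes "g \<in> G" "g \<noteq> 0" "t \<in> exps f" "exp_dvd (lead_exp g) t"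
  obtains f' q where "red_step G f f'" "f' = f - q * g"
    "coef f' t = 0" "\<And>u. lex_less t u \<Longrightarrow> coef f' u = coef f u"
proof -
  let ?f' = "f - const_xy (coef f t / lead_cf g) * (mono_xy t div lead_mono g) * g"
  have r': "red_step G f ?f'"
    using assms unfolding red_step_def
    by (auto simp: lead_mono_def mono_xy_dvd_iff intro!: bexI[of _ t] bexI[of _ g])
  have "coef ?f' t = 0 \<and> (\<forall>u. lex_less t u \<longrightarrow> coef ?f' u = coef f u)"
  proof -
    let ?c = "coef f t / lead_cf g"
    let ?s = "t - lead_exp g"
    have f'': "?f' = f - const_xy ?c * (mono_xy ?s * g)"
      unfolding lead_mono_def mono_xy_div[OF assms(4)] by (simp only: mult.assoc)
    have c: "coef ?f' u = coef f u - ?c * (if exp_dvd ?s u then coef g (u - ?s) else 0)" for u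
      unfolding f'' coef_simps(3) coef_simps(5) coef_mono_mult ..
    have ts: "t - ?s = lead_exp g" "exp_dvd ?s t"
      using assms(4) by (auto simp: exp_dvd_def prod_eq_iff)
    have "coef ?f' t = 0"
      using assms lead_cf_nz[of g] unfolding c ts(1) by (simp add: ts(2) lead_cf_def)
    moreover have "coef ?f' u = coef f u" if "lex_less t u" for u
    proof (cases "exp_dvd ?s u")
      case True
      then have "lex_less (lead_exp g) (u - ?s)"
        using that assms(4) by (auto simp: exp_dvd_def lex_less_iff)
      then show ?thesis unfolding c by (simp add: coef_above_lead)
    next
      case False
      then show ?thesis unfolding c by simp
    qed
    ultimately show ?thesis by blast
  qed
  with r' show ?thesis
    by (intro that[of ?f' "const_xy (coef f t / lead_cf g) * (mono_xy t div lead_mono g)"]) auto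
qed

lemma interreduction_red:
  "f \<in> G \<Longrightarrow> red_step (G - {f}) f f' \<Longrightarrow> interreduction_step G ((G - {f}) \<union> ({f'} - {0}))"
  unfolding interreduction_step_def by blast

lemma interreduction_monic:
  "f \<in> G \<Longrightarrow> f \<noteq> 0 \<Longrightarrow> interreduction_step G ((G - {f}) \<union> ({const_xy (1 / lead_cf f) * f} - {0}))"
  unfolding interreduction_step_def by blast

text \<open>A member of the ideal is reduced to 0 by cancelling leading monomials, which decrease.  Should
  an intermediate remainder already belong to \<open>F\<close>, then the current set is \<open>F\<close> itself.\<close>

lemma interreduction_remove:
  assumes I: "is_ideal I" and F: "is_groebner_basis F I" "0 \<notin> F"
    and f: "f \<in> I"
  shows "interreduction_step\<^sup>*\<^sup>* (insert f F - {0}) F"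
  using f
proof (induction "lead_exp f" arbitrary: f rule: wfp_induct_rule[OF wf_lex_less])
  case (1 f)
  show ?case
  proof (cases "f = 0 \<or> f \<in> F")
    case True
    then have "insert f F - {0} = F" using F(2) by auto
    then show ?thesis by simp
  next
    case False
    then obtain g where g: "g \<in> F" "exp_dvd (lead_exp g) (lead_exp f)"
      using F(1) 1(2) unfolding groebner_basis_iff by blast
    obtain f' q where f': "red_step F f f'" "f' = f - q * g" "coef f' (lead_exp f) = 0"
        "\<And>u. lex_less (lead_exp f) u \<Longrightarrow> coef f' u = coef f u"
      using red_step_exists[of g F "lead_exp f" f] g False F(2) lead_exp_in[of f] by metis
    have G: "insert f F - {0} - {f} = F" using False F(2) by auto
    have "interreduction_step (insert f F - {0}) (F \<union> ({f'} - {0}))"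
      using interreduction_red[of f "insert f F - {0}" f'] False f'(1) unfolding G by simp
    moreover have "F \<union> ({f'} - {0}) = insert f' F - {0}" using F(2) by auto
    moreover have "interreduction_step\<^sup>*\<^sup>* (insert f' F - {0}) F"
    proof (cases "f' = 0")
      case True
      then show ?thesis using F(2) by simp
    next
      case nz: False
      have "lex_less (lead_exp f') (lead_exp f)"
        using lex_less_linear[of "lead_exp f'" "lead_exp f"] f'(3) f'(4)[of "lead_exp f'"] lead_exp_in[OF nz]
          coef_above_lead[of f "lead_exp f'"] by (auto simp: exps_def)
      moreover have "f' \<in> I"
        using F(1) g(1) 1(2) unfolding f'(2) groebner_basis_iff
        by (auto intro!: ideal_diff[OF I] ideal_mult[OF I])
      ultimately show ?thesis using 1(1) by blast
    qed
    ultimately show ?thesis by (simp only: converse_rtranclp_into_rtranclp)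
  qed
qed

definition lead_antichain :: "bipoly set \<Rightarrow> bool" where
  "lead_antichain G \<longleftrightarrow> (\<forall>f\<in>G. \<forall>g\<in>G. exp_dvd (lead_exp g) (lead_exp f) \<longrightarrow> f = g)"

text \<open>An element whose leading monomial is a multiple of another leading monomial is redundant, so
  the remaining elements reduce it to 0.\<close>

lemma interreduction_to_antichain:
  assumes I: "is_ideal I" and "is_groebner_basis G I" "0 \<notin> G"
  shows "\<exists>F. interreduction_step\<^sup>*\<^sup>* G F \<and> is_groebner_basis F I \<and> 0 \<notin> F \<and> lead_antichain F"
  using assms(2,3)
proof (induction "card G" arbitrary: G rule: less_induct)
  case less
  show ?case
  proof (cases "lead_antichain G")
    case True
    then show ?thesis using less.prems by blast
  next
    case False
    then obtain f g where fg: "f \<in> G" "g \<in> G" "exp_dvd (lead_exp g) (lead_exp f)" "f \<noteq> g"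
      by (auto simp: lead_antichain_def)
    have G: "finite G" "G \<subseteq> I" and cov: "\<And>h. h \<in> I - {0} \<Longrightarrow> \<exists>g\<in>G - {0}. exp_dvd (lead_exp g) (lead_exp h)"
      using less.prems unfolding groebner_basis_iff by auto
    have F: "is_groebner_basis (G - {f}) I"
      unfolding groebner_basis_iff
    proof (intro conjI ballI)
      fix h assume "h \<in> I - {0}"
      then obtain k where k: "k \<in> G - {0}" "exp_dvd (lead_exp k) (lead_exp h)" using cov by blast
      show "\<exists>g\<in>G - {f} - {0}. exp_dvd (lead_exp g) (lead_exp h)"
      proof (cases "k = f")
        case True
        then have "exp_dvd (lead_exp g) (lead_exp h)" using fg(3) k(2) exp_dvd_trans by blast
        then show ?thesis using fg less.prems(2) by auto
      qed (use k in auto)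
    qed (use G in auto)
    have "card (G - {f}) < card G" using fg(1) G(1) by (meson card_Diff1_less)
    from less.hyps[OF this F] obtain F' where
      F': "interreduction_step\<^sup>*\<^sup>* (G - {f}) F'" "is_groebner_basis F' I" "0 \<notin> F'" "lead_antichain F'"
      using less.prems by blast
    have "interreduction_step\<^sup>*\<^sup>* (insert f (G - {f}) - {0}) (G - {f})"
      using fg(1) G(2) less.prems(2) by (intro interreduction_remove[OF I F]) auto
    moreover have "insert f (G - {f}) - {0} = G" using fg(1) less.prems(2) by auto
    ultimately have "interreduction_step\<^sup>*\<^sup>* G F'" using F'(1) by (metis rtranclp_trans)
    with F' show ?thesis by blast
  qed
qed

text \<open>Being a Groebner basis depends only on leading exponents, so normalising an element or
  reducing its tail is harmless.\<close>

lemma groebner_basis_replace: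
  assumes "is_groebner_basis G I" "0 \<notin> G" "lead_antichain G" "f \<in> G"
    and "f' \<in> I" "f' \<noteq> 0" "lead_exp f' = lead_exp f"
  shows "is_groebner_basis (insert f' (G - {f})) I" "lead_antichain (insert f' (G - {f}))"
    "f' \<notin> G - {f}"
proof -
  show "is_groebner_basis (insert f' (G - {f})) I"
    using assms(1,2,4-7) unfolding groebner_basis_iff by (auto simp: Ball_def Bex_def) metis
  show "lead_antichain (insert f' (G - {f}))"
    using assms(3,4,7) unfolding lead_antichain_def by auto
  show "f' \<notin> G - {f}"
    using assms(3,4,7) unfolding lead_antichain_def by auto
qed

lemma const_xy_lead: "c \<noteq> 0 \<Longrightarrow> f \<noteq> 0 \<Longrightarrow> lead_exp (const_xy c * f) = lead_exp f \<and> lead_cf (const_xy c * f) = c * lead_cf f"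
  using lead_exp_same[of "const_xy c * f" f] lead_cf_nz[of f]
  by (simp add: lead_cf_def coef_above_lead)

lemma interreduction_to_monic:
  assumes I: "is_ideal I" and "is_groebner_basis G I" "0 \<notin> G" "lead_antichain G"
  shows "\<exists>F. interreduction_step\<^sup>*\<^sup>* G F \<and> is_groebner_basis F I \<and> 0 \<notin> F \<and> lead_antichain F \<and>
    (\<forall>f\<in>F. lead_cf f = 1)"
  using assms(2-)
proof (induction "card {f\<in>G. lead_cf f \<noteq> 1}" arbitrary: G rule: less_induct)
  case less
  show ?case
  proof (cases "\<exists>f\<in>G. lead_cf f \<noteq> 1")
    case False
    then show ?thesis using less.prems by blast
  next
    case True
    then obtain f where f: "f \<in> G" "lead_cf f \<noteq> 1" by blast
    have f0: "f \<noteq> 0" using f less.prems by auto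
    define f' where "f' = const_xy (1 / lead_cf f) * f"
    have l: "lead_exp f' = lead_exp f" "lead_cf f' = 1"
      using const_xy_lead[of "1 / lead_cf f" f] lead_cf_nz[OF f0] f0 by (auto simp: f'_def)
    have nz: "f' \<noteq> 0"
    proof
      assume "f' = 0"
      with l(2) have "lead_cf 0 = 1" by simp
      then show False by (simp add: lead_cf_def)
    qed
    have "f \<in> I" "finite G" using less.prems(1) f(1) unfolding groebner_basis_iff by auto
    then have fI: "f' \<in> I" unfolding f'_def by (intro ideal_mult[OF I])
    note r = groebner_basis_replace[OF less.prems f(1) fI nz l(1)]
    have "{h \<in> insert f' (G - {f}). lead_cf h \<noteq> 1} = {h\<in>G. lead_cf h \<noteq> 1} - {f}"
      using l(2) by blast
    then have "card {h \<in> insert f' (G - {f}). lead_cf h \<noteq> 1} < card {h\<in>G. lead_cf h \<noteq> 1}"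
      using f \<open>finite G\<close> by (simp only:) (intro card_Diff1_less, simp_all)
    from less.hyps[OF this r(1) _ r(2)] obtain F where
      "interreduction_step\<^sup>*\<^sup>* (insert f' (G - {f})) F" "is_groebner_basis F I" "0 \<notin> F" "lead_antichain F"
      "\<forall>f\<in>F. lead_cf f = 1" using nz less.prems(2) by auto
    moreover have "interreduction_step G (insert f' (G - {f}))"
      using interreduction_monic[OF f(1) f0, folded f'_def] nz by simp
    ultimately show ?thesis using converse_rtranclp_into_rtranclp[of interreduction_step G] by blast
  qed
qed

definition tail_reduced :: "bipoly set \<Rightarrow> bipoly \<Rightarrow> bool" where
  "tail_reduced G f \<longleftrightarrow> (\<forall>g\<in>G - {f}. \<forall>t\<in>exps f. \<not> exp_dvd (lead_exp g) t)"

text \<open>The bound \<open>b\<close> on the reducible exponents drives the induction: reducing at the largest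
  one makes it the new bound.\<close>

lemma interreduction_tail:
  assumes I: "is_ideal I" and F: "F \<subseteq> I" "0 \<notin> F"
    and "f \<in> I" "f \<notin> F" "lead_cf f = 1"
    and "is_groebner_basis (insert f F) I" "lead_antichain (insert f F)"
    and "\<And>g t. g \<in> F \<Longrightarrow> t \<in> exps f \<Longrightarrow> exp_dvd (lead_exp g) t \<Longrightarrow> lex_less t b"
  shows "\<exists>f'. interreduction_step\<^sup>*\<^sup>* (insert f F) (insert f' F) \<and> f' \<notin> F \<and> f' \<in> I \<and> lead_cf f' = 1 \<and>
    lead_exp f' = lead_exp f \<and> (\<forall>g\<in>F. \<forall>t\<in>exps f'. \<not> exp_dvd (lead_exp g) t)"
  using assms(4-)
proof (induction b arbitrary: f rule: wfp_induct_rule[OF wf_lex_less])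
  case (1 b f)
  let ?T = "{t\<in>exps f. \<exists>g\<in>F. exp_dvd (lead_exp g) t}"
  show ?case
  proof (cases "?T = {}")
    case True
    then show ?thesis using 1 by (intro exI[of _ f]) auto
  next
    case False
    have "finite ?T" using finite_exps[of f] by simp
    have "\<exists>t\<in>?T. \<forall>s\<in>?T. \<not> lex_less t s"
    proof -
      have "transp_on ?T (\<lambda>s t. lex_less t s)" by (auto intro!: transp_onI elim: lex_less_trans)
      moreover have "asymp_on ?T (\<lambda>s t. lex_less t s)"
        by (auto intro!: asymp_onI dest: lex_less_trans)
      ultimately show ?thesis
        using Finite_Set.bex_min_element[of ?T "\<lambda>s t. lex_less t s"] \<open>finite ?T\<close> False
        by (metis (no_types, lifting) lex_less_irrefl)
    qed
    then obtain t where t: "t \<in> ?T" and tmax: "\<And>s. s \<in> ?T \<Longrightarrow> \<not> lex_less t s" by blast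
    obtain g where g: "g \<in> F" "exp_dvd (lead_exp g) t" using t by blast
    have f0: "f \<noteq> 0" using 1(4) by (auto simp: lead_cf_def)
    obtain f' q where f': "red_step F f f'" "f' = f - q * g" "coef f' t = 0"
        "\<And>u. lex_less t u \<Longrightarrow> coef f' u = coef f u"
      using red_step_exists[of g F t f] g t F(2) by (metis (no_types, lifting) mem_Collect_eq)
    have tne: "t \<noteq> lead_exp f"
      using 1(3,6) g unfolding lead_antichain_def by auto
    then have tl: "lex_less t (lead_exp f)" using lead_exp_max[of t f] t by auto
    have le: "lead_exp f' = lead_exp f"
      using f'(4)[OF tl] f'(4)[OF lex_less_trans[OF tl]] coef_above_lead[of f] lead_exp_in[OF f0]
      by (intro lead_exp_same) (auto simp: exps_def)
    have lc: "lead_cf f' = 1"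
      using 1(4) f'(4)[OF tl] by (simp add: lead_cf_def le)
    have f'0: "f' \<noteq> 0" using lc by (auto simp: lead_cf_def)
    have f'I: "f' \<in> I"
      unfolding f'(2) using 1(2) g(1) F(1) by (auto intro!: ideal_diff[OF I] ideal_mult[OF I])
    have G: "insert f F - {f} = F" using 1(3) by auto
    have "0 \<notin> insert f F" using f0 F(2) by auto
    note r = groebner_basis_replace[OF 1(5) this 1(6) insertI1 f'I f'0 le, unfolded G]
    have "lex_less t b" using 1(7) g t by blast
    moreover have "lex_less s t" if s: "h \<in> F" "s \<in> exps f'" "exp_dvd (lead_exp h) s" for h s
    proof -
      have "s \<noteq> t" using s(2) f'(3) by (auto simp: exps_def)
      moreover have "\<not> lex_less t s"
      proof
        assume *: "lex_less t s"
        then have "s \<in> exps f" using s(2) f'(4)[OF *] by (simp add: exps_def)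
        then show False using tmax[of s] s * by blast
      qed
      ultimately show ?thesis using lex_less_linear by blast
    qed
    ultimately obtain f'' where
      "interreduction_step\<^sup>*\<^sup>* (insert f' F) (insert f'' F)" "f'' \<notin> F" "f'' \<in> I" "lead_cf f'' = 1"
      "lead_exp f'' = lead_exp f'" "\<forall>g\<in>F. \<forall>t\<in>exps f''. \<not> exp_dvd (lead_exp g) t"
      using 1(1)[of t f'] f'I r lc by metis
    moreover have "interreduction_step (insert f F) (insert f' F)"
      using interreduction_red[of f "insert f F" f'] f'(1) f'0 unfolding G by simp
    ultimately show ?thesis
      using converse_rtranclp_into_rtranclp[of interreduction_step "insert f F"] unfolding le by blast
  qed
qed

text \<open>Whether a member is tail reduced depends only on the leading exponents of the other members.
  These do not change when a tail is reduced, so no finished member is spoilt.\<close>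

lemma interreduction_to_tail_reduced:
  assumes I: "is_ideal I" and "is_groebner_basis G I" "0 \<notin> G" "lead_antichain G"
    and "\<forall>f\<in>G. lead_cf f = 1"
  shows "\<exists>F. interreduction_step\<^sup>*\<^sup>* G F \<and> is_groebner_basis F I \<and> 0 \<notin> F \<and> lead_antichain F \<and>
    (\<forall>f\<in>F. lead_cf f = 1) \<and> (\<forall>f\<in>F. tail_reduced F f)"
  using assms(2-)
proof (induction "card {f\<in>G. \<not> tail_reduced G f}" arbitrary: G rule: less_induct)
  case less
  show ?case
  proof (cases "\<forall>f\<in>G. tail_reduced G f")
    case True
    then show ?thesis using less.prems by blast
  next
    case False
    then obtain f where f: "f \<in> G" "\<not> tail_reduced G f" by blast
    define F where "F = G - {f}"
    have G: "G = insert f F" "f \<notin> F" using f(1) by (auto simp: F_def)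
    have f0: "f \<noteq> 0" using f less.prems by auto
    have GI: "finite G" "G \<subseteq> I" using less.prems(1) unfolding groebner_basis_iff by auto
    \<comment> \<open>any exponent above all those of \<open>f\<close> starts the induction\<close>
    have bound: "lex_less t (Suc (fst (lead_exp f)), 0)" if "t \<in> exps f" for t
      using lead_exp_max[OF that] by (auto simp: lex_less_iff)
    obtain f' where f': "interreduction_step\<^sup>*\<^sup>* (insert f F) (insert f' F)" "f' \<notin> F" "f' \<in> I" "lead_cf f' = 1"
      "lead_exp f' = lead_exp f" "\<forall>g\<in>F. \<forall>t\<in>exps f'. \<not> exp_dvd (lead_exp g) t"
      using interreduction_tail[OF I, of F f "(Suc (fst (lead_exp f)), 0)"] G GI less.prems bound by auto
    have nz: "f' \<noteq> 0" using f'(4) by (auto simp: lead_cf_def)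
    note r = groebner_basis_replace[OF less.prems(1-3) f(1) f'(3) nz f'(5), folded F_def]
    have J_trans: "tail_reduced (insert f' F) h \<longleftrightarrow> tail_reduced G h" if "h \<in> F" for h
    proof -
      have "insert f' F - {h} = insert f' (F - {h})" "G - {h} = insert f (F - {h})"
        using that f'(2) G by auto
      then show ?thesis unfolding tail_reduced_def by (simp only: ball_simps f'(5))
    qed
    have tr': "tail_reduced (insert f' F) f'"
      using f'(2,6) by (auto simp: tail_reduced_def)
    have "{h \<in> insert f' F. \<not> tail_reduced (insert f' F) h} = {h\<in>G. \<not> tail_reduced G h} - {f}"
      using J_trans tr' f(2) unfolding G(1) using G(2) by blast
    then have "card {h \<in> insert f' F. \<not> tail_reduced (insert f' F) h} < card {h\<in>G. \<not> tail_reduced G h}"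
      using f GI(1) by (simp only:) (intro card_Diff1_less, simp_all)
    from less.hyps[OF this r(1) _ r(2)] obtain F' where
      "interreduction_step\<^sup>*\<^sup>* (insert f' F) F'" "is_groebner_basis F' I" "0 \<notin> F'" "lead_antichain F'"
      "\<forall>f\<in>F'. lead_cf f = 1" "\<forall>f\<in>F'. tail_reduced F' f"
      using nz less.prems f'(4) G by auto
    moreover from this(1) have "interreduction_step\<^sup>*\<^sup>* G F'"
      using f'(1) unfolding G(1) by (rule rtranclp_trans[rotated])
    ultimately show ?thesis by blast
  qed
qed

lemma reduced_groebner_basis_iff:
  "is_reduced_groebner_basis G I \<longleftrightarrow> is_groebner_basis G I \<and> 0 \<notin> G \<and>
     (\<forall>f\<in>G. lead_cf f = 1) \<and> (\<forall>f\<in>G. tail_reduced G f)"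
  unfolding is_reduced_groebner_basis_def tail_reduced_def lead_mono_def mono_xy_dvd_iff by blast

text \<open>Members of the two bases can be matched by their leading exponents.  The difference of two
  matching members has its leading exponent among their tail exponents, and it is divisible by a
  leading exponent of each basis; as both bases are reduced, the difference must be 0.\<close>

lemma reduced_groebner_basis_subset:
  assumes I: "is_ideal I" and G: "is_reduced_groebner_basis G I" and G': "is_reduced_groebner_basis G' I"
  shows "G \<subseteq> G'"
proof
  fix f assume f: "f \<in> G"
  note G1 = G[unfolded reduced_groebner_basis_iff groebner_basis_iff]
  note G2 = G'[unfolded reduced_groebner_basis_iff groebner_basis_iff]
  have f0: "f \<noteq> 0" and fI: "f \<in> I" using f G1 by auto
  then obtain f' where f': "f' \<in> G'" "exp_dvd (lead_exp f') (lead_exp f)" using G2 by blast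
  have f'0: "f' \<noteq> 0" and f'I: "f' \<in> I" using f' G2 by auto
  then obtain h where h: "h \<in> G" "exp_dvd (lead_exp h) (lead_exp f')" using G1 by blast
  have "h = f"
  proof (rule ccontr)
    assume "h \<noteq> f"
    then show False
      using G1 f h exp_dvd_trans[OF h(2) f'(2)] lead_exp_in[OF f0] unfolding tail_reduced_def by blast
  qed
  then have le: "lead_exp f' = lead_exp f" using h(2) f'(2) exp_dvd_antisym by blast
  show "f \<in> G'"
  proof (rule ccontr)
    assume "f \<notin> G'"
    then have d0: "f - f' \<noteq> 0" using f'(1) by auto
    let ?t = "lead_exp (f - f')"
    have dI: "f - f' \<in> I" using fI f'I by (rule ideal_diff[OF I])
    have t: "coef f ?t \<noteq> coef f' ?t" using lead_exp_in[OF d0] by (auto simp: exps_def)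
    have "coef f (lead_exp f) = coef f' (lead_exp f)"
      using G1 G2 f f'(1) le by (auto simp: lead_cf_def)
    then have "?t \<noteq> lead_exp f" using t by auto
    moreover have "\<not> lex_less (lead_exp f) ?t"
      using t coef_above_lead[of f ?t] coef_above_lead[of f' ?t] by (auto simp: le)
    ultimately have tl: "lex_less ?t (lead_exp f)" using lex_less_linear by blast
    obtain g where g: "g \<in> G" "g \<noteq> 0" "exp_dvd (lead_exp g) ?t" using G1 dI d0 by blast
    have gI: "g \<in> I" using g(1) G1 by auto
    obtain g' where g': "g' \<in> G'" "exp_dvd (lead_exp g') (lead_exp g)" using G2 gI g(2) by blast
    have c': "exp_dvd (lead_exp g') ?t" using exp_dvd_trans[OF g'(2) g(3)] .
    have "g \<noteq> f" "g' \<noteq> f'"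
      using exp_dvd_not_lex_less[OF g(3)] exp_dvd_not_lex_less[OF c'] tl le by auto
    moreover have "?t \<in> exps f \<or> ?t \<in> exps f'" using t by (auto simp: exps_def)
    ultimately show False
      using G1 G2 f f'(1) g g'(1) c' unfolding tail_reduced_def by blast
  qed
qed

lemma reduced_groebner_basis_eqI:
  assumes "is_ideal I" "is_reduced_groebner_basis G I"
  shows "reduced_groebner_basis I = G"
  unfolding reduced_groebner_basis_def
  using assms reduced_groebner_basis_subset[OF assms(1)] by (intro the_equality) (auto intro!: antisym)

theorem interreduces_to_reduced_groebner_basis:
  assumes I: "is_ideal I" and "is_groebner_basis G I" "0 \<notin> G"
  shows "interreduces_to G (reduced_groebner_basis I) I"
proof -
  obtain F where F: "interreduction_step\<^sup>*\<^sup>* G F" "is_groebner_basis F I" "0 \<notin> F" "lead_antichain F"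
    using interreduction_to_antichain[OF assms] by blast
  obtain F' where F': "interreduction_step\<^sup>*\<^sup>* F F'" "is_groebner_basis F' I" "0 \<notin> F'" "lead_antichain F'"
    "\<forall>f\<in>F'. lead_cf f = 1"
    using interreduction_to_monic[OF I F(2-)] by blast
  obtain H where H: "interreduction_step\<^sup>*\<^sup>* F' H" "is_groebner_basis H I" "0 \<notin> H"
    "\<forall>f\<in>H. lead_cf f = 1" "\<forall>f\<in>H. tail_reduced H f"
    using interreduction_to_tail_reduced[OF I F'(2-)] by blast
  have "is_reduced_groebner_basis H I" using H by (simp add: reduced_groebner_basis_iff)
  moreover have "reduced_groebner_basis I = H"
    using reduced_groebner_basis_eqI[OF I calculation] .
  moreover have "interreduction_step\<^sup>*\<^sup>* G H" using F(1) F'(1) H(1) by (meson rtranclp_trans)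
  ultimately show ?thesis by (simp add: interreduces_to_def)
qed

lemma reduced_groebner_basis_unit_ideal:
  assumes I: "is_ideal I" and "1 \<in> I"
  shows "reduced_groebner_basis I = {1}"
proof (rule reduced_groebner_basis_eqI[OF I])
  have m: "mono_xy (0, 0) = 1" by (simp add: mono_xy_def)
  have c: "coef 1 t = (if t = (0, 0) then 1 else 0)" for t
    using coef_mono_xy[of "(0,0)" t] unfolding m by auto
  have "lead_exp 1 = (0, 0)"
    by (rule lead_exp_eqI) (auto simp: exps_def c split: if_splits)
  then show "is_reduced_groebner_basis {1} I"
    using assms by (simp add: reduced_groebner_basis_iff groebner_basis_iff tail_reduced_def lead_cf_def c exp_dvd_def)
qed

section \<open>From polynomials to Laurent polynomials\<close>

definition exp_emb :: "nat \<times> nat \<Rightarrow> int \<times> int" where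
  "exp_emb = (\<lambda>(j, i). (int j, int i))"

lemma exp_emb_inj: "exp_emb s = exp_emb t \<longleftrightarrow> s = t"
  by (auto simp: exp_emb_def split: prod.splits)

lemma exp_emb_add: "exp_emb (s + t) = exp_emb s + exp_emb t"
  by (cases s; cases t) (simp add: exp_emb_def)

lemma to_laurent_eq: "to_laurent f = (\<Sum>t\<in>exps f. Poly_Mapping.single (exp_emb t) (coef f t))"
  unfolding to_laurent_def by (intro sum.cong) (auto simp: exp_emb_def)

lemma laurent_eqI: "(\<And>p. Poly_Mapping.lookup f p = Poly_Mapping.lookup g p) \<Longrightarrow> f = g"
  by (rule poly_mapping_eqI)

lemma lookup_to_laurent_exp_emb: "Poly_Mapping.lookup (to_laurent f) (exp_emb s) = coef f s"
proof -
  have "Poly_Mapping.lookup (to_laurent f) (exp_emb s) = (\<Sum>t\<in>exps f. if t = s then coef f t else 0)"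
    unfolding to_laurent_eq lookup_sum lookup_single exp_emb_inj by (simp add: when_def)
  also have "\<dots> = coef f s"
    using finite_exps[of f] by (subst sum.delta) (auto simp: exps_def)
  finally show ?thesis .
qed

lemma lookup_to_laurent_outside:
  assumes "p \<notin> range exp_emb"
  shows "Poly_Mapping.lookup (to_laurent f) p = 0"
  unfolding to_laurent_eq lookup_sum lookup_single using assms
  by (intro sum.neutral) (auto simp: when_def)

lemma to_laurent_add: "to_laurent (f + g) = to_laurent f + to_laurent g"
proof (rule laurent_eqI)
  fix p
  show "Poly_Mapping.lookup (to_laurent (f + g)) p = Poly_Mapping.lookup (to_laurent f + to_laurent g) p"
    by (cases "p \<in> range exp_emb") (auto simp: lookup_add lookup_to_laurent_exp_emb lookup_to_laurent_outside)
qed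

lemma to_laurent_inj: "to_laurent f = to_laurent g \<Longrightarrow> f = g"
  by (rule coef_ext) (metis lookup_to_laurent_exp_emb)

lemma to_laurent_0 [simp]: "to_laurent 0 = 0"
  using to_laurent_add[of 0 0] by simp

lemma to_laurent_sum: "to_laurent (sum f A) = (\<Sum>a\<in>A. to_laurent (f a))"
  by (induction A rule: infinite_finite_induct) (simp_all add: to_laurent_add)

lemma to_laurent_monomial: "to_laurent (const_xy c * mono_xy s) = Poly_Mapping.single (exp_emb s) c"
proof (rule laurent_eqI)
  fix p
  have e: "exp_emb s = p \<longleftrightarrow> False" if "p \<notin> range exp_emb" using that by auto
  show "Poly_Mapping.lookup (to_laurent (const_xy c * mono_xy s)) p = Poly_Mapping.lookup (Poly_Mapping.single (exp_emb s) c) p"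
    by (cases "p \<in> range exp_emb")
      (auto simp: lookup_to_laurent_exp_emb lookup_to_laurent_outside lookup_single exp_emb_inj coef_mono_xy when_def e)
qed

text \<open>Both factors are expanded into terms, on which multiplicativity is addition of exponents.\<close>

lemma to_laurent_mult: "to_laurent (f * g) = to_laurent f * to_laurent g"
proof -
  have m: "(const_xy c * mono_xy s) * (const_xy d * mono_xy t) = const_xy (c * d) * mono_xy (s + t)" for c d s t
  proof -
    have "const_xy (c * d) = const_xy c * const_xy d" by (simp add: const_xy_def)
    then show ?thesis by (simp only: mono_xy_add mult.assoc mult.left_commute)
  qed
  have "to_laurent (f * g) = to_laurent ((\<Sum>s\<in>exps f. const_xy (coef f s) * mono_xy s) *
      (\<Sum>t\<in>exps g. const_xy (coef g t) * mono_xy t))"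
    using bipoly_as_sum[of f] bipoly_as_sum[of g] by simp
  also have "\<dots> = to_laurent f * to_laurent g"
    unfolding sum_product m to_laurent_sum to_laurent_monomial to_laurent_eq[of f] to_laurent_eq[of g]
      mult_single exp_emb_add ..
  finally show ?thesis .
qed

definition yL :: laurent where "yL = Poly_Mapping.single (1, 0) 1"
definition xL :: laurent where "xL = Poly_Mapping.single (0, 1) 1"
definition yiL :: laurent where "yiL = Poly_Mapping.single (-1, 0) 1"
definition xiL :: laurent where "xiL = Poly_Mapping.single (0, -1) 1"

lemma laurent_inverses: "xL * xiL = 1" "yL * yiL = 1"
  by (simp_all add: xL_def xiL_def yL_def yiL_def mult_single flip: single_one zero_prod_def)

lemma const_xy_1: "const_xy 1 = 1"
  by (simp add: const_xy_def one_pCons)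

lemma to_laurent_1 [simp]: "to_laurent 1 = 1"
proof -
  have "mono_xy (0, 0) = 1" "exp_emb (0, 0) = 0" by (simp_all add: mono_xy_def exp_emb_def zero_prod_def)
  then show ?thesis using to_laurent_monomial[of 1 "(0,0)"] by (simp add: const_xy_1)
qed

lemma to_laurent_X: "to_laurent X = xL" and to_laurent_Y: "to_laurent Y = yL"
  using to_laurent_monomial[of 1 "(0,1)"] to_laurent_monomial[of 1 "(1,0)"]
  by (simp_all add: const_xy_1 mono_xy_def exp_emb_def xL_def yL_def)

lemma to_laurent_uminus: "to_laurent (- f) = - to_laurent f"
  using to_laurent_add[of f "- f"] by (simp add: eq_neg_iff_add_eq_0 add.commute)

lemma to_laurent_diff: "to_laurent (f - g) = to_laurent f - to_laurent g"
  using to_laurent_add[of f "- g"] by (simp add: to_laurent_uminus)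

lemma to_laurent_power: "to_laurent (f ^ n) = to_laurent f ^ n"
  by (induction n) (simp_all add: to_laurent_mult)

lemmas to_laurent_hom = to_laurent_add to_laurent_diff to_laurent_uminus to_laurent_mult
  to_laurent_power to_laurent_sum to_laurent_X to_laurent_Y to_laurent_1 to_laurent_0

lemma laurent_as_sum:
  "c = (\<Sum>p\<in>Poly_Mapping.keys c. Poly_Mapping.single p (Poly_Mapping.lookup c p))"
proof (rule laurent_eqI)
  fix q
  have "Poly_Mapping.lookup (\<Sum>p\<in>Poly_Mapping.keys c. Poly_Mapping.single p (Poly_Mapping.lookup c p)) q
    = (\<Sum>p\<in>Poly_Mapping.keys c. if p = q then Poly_Mapping.lookup c p else 0)"
    unfolding lookup_sum lookup_single by (simp add: when_def)
  also have "\<dots> = Poly_Mapping.lookup c q"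
    by (subst sum.delta) (auto simp: in_keys_iff)
  finally show "Poly_Mapping.lookup c q = Poly_Mapping.lookup
    (\<Sum>p\<in>Poly_Mapping.keys c. Poly_Mapping.single p (Poly_Mapping.lookup c p)) q" by simp
qed

lemma clear_denominators_mono:
  assumes "to_laurent ((X * Y) ^ n) * c = to_laurent f" "n \<le> N"
  shows "to_laurent ((X * Y) ^ N) * c = to_laurent ((X * Y) ^ (N - n) * f)"
proof -
  have "(X * Y) ^ N = (X * Y) ^ (N - n) * (X * Y) ^ n"
    using assms(2) by (simp flip: power_add)
  then show ?thesis by (simp only: to_laurent_mult mult.assoc assms(1))
qed

lemma clear_denominators: "\<exists>n f. to_laurent ((X * Y) ^ n) * c = to_laurent f"
proof -
  have single: "\<exists>n f. to_laurent ((X * Y) ^ n) * Poly_Mapping.single p a = to_laurent f" for p a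
  proof -
    obtain j i where p: "p = (j, i)" by (cases p)
    define n where "n = nat \<bar>j\<bar> + nat \<bar>i\<bar>"
    have "(X * Y) ^ n = const_xy 1 * mono_xy (n, n)"
      by (simp add: mono_xy_def const_xy_1 power_mult_distrib mult.commute)
    then have "to_laurent ((X * Y) ^ n) * Poly_Mapping.single p a = Poly_Mapping.single (exp_emb (n, n) + p) a"
      by (simp only: to_laurent_monomial mult_single mult_1)
    also have "exp_emb (n, n) + p = exp_emb (nat (int n + j), nat (int n + i))"
    proof -
      have "0 \<le> int n + j" "0 \<le> int n + i" unfolding n_def by linarith+
      then show ?thesis by (simp add: exp_emb_def p)
    qed
    finally show ?thesis by (metis to_laurent_monomial)
  qed
  have "\<exists>n f. to_laurent ((X * Y) ^ n) * (\<Sum>p\<in>A. Poly_Mapping.single p (Poly_Mapping.lookup c p)) = to_laurent f"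
    if "finite A" for A
    using that
  proof (induction A)
    case empty
    show ?case by (intro exI[of _ 0]) simp
  next
    case (insert p A)
    obtain n f where 1: "to_laurent ((X * Y) ^ n) * (\<Sum>p\<in>A. Poly_Mapping.single p (Poly_Mapping.lookup c p)) = to_laurent f"
      using insert.IH by blast
    obtain n' f' where 2: "to_laurent ((X * Y) ^ n') * Poly_Mapping.single p (Poly_Mapping.lookup c p) = to_laurent f'"
      using single by blast
    show ?case
      using clear_denominators_mono[OF 1, of "max n n'"] clear_denominators_mono[OF 2, of "max n n'"]
      unfolding sum.insert[OF insert.hyps] distrib_left by (metis max.cobounded1 max.cobounded2 to_laurent_add)
  qed
  from this[of "Poly_Mapping.keys c"] show ?thesis using laurent_as_sum[of c] by simp
qed

text \<open>A denominator \<open>(xy)^n\<close> can be cleared and then cancelled, since \<open>xy\<close> is a unit modulo \<open>I\<close>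
  with inverse \<open>w\<close>.\<close>

lemma contract_extend:
  assumes I: "is_ideal I" and unit: "1 - X * Y * w \<in> I"
    and f: "to_laurent f \<in> ideal_gen (to_laurent ` I)"
  shows "f \<in> I"
proof -
  let ?J = "{z. \<exists>n g. g \<in> I \<and> to_laurent ((X * Y) ^ n) * z = to_laurent g}"
  have "is_ideal ?J"
  proof (rule is_idealI)
    show "0 \<in> ?J" using ideal_0[OF I] by (auto intro!: exI[of _ "0::nat"] exI[of _ "0::bipoly"])
  next
    fix a b assume "a \<in> ?J" "b \<in> ?J"
    then obtain n g n' g' where 1: "g \<in> I" "to_laurent ((X * Y) ^ n) * a = to_laurent g"
      and 2: "g' \<in> I" "to_laurent ((X * Y) ^ n') * b = to_laurent g'" by blast
    let ?N = "max n n'"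
    have "to_laurent ((X * Y) ^ ?N) * (a + b) = to_laurent ((X * Y) ^ (?N - n) * g + (X * Y) ^ (?N - n') * g')"
      using clear_denominators_mono[OF 1(2), of ?N] clear_denominators_mono[OF 2(2), of ?N]
      by (simp only: distrib_left to_laurent_add max.cobounded1 max.cobounded2)
    moreover have "(X * Y) ^ (?N - n) * g + (X * Y) ^ (?N - n') * g' \<in> I"
      by (intro ideal_add[OF I] ideal_mult[OF I] 1 2)
    ultimately show "a + b \<in> ?J" by blast
  next
    fix c a assume "a \<in> ?J"
    then obtain n g where 1: "g \<in> I" "to_laurent ((X * Y) ^ n) * a = to_laurent g" by blast
    obtain n' h where 2: "to_laurent ((X * Y) ^ n') * c = to_laurent h" using clear_denominators by blast
    have "to_laurent ((X * Y) ^ (n' + n)) * (c * a)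
        = (to_laurent ((X * Y) ^ n') * c) * (to_laurent ((X * Y) ^ n) * a)"
      by (simp add: power_add to_laurent_mult ac_simps)
    also have "\<dots> = to_laurent (h * g)" unfolding 1 2 to_laurent_mult ..
    finally show "c * a \<in> ?J" using ideal_mult[OF I 1(1)] by blast
  qed
  moreover have "to_laurent ` I \<subseteq> ?J" by (auto intro!: exI[of _ "0::nat"])
  ultimately have "to_laurent f \<in> ?J" using ideal_gen_least f by blast
  then obtain n g where "g \<in> I" "to_laurent ((X * Y) ^ n * f) = to_laurent g"
    by (auto simp: to_laurent_mult)
  then have xf: "(X * Y) ^ n * f \<in> I" using to_laurent_inj by blast
  have "1 - (X * Y) ^ n * w ^ n \<in> I"
  proof (induction n)
    case (Suc n)
    have "1 - (X * Y) ^ Suc n * w ^ Suc n = (1 - (X * Y) ^ n * w ^ n) + ((X * Y) ^ n * w ^ n) * (1 - X * Y * w)"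
      by (simp add: algebra_simps)
    with Suc show ?case by (metis I ideal_add ideal_mult unit)
  qed (simp add: ideal_0[OF I])
  then have "(1 - (X * Y) ^ n * w ^ n) * f + w ^ n * ((X * Y) ^ n * f) \<in> I"
    by (intro ideal_add[OF I] ideal_mult[OF I xf] ideal_mult_right[OF I])
  then show ?thesis by (simp add: algebra_simps)
qed

section \<open>Fox calculus under an abelian representation\<close>

definition word_mono :: "(nat \<Rightarrow> int \<times> int) \<Rightarrow> gword \<Rightarrow> laurent" where
  "word_mono \<phi> w = Poly_Mapping.single (word_image \<phi> w) 1"

definition fox_image :: "(nat \<Rightarrow> int \<times> int) \<Rightarrow> nat \<Rightarrow> gword \<Rightarrow> laurent" where
  "fox_image \<phi> j w = eval_terms \<phi> (fox j w)"

lemma word_mono_Nil [simp]: "word_mono \<phi> [] = 1"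
  by (simp add: word_mono_def word_image_def)

lemma word_mono_append: "word_mono \<phi> (u @ v) = word_mono \<phi> u * word_mono \<phi> v"
  by (simp add: word_mono_def word_image_def mult_single)

lemma eval_terms_append: "eval_terms \<phi> (a @ b) = eval_terms \<phi> a + eval_terms \<phi> b"
  by (simp add: eval_terms_def)

lemma eval_terms_prefix:
  "eval_terms \<phi> (map (\<lambda>(c, u). (c, p # u)) ts) = word_mono \<phi> [p] * eval_terms \<phi> ts"
proof (induction ts)
  case Nil
  show ?case by (simp add: eval_terms_def)
next
  case (Cons cu ts)
  obtain c u where cu: "cu = (c, u)" by (cases cu)
  have "Poly_Mapping.single (word_image \<phi> (p # u)) (rat_of_int c)
      = word_mono \<phi> [p] * Poly_Mapping.single (word_image \<phi> u) (rat_of_int c)"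
    by (simp add: word_mono_def mult_single word_image_def)
  with Cons show ?case by (simp add: eval_terms_def cu distrib_left)
qed

lemma fox_image_Nil [simp]: "fox_image \<phi> j [] = 0"
  by (simp add: fox_image_def eval_terms_def)

lemma fox_image_Cons:
  "fox_image \<phi> j (p # w) = fox_image \<phi> j [p] + word_mono \<phi> [p] * fox_image \<phi> j w"
proof -
  obtain i s where p: "p = (i, s)" by (cases p)
  show ?thesis
    unfolding fox_image_def p fox.simps eval_terms_append eval_terms_prefix by (simp add: eval_terms_def)
qed

lemma fox_image_letter:
  "fox_image \<phi> j [(i, s)] = (if i = j then if s then 1 else - word_mono \<phi> [(i, False)] else 0)"
  by (simp add: fox_image_def eval_terms_def word_mono_def word_image_def single_uminus)

lemma fox_image_append: "fox_image \<phi> j (u @ v) = fox_image \<phi> j u + word_mono \<phi> u * fox_image \<phi> j v"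
proof (induction u)
  case (Cons p u)
  have pu: "word_mono \<phi> (p # u) = word_mono \<phi> [p] * word_mono \<phi> u" using word_mono_append[of \<phi> "[p]" u] by simp
  show ?case
    unfolding append_Cons fox_image_Cons[of \<phi> j p u] fox_image_Cons[of \<phi> j p "u @ v"] Cons pu by (simp only: distrib_left mult.assoc add.assoc)
qed simp

lemma word_mono_letter_inverse: "word_mono \<phi> [(i, s)] * word_mono \<phi> [(i, \<not> s)] = 1"
  by (simp add: word_mono_def mult_single word_image_def)

lemma winv_Cons: "winv ((i, s) # w) = winv w @ [(i, \<not> s)]"
  by (simp add: winv_def)

lemma word_mono_winv: "word_mono \<phi> w * word_mono \<phi> (winv w) = 1"
proof (induction w)
  case Nil
  show ?case by (simp add: winv_def)
next
  case (Cons p w)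
  obtain i s where p: "p = (i, s)" by (cases p)
  have "word_mono \<phi> (p # w) * word_mono \<phi> (winv (p # w))
    = (word_mono \<phi> w * word_mono \<phi> (winv w)) * (word_mono \<phi> [(i, s)] * word_mono \<phi> [(i, \<not> s)])"
    using word_mono_append[of \<phi> "[p]" w]
    by (simp only: p winv_Cons word_mono_append append_Cons append_Nil mult.assoc mult.left_commute mult.commute)
  then show ?case by (simp only: Cons word_mono_letter_inverse mult_1)
qed

lemma fox_image_winv: "fox_image \<phi> j (winv w) = - word_mono \<phi> (winv w) * fox_image \<phi> j w"
proof (induction w)
  case Nil
  show ?case by (simp add: winv_def)
next
  case (Cons p w)
  obtain i s where p: "p = (i, s)" by (cases p)
  let ?a = "word_mono \<phi> [(i, s)]" and ?b = "word_mono \<phi> [(i, \<not> s)]" and ?v = "word_mono \<phi> (winv w)"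
  have l: "fox_image \<phi> j [(i, \<not> s)] = - ?b * fox_image \<phi> j [(i, s)]"
    using word_mono_letter_inverse[of \<phi> i s] by (cases s) (auto simp: fox_image_letter mult.commute)
  have "- ?v * ?b * (fox_image \<phi> j [(i, s)] + ?a * fox_image \<phi> j w)
    = - ?v * (?a * ?b) * fox_image \<phi> j w + ?v * (- ?b * fox_image \<phi> j [(i, s)])"
    by (simp add: algebra_simps)
  then show ?case
    unfolding p winv_Cons fox_image_append fox_image_Cons[of _ _ _ w] word_mono_append Cons l
    by (simp add: word_mono_letter_inverse)
qed

lemma word_mono_wpow: "word_mono \<phi> (wpow w n) = word_mono \<phi> w ^ n"
  by (induction n) (simp_all add: wpow_def word_mono_append)

lemma fox_image_wpow: "fox_image \<phi> j (wpow w n) = (\<Sum>i<n. word_mono \<phi> w ^ i) * fox_image \<phi> j w"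
proof (induction n)
  case (Suc n)
  have "wpow w (Suc n) = w @ wpow w n" by (simp add: wpow_def)
  then show ?case
    unfolding sum.lessThan_Suc_shift
    by (simp add: fox_image_append Suc sum_distrib_left sum_distrib_right distrib_right mult.assoc)
qed (simp add: wpow_def)

section \<open>The second elementary ideal of the pretzel link\<close>

lemma A_poly_mult: assumes "odd q" shows "(1 + [:0, 1:]) * A_poly q = 1 + [:0, 1:] ^ q"
proof -
  have "poly (1 + [:0, 1:] ^ q) (-1 :: rat) = 0" using assms by simp
  then have "[:1, 1:] dvd (1 + [:0, 1:] ^ q :: rat poly)"
    by (metis minus_minus poly_eq_0_iff_dvd)
  moreover have "[:1, 1:] = (1 + [:0, 1:] :: rat poly)" by (simp add: one_pCons)
  ultimately show ?thesis by (simp add: A_poly_def)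
qed

lemma A_poly_cancel:
  assumes "odd q" "(1 + [:0, 1:]) * p = 1 + [:0, 1:] ^ q" shows "p = A_poly q"
proof -
  have "(1 + [:0, 1:] :: rat poly) \<noteq> 0" by (simp add: one_pCons)
  then show ?thesis using A_poly_mult[OF assms(1)] assms(2) by (metis mult_left_cancel)
qed

lemma G_poly_eq: "G_poly k = (\<Sum>i<k. (X * Y) ^ i)"
proof -
  have "1 - X * Y \<noteq> 0"
  proof
    assume "1 - X * Y = 0"
    then have "coef (1 - X * Y) (0, 0) = 0" by simp
    then show False by (simp add: coef_def X_def Y_def)
  qed
  moreover have "1 - (X * Y) ^ k = (1 - X * Y) * (\<Sum>i<k. (X * Y) ^ i)"
    by (rule one_diff_power_eq)
  ultimately show ?thesis unfolding G_poly_def by simp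
qed

lemma H_poly_eq: "H_poly m = (\<Sum>i<m. Y ^ (m - Suc i) * X ^ i)"
proof -
  have "X - Y \<noteq> 0"
  proof
    assume "X - Y = 0"
    then have "coef (X - Y) (0, 1) = 0" by simp
    then show False by (simp add: coef_def X_def Y_def)
  qed
  moreover have "X ^ m - Y ^ m = (X - Y) * (\<Sum>i<m. Y ^ (m - Suc i) * X ^ i)"
    by (rule power_diff_sumr2)
  ultimately show ?thesis unfolding H_poly_def by simp
qed

definition cpoly :: "rat poly \<Rightarrow> bipoly" where "cpoly p = [:p:]"

lemma cpoly_hom [simp]:
  "cpoly 0 = 0" "cpoly 1 = 1" "cpoly (p + p') = cpoly p + cpoly p'" "cpoly (p - p') = cpoly p - cpoly p'"
  "cpoly (- p) = - cpoly p" "cpoly (p * p') = cpoly p * cpoly p'"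
  by (simp_all add: cpoly_def one_pCons)

lemma cpoly_power [simp]: "cpoly (p ^ n) = cpoly p ^ n"
  by (induction n) simp_all

lemma cpoly_var [simp]: "cpoly [:0, 1:] = X"
  by (simp add: cpoly_def X_def)

lemma cpoly_sum: "cpoly (sum f A) = (\<Sum>a\<in>A. cpoly (f a))"
  by (induction A rule: infinite_finite_induct) simp_all

lemma cpoly_dvd_iff: "cpoly p dvd cpoly p' \<longleftrightarrow> p dvd p'"
  by (auto simp: cpoly_def const_poly_dvd_iff coeff_pCons split: nat.splits)

text \<open>This is the shape in which \<open>A\<^sub>q\<close> turns up among the derivatives; multiplication by \<open>1 + x\<close> makes
  the geometric sum telescope.\<close>

lemma A_poly_geometric:
  assumes "r \<ge> 1"
  shows "A_poly (2 * r - 1) = [:0, 1:] ^ (2 * r - 1) - ([:0, 1:] - 1) * (\<Sum>i<r. ([:0, 1:] * [:0, 1:]) ^ i)"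
proof (rule A_poly_cancel[symmetric])
  define x where "x = ([:0, 1:] :: rat poly)"
  have "(x * x - 1) * (\<Sum>i<r. (x * x) ^ i) = (x * x) ^ r - 1" by (rule power_diff_1_eq[symmetric])
  moreover have "(x * x) ^ r = x * x ^ (2 * r - 1)"
    using assms by (simp flip: power2_eq_square power_mult power_Suc)
  ultimately have "(1 + x) * (x ^ (2 * r - 1) - (x - 1) * (\<Sum>i<r. (x * x) ^ i)) = 1 + x ^ (2 * r - 1)"
    by (simp add: algebra_simps)
  then show "(1 + [:0, 1:]) * ([:0, 1:] ^ (2 * r - 1) - ([:0, 1:] - 1) * (\<Sum>i<r. ([:0, 1:] * [:0, 1:]) ^ i))
      = 1 + ([:0, 1:] :: rat poly) ^ (2 * r - 1)"
    unfolding x_def .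
qed (use assms in auto)

lemma power_mult_geometric_inverse:
  fixes t t' :: "'a::comm_ring_1"
  assumes "t * t' = 1"
  shows "t ^ m * (\<Sum>i<m. t' ^ i) = t * (\<Sum>i<m. t ^ i)"
proof (induction m)
  case (Suc m)
  have S: "(\<Sum>i<Suc m. t ^ i) = 1 + t * (\<Sum>i<m. t ^ i)"
    unfolding sum.lessThan_Suc_shift by (simp add: sum_distrib_left)
  have "t ^ Suc m * (\<Sum>i<Suc m. t' ^ i) = t * (t ^ m * (\<Sum>i<m. t' ^ i)) + t * (t * t') ^ m"
    by (simp add: algebra_simps power_mult_distrib)
  also have "\<dots> = t * (\<Sum>i<Suc m. t ^ i)"
    unfolding Suc S by (simp add: assms algebra_simps)
  finally show ?case .
qed simp

lemma det_submatrix_singleton: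
  assumes "i < dim_row M" "j < dim_col M"
  shows "det (submatrix M {i} {j}) = M $$ (i, j)"
proof -
  have c: "{a. a < dim_row M \<and> a \<in> {i}} = {i}" "{a. a < dim_col M \<and> a \<in> {j}} = {j}"
    using assms by auto
  have "submatrix M {i} {j} \<in> carrier_mat 1 1"
    by (intro carrier_matI) (simp_all only: dim_submatrix c, simp_all)
  then have "det (submatrix M {i} {j}) = submatrix M {i} {j} $$ (0, 0)" by (rule det_single)
  also have "\<dots> = M $$ (i, j)"
    using submatrix_index_card[of i M j "{i}" "{j}"] assms
    by (metis (mono_tags, lifting) Collect_empty_eq card.empty insertCI less_irrefl singletonD)
  finally show ?thesis .
qed

text \<open>With \<open>d + 1\<close> generators the minors have size 1, so they are the Fox derivatives themselves.\<close>

lemma elementary_ideal_codim_1: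
  "elementary_ideal d \<phi> (Suc d, rs) = ideal_gen {fox_image \<phi> j w | j w. j \<le> d \<and> w \<in> set rs}"
proof -
  let ?M = "fox_matrix \<phi> (Suc d, rs)"
  have dims: "dim_row ?M = length rs" "dim_col ?M = Suc d" by (simp_all add: fox_matrix_def)
  have entry: "?M $$ (i, j) = fox_image \<phi> j (rs ! i)" if "i < length rs" "j < Suc d" for i j
    using that by (simp add: fox_matrix_def fox_image_def)
  have "{det (submatrix ?M I J) | I J. I \<subseteq> {..<length rs} \<and> J \<subseteq> {..<Suc d} \<and> card I = 1 \<and> card J = 1}
      = {fox_image \<phi> j w | j w. j \<le> d \<and> w \<in> set rs}" (is "?L = ?R")
  proof (intro equalityI subsetI)
    fix a assume "a \<in> ?L"
    then obtain i j where ij: "i < length rs" "j < Suc d" "a = det (submatrix ?M {i} {j})"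
      by clarsimp (metis card_1_singletonE One_nat_def insert_subset lessThan_iff)
    then have "a = fox_image \<phi> j (rs ! i)" using det_submatrix_singleton[of i ?M j] by (simp add: dims entry)
    then show "a \<in> ?R" using ij by (auto intro!: exI[of _ j] exI[of _ "rs ! i"])
  next
    fix a assume "a \<in> ?R"
    then obtain j i where ij: "j < Suc d" "i < length rs" "a = fox_image \<phi> j (rs ! i)"
      by (auto simp: in_set_conv_nth less_Suc_eq_le)
    then have "a = det (submatrix ?M {i} {j})" using det_submatrix_singleton[of i ?M j] by (simp add: dims entry)
    then show "a \<in> ?L" using ij by (intro CollectI exI[of _ "{i}"] exI[of _ "{j}"]) auto
  qed
  then show ?thesis unfolding elementary_ideal_def by simp
qed

lemma winv_letter: "winv [(i, True)] = [(i, False)]"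
  by (simp add: winv_def)

lemma word_mono_pretzel:
  "word_mono pretzel_phi [(0, True)] = yL" "word_mono pretzel_phi [(Suc 0, True)] = xL" "word_mono pretzel_phi [(2, True)] = xL"
  "word_mono pretzel_phi [(0, False)] = yiL" "word_mono pretzel_phi [(Suc 0, False)] = xiL" "word_mono pretzel_phi [(2, False)] = xiL"
  by (simp_all add: word_mono_def word_image_def pretzel_phi_def yL_def xL_def yiL_def xiL_def)

definition relator1 :: "nat \<Rightarrow> nat \<Rightarrow> gword" where
  "relator1 r m = wpow (wc @ wb) r @ winv wb @ winv (wpow (wc @ wb) r) @
        wpow (wa @ winv wc) m @ wc @ wpow (wc @ winv wa) m"

definition relator2 :: "nat \<Rightarrow> nat \<Rightarrow> gword" where
  "relator2 k r = winv (wpow (wa @ wb) k) @ wb @ wpow (wa @ wb) k @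
        wpow (wc @ wb) (r - 1) @ winv wc @ winv (wpow (wc @ wb) (r - 1))"

lemmas fox_simps = One_nat_def fox_image_append word_mono_append fox_image_winv fox_image_wpow word_mono_wpow winv_letter
  fox_image_letter word_mono_pretzel

text \<open>The image of the inverse of \<open>(cb)^r\<close> is kept as a variable \<open>p'\<close> with \<open>p * p' = 1\<close>, so that
  negative powers do not enter the ring identities.  Powers of \<open>a c^-1\<close> and \<open>c a^-1\<close> contribute
  geometric sums \<open>T\<close> and \<open>V\<close>, which are multiples of each other.\<close>

lemma relator1_derivatives:
  fixes r m :: nat
  defines "T \<equiv> \<Sum>i<m. (yL * xiL) ^ i" and "S \<equiv> \<Sum>i<r. (xL * xL) ^ i"
  shows "fox_image pretzel_phi 0 (relator1 r m) = (xiL - 1) * T"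
    "xL * fox_image pretzel_phi (Suc 0) (relator1 r m) = xL * (xL - 1) * S - (xL * xL) ^ r"
    "fox_image pretzel_phi 2 (relator1 r m) = (1 - xiL) * S + xiL + (yL * xiL - xiL) * T"
proof -
  define p where "p = (xL * xL) ^ r"
  define p' where "p' = word_mono pretzel_phi (winv (wpow (wc @ wb) r))"
  define V where "V = (\<Sum>i<m. (xL * yiL) ^ i)"
  define U where "U = (yL * xiL) ^ m"
  have x: "xL * xiL = 1" by (rule laurent_inverses)
  have pp: "p * p' = 1"
    using word_mono_winv[of pretzel_phi "wpow (wc @ wb) r"] by (simp only: p_def p'_def fox_simps)
  have t: "(yL * xiL) * (xL * yiL) = 1"
    using laurent_inverses by (metis mult.left_commute mult.assoc mult.right_neutral)
  have UV: "U * V = yL * xiL * T"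
    unfolding U_def V_def T_def by (rule power_mult_geometric_inverse[OF t])
  have U: "U = 1 + (yL * xiL - 1) * T"
    unfolding U_def T_def power_diff_1_eq[symmetric] by simp
  note F = fox_simps p'_def[unfolded One_nat_def, symmetric] p_def[symmetric] S_def[symmetric] T_def[symmetric] V_def[symmetric] U_def[symmetric]
  have "fox_image pretzel_phi 0 (relator1 r m) = (p * p') * xiL * (T - (U * V) * xL * (xL * yiL))"
    unfolding relator1_def F by (simp add: algebra_simps)
  also have "\<dots> = xiL * T - ((yL * xiL) * (xL * yiL)) * (xL * xiL) * T"
    unfolding pp UV by (simp add: algebra_simps)
  also have "\<dots> = (xiL - 1) * T" unfolding t x by (simp add: algebra_simps)
  finally show "fox_image pretzel_phi 0 (relator1 r m) = (xiL - 1) * T" .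
  have "xL * fox_image pretzel_phi (Suc 0) (relator1 r m)
      = xL * xL * S - p * (xL * xiL) - (xL * xiL) * (p * p') * S * xL"
    unfolding relator1_def F by (simp add: algebra_simps)
  then show "xL * fox_image pretzel_phi (Suc 0) (relator1 r m) = xL * (xL - 1) * S - (xL * xL) ^ r"
    unfolding pp x by (simp add: p_def algebra_simps)
  have "fox_image pretzel_phi 2 (relator1 r m)
      = S - (p * p') * xiL * S + (p * p') * xiL * (U + (U * V) * xL - yL * xiL * T)"
    unfolding relator1_def F by (simp add: algebra_simps)
  also have "\<dots> = S - xiL * S + xiL * U + (xL * xiL) * (yL * xiL) * T - xiL * (yL * xiL) * T"
    unfolding pp UV by (simp add: algebra_simps)
  finally show "fox_image pretzel_phi 2 (relator1 r m) = (1 - xiL) * S + xiL + (yL * xiL - xiL) * T"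
    unfolding x U by (simp add: algebra_simps)
qed

lemma relator2_derivatives:
  fixes r k :: nat
  defines "T \<equiv> \<Sum>i<k. (yL * xL) ^ i" and "S \<equiv> \<Sum>i<r - 1. (xL * xL) ^ i"
  shows "(yL * xL) ^ k * fox_image pretzel_phi 0 (relator2 k r) = (xL - 1) * T"
    "(yL * xL) ^ k * fox_image pretzel_phi (Suc 0) (relator2 k r)
      = (yL * xL) ^ k * (1 + xL * (xL - 1) * S) + (1 - yL) * T"
    "fox_image pretzel_phi 2 (relator2 k r) = (xL - 1) * S - (xL * xL) ^ (r - 1)"
proof -
  define p where "p = (xL * xL) ^ (r - 1)"
  define p' where "p' = word_mono pretzel_phi (winv (wpow (wc @ wb) (r - 1)))"
  define w where "w = (yL * xL) ^ k"
  define w' where "w' = word_mono pretzel_phi (winv (wpow (wa @ wb) k))"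
  have x: "xL * xiL = 1" by (rule laurent_inverses)
  have pp: "p * p' = 1"
    using word_mono_winv[of pretzel_phi "wpow (wc @ wb) (r - 1)"] by (simp only: p_def p'_def fox_simps)
  have ww: "w * w' = 1"
    using word_mono_winv[of pretzel_phi "wpow (wa @ wb) k"] by (simp only: w_def w'_def fox_simps)
  have w: "1 = w - (yL * xL - 1) * T"
    unfolding w_def T_def power_diff_1_eq[symmetric] by simp
  note F = fox_simps p'_def[unfolded One_nat_def, symmetric] p_def[unfolded One_nat_def, symmetric]
    S_def[unfolded One_nat_def, symmetric] T_def[symmetric] w'_def[unfolded One_nat_def, symmetric] w_def[symmetric]
  have "w * fox_image pretzel_phi 0 (relator2 k r) = (w * w') * (xL - 1) * T"
    unfolding relator2_def F by (simp add: algebra_simps)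
  then show "(yL * xL) ^ k * fox_image pretzel_phi 0 (relator2 k r) = (xL - 1) * T"
    unfolding ww unfolding w_def by simp
  have "w * fox_image pretzel_phi (Suc 0) (relator2 k r)
      = (w * w') * ((xL - 1) * yL * T + 1) + (w * w') * w * xL * (S * xL - (p * p') * (xL * xiL) * S)"
    unfolding relator2_def F by (simp add: algebra_simps)
  also have "\<dots> = (xL - 1) * yL * T + (w - (yL * xL - 1) * T) + w * xL * (xL - 1) * S"
    unfolding pp ww x w[symmetric] by (simp add: algebra_simps)
  also have "\<dots> = w * (1 + xL * (xL - 1) * S) + (1 - yL) * T"
    by (simp add: algebra_simps)
  finally show "(yL * xL) ^ k * fox_image pretzel_phi (Suc 0) (relator2 k r)
      = (yL * xL) ^ k * (1 + xL * (xL - 1) * S) + (1 - yL) * T"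
    unfolding w_def .
  have "fox_image pretzel_phi 2 (relator2 k r)
      = (w * w') * (xL * S - p * (xL * xiL) - (p * p') * (xL * xiL) * S)"
    unfolding relator2_def F by (simp add: algebra_simps)
  then show "fox_image pretzel_phi 2 (relator2 k r) = (xL - 1) * S - (xL * xL) ^ (r - 1)"
    unfolding pp ww x by (simp add: p_def algebra_simps)
qed

text \<open>The value at \<open>x = 1\<close> is 1, whence \<open>x - 1\<close> is a unit modulo \<open>A\<^sub>q\<close>.\<close>

lemma A_poly_bezout: "\<exists>B. A_poly q = 1 + ([:0, 1:] - 1) * B" if "odd q"
proof -
  have "poly ((1 + [:0, 1:]) * A_poly q) 1 = 2"
    unfolding A_poly_mult[OF that] by simp
  then have "poly (A_poly q - 1) 1 = 0" by simp
  then have "[:-1, 1:] dvd A_poly q - 1" by (simp only: poly_eq_0_iff_dvd)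
  then obtain B where B: "A_poly q - 1 = [:-1, 1:] * B" by (elim dvdE)
  have "[:-1, 1:] = ([:0, 1:] - 1 :: rat poly)" by (simp add: one_pCons)
  with B show ?thesis by (intro exI[of _ B]) (metis add_diff_cancel_left' diff_add_cancel add.commute)
qed

text \<open>The derivatives with respect to \<open>a\<close> give \<open>H\<^sub>m\<close> and \<open>G\<^sub>k\<close> after the unit \<open>x - 1\<close> modulo \<open>A\<^sub>q\<close> has been
  cancelled.  The other derivatives are \<open>\<plusminus> A\<^sub>q\<close> up to multiples of these two.\<close>

theorem pretzel_ideal:
  assumes "k \<ge> 1" "m \<ge> 1" "r \<ge> 2"
  shows "pretzel_E2_cap_R k r m = ideal_gen {cpoly (A_poly (2 * r - 1)), G_poly k, H_poly m}"
proof -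
  define A where "A = to_laurent (cpoly (A_poly (2 * r - 1)))"
  define T where "T = (\<Sum>i<m. (yL * xiL) ^ i)"
  define W where "W = (\<Sum>i<k. (yL * xL) ^ i)"
  define S where "S = (\<lambda>n. \<Sum>i<n. (xL * xL) ^ i)"
  let ?I = "ideal_gen {cpoly (A_poly (2 * r - 1)), G_poly k, H_poly m}"
  let ?E = "pretzel_E2 k r m"
  let ?J = "ideal_gen (to_laurent ` ?I)"
  have x: "xL * xiL = 1" and y: "yL * yiL = 1" by (rule laurent_inverses)+
  have G: "to_laurent (G_poly k) = W"
    by (simp add: G_poly_eq to_laurent_hom W_def mult.commute)
  have H: "to_laurent (H_poly m) = xL ^ (m - 1) * T"
  proof -
    have "T * xL ^ (m - 1) = (\<Sum>i<m. yL ^ i * xL ^ (m - Suc i))"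
      unfolding T_def sum_distrib_right
    proof (rule sum.cong)
      fix i assume "i \<in> {..<m}"
      then have "xL ^ (m - 1) = xL ^ i * xL ^ (m - Suc i)" by (simp flip: power_add)
      then have "(yL * xiL) ^ i * xL ^ (m - 1) = yL ^ i * (xL * xiL) ^ i * xL ^ (m - Suc i)"
        by (simp add: power_mult_distrib ac_simps)
      then show "(yL * xiL) ^ i * xL ^ (m - 1) = yL ^ i * xL ^ (m - Suc i)" by (simp add: x)
    qed simp
    also have "\<dots> = (\<Sum>i<m. yL ^ (m - Suc i) * xL ^ i)"
      by (subst sum.nat_diff_reindex[symmetric]) (auto intro!: sum.cong)
    finally show ?thesis by (simp add: H_poly_eq to_laurent_hom mult.commute)
  qed
  have A1: "A = xL ^ (2 * r - 1) - (xL - 1) * S r"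
  proof -
    have "cpoly (A_poly (2 * r - 1)) = X ^ (2 * r - 1) - (X - 1) * (\<Sum>i<r. (X * X) ^ i)"
      using A_poly_geometric[of r] assms by (simp only: cpoly_hom cpoly_power cpoly_sum cpoly_var)
    then show ?thesis unfolding A_def S_def by (simp only: to_laurent_hom)
  qed
  have xr: "(xL * xL) ^ r = xL * xL ^ (2 * r - 1)" "xL ^ (2 * r - 1) = xL * (xL * xL) ^ (r - 1)"
  proof -
    obtain s where s: "r = Suc s" using assms by (cases r) auto
    show "(xL * xL) ^ r = xL * xL ^ (2 * r - 1)" "xL ^ (2 * r - 1) = xL * (xL * xL) ^ (r - 1)"
      by (simp_all add: s power_mult_distrib ac_simps flip: power2_eq_square power_mult power_add)
  qed
  have Sr: "S r = S (r - 1) + (xL * xL) ^ (r - 1)"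
    using assms by (cases r) (simp_all add: S_def)
  have A2: "A = (xL * xL) ^ (r - 1) - (xL - 1) * S (r - 1)"
    unfolding A1 Sr xr(2) by (simp add: algebra_simps)
  have geo: "(xL * xL - 1) * S n = (xL * xL) ^ n - 1" for n
    unfolding S_def by (rule power_diff_1_eq[symmetric])
  define w where "w = (yL * xL) ^ k"
  define w' where "w' = (xiL * yiL) ^ k"
  have ww: "w' * w = 1"
  proof -
    have "w' * w = ((yL * yiL) * (xL * xiL)) ^ k"
      unfolding w_def w'_def by (simp only: power_mult_distrib mult_ac)
    then show ?thesis by (simp add: x y)
  qed
  have unit_cancel: "a = b" if "xL * a = xL * b" for a b
  proof -
    have "(xL * xiL) * a = (xL * xiL) * b" using that by (simp only: mult.assoc mult.left_commute[of xL xiL])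
    then show ?thesis by (simp only: x mult_1)
  qed
  have f10: "fox_image pretzel_phi 0 (relator1 r m) = (xiL - 1) * T"
    unfolding T_def by (rule relator1_derivatives)
  have f11: "fox_image pretzel_phi (Suc 0) (relator1 r m) = - A"
  proof -
    have "xL * fox_image pretzel_phi (Suc 0) (relator1 r m) = xL * (xL - 1) * S r - xL * xL ^ (2 * r - 1)"
      unfolding S_def xr(1)[symmetric] by (rule relator1_derivatives(2))
    also have "\<dots> = xL * (- A)"
      unfolding A1 by (simp only: minus_diff_eq right_diff_distrib[of xL "(xL - 1) * S r"] mult.assoc)
    finally show ?thesis by (rule unit_cancel)
  qed
  have f12: "fox_image pretzel_phi 2 (relator1 r m) = A + (yL * xiL - xiL) * T"
  proof -
    have "xL * A = xL * xL ^ (2 * r - 1) - (xL * xL - 1) * S r + (xL - 1) * S r"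
      unfolding A1 by (simp add: algebra_simps)
    also have "\<dots> = 1 + (xL - 1) * S r" unfolding geo xr(1)[symmetric] by simp
    also have "\<dots> = xL * xiL + (xL - xL * xiL) * S r" unfolding x ..
    also have "\<dots> = xL * ((1 - xiL) * S r + xiL)" by (simp add: algebra_simps)
    finally have "A = (1 - xiL) * S r + xiL" by (rule unit_cancel)
    then show ?thesis unfolding relator1_derivatives(3) T_def S_def by simp
  qed
  have f20: "fox_image pretzel_phi 0 (relator2 k r) = w' * (xL - 1) * W"
    and f20': "w * fox_image pretzel_phi 0 (relator2 k r) = (xL - 1) * W"
  proof -
    show *: "w * fox_image pretzel_phi 0 (relator2 k r) = (xL - 1) * W"
      unfolding w_def W_def by (rule relator2_derivatives)
    show "fox_image pretzel_phi 0 (relator2 k r) = w' * (xL - 1) * W"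
      using ww by (metis * mult.assoc mult_1)
  qed
  have f22: "fox_image pretzel_phi 2 (relator2 k r) = - A"
    unfolding relator2_derivatives A2 S_def by simp
  have f21: "fox_image pretzel_phi (Suc 0) (relator2 k r) = A + w' * (1 - yL) * W"
  proof -
    have "xL * A + ((xL * xL - 1) * S (r - 1) - ((xL * xL) ^ (r - 1) - 1)) + A = xL * A + 1 + xL * (xL - 1) * S (r - 1)"
      by (subst (2) A2) (simp add: algebra_simps)
    then have A4: "A = 1 + xL * (xL - 1) * S (r - 1)"
      unfolding geo by (simp add: add.assoc)
    have "w * fox_image pretzel_phi (Suc 0) (relator2 k r) = w * A + (1 - yL) * W"
      unfolding A4 w_def W_def S_def by (rule relator2_derivatives)
    then have "(w' * w) * fox_image pretzel_phi (Suc 0) (relator2 k r) = (w' * w) * A + w' * ((1 - yL) * W)"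
      by (metis distrib_left mult.assoc)
    then show ?thesis unfolding ww by (simp add: mult.assoc)
  qed
  have E: "?E = ideal_gen {fox_image pretzel_phi j v | j v. j \<le> 2 \<and> v \<in> {relator1 r m, relator2 k r}}"
    unfolding pretzel_E2_def pretzel_presentation_def relator1_def relator2_def
    using elementary_ideal_codim_1[of 2] by simp
  have EJ: "?E \<subseteq> ?J"
    unfolding E
  proof (rule ideal_gen_least)
    have J: "is_ideal ?J" by simp
    have inJ: "to_laurent f \<in> ?J" if "f \<in> ?I" for f using that by (auto intro: ideal_gen_base)
    have AJ: "A \<in> ?J" unfolding A_def by (intro inJ ideal_gen_base) simp
    have WJ: "W \<in> ?J" unfolding G[symmetric] by (intro inJ ideal_gen_base) simp
    have TJ: "T \<in> ?J"
    proof -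
      have "xiL ^ (m - 1) * (xL ^ (m - 1) * T) \<in> ?J"
        unfolding H[symmetric] by (intro ideal_mult[OF J] inJ ideal_gen_base) simp
      moreover have "xiL ^ (m - 1) * (xL ^ (m - 1) * T) = (xL * xiL) ^ (m - 1) * T"
        by (simp only: power_mult_distrib mult_ac)
      ultimately show ?thesis by (simp add: x)
    qed
    show "{fox_image pretzel_phi j v | j v. j \<le> 2 \<and> v \<in> {relator1 r m, relator2 k r}} \<subseteq> ?J"
    proof clarify
      fix j v assume "j \<le> (2::nat)" "v \<in> {relator1 r m, relator2 k r}"
      then have "j = 0 \<or> j = Suc 0 \<or> j = 2" "v = relator1 r m \<or> v = relator2 k r" by auto
      then show "fox_image pretzel_phi j v \<in> ?J"
        by (elim disjE; simp only: f10 f11 f12 f20 f21 f22)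
          (intro ideal_add[OF J] ideal_mult[OF J] ideal_uminus[OF J] AJ TJ WJ)+
    qed
  qed simp
  have JE: "to_laurent f \<in> ?E" if "f \<in> ?I" for f
  proof -
    have Ei: "is_ideal ?E" unfolding E by simp
    have fE: "fox_image pretzel_phi j v \<in> ?E" if "j \<le> 2" "v \<in> {relator1 r m, relator2 k r}" for j v
      unfolding E using that by (intro ideal_gen_base) blast
    have AE: "A \<in> ?E"
      using ideal_uminus[OF Ei fE[of "Suc 0" "relator1 r m"]] by (simp add: f11)
    obtain B where "A_poly (2 * r - 1) = 1 + ([:0, 1:] - 1) * B"
      using A_poly_bezout[of "2 * r - 1"] assms by auto
    then have "cpoly (A_poly (2 * r - 1)) = 1 + (X - 1) * cpoly B" by (simp only: cpoly_hom cpoly_var)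
    then have B: "1 = A - (xL - 1) * to_laurent (cpoly B)"
      unfolding A_def by (simp add: to_laurent_hom)
    have cancel: "c \<in> ?E" if "(xL - 1) * c \<in> ?E" for c
    proof -
      have "c * A - to_laurent (cpoly B) * ((xL - 1) * c) \<in> ?E"
        by (intro ideal_diff[OF Ei] ideal_mult[OF Ei] AE that)
      moreover have "c * A - to_laurent (cpoly B) * ((xL - 1) * c) = c * (A - (xL - 1) * to_laurent (cpoly B))"
        by (simp only: right_diff_distrib mult_ac)
      ultimately show ?thesis unfolding B[symmetric] by simp
    qed
    have "- xL * fox_image pretzel_phi 0 (relator1 r m) = (xL - xL * xiL) * T"
      by (simp add: f10 algebra_simps)
    then have "(xL - 1) * T = - xL * fox_image pretzel_phi 0 (relator1 r m)" unfolding x ..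
    moreover have "- xL * fox_image pretzel_phi 0 (relator1 r m) \<in> ?E"
      by (rule ideal_mult[OF Ei fE]) simp_all
    ultimately have "(xL - 1) * T \<in> ?E" by (simp only:)
    then have TE: "T \<in> ?E" by (rule cancel)
    have "w * fox_image pretzel_phi 0 (relator2 k r) \<in> ?E"
      by (rule ideal_mult[OF Ei fE]) simp_all
    then have WE: "W \<in> ?E" unfolding f20' by (rule cancel)
    have "?I \<subseteq> {f. to_laurent f \<in> ?E}"
    proof (rule ideal_gen_least)
      show "is_ideal {f. to_laurent f \<in> ?E}"
        by (rule is_idealI) (auto simp: to_laurent_add to_laurent_mult intro: ideal_0[OF Ei] ideal_add[OF Ei] ideal_mult[OF Ei])
      show "{cpoly (A_poly (2 * r - 1)), G_poly k, H_poly m} \<subseteq> {f. to_laurent f \<in> ?E}"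
        using AE WE ideal_mult[OF Ei TE, of "xL ^ (m - 1)"] unfolding G[symmetric] H[symmetric] A_def by blast
    qed
    with that show ?thesis by blast
  qed
  \<comment> \<open>\<open>G\<^sub>k = 1 + xy + ... + (xy)^(k - 1)\<close> shows the inverse of \<open>xy\<close>\<close>
  have unit: "1 - X * Y * (\<Sum>i<k - 1. - ((X * Y) ^ i)) \<in> ?I"
  proof -
    have "k = Suc (k - 1)" using assms by simp
    then have "G_poly k = (\<Sum>i<Suc (k - 1). (X * Y) ^ i)" unfolding G_poly_eq by simp
    also have "\<dots> = 1 - X * Y * (\<Sum>i<k - 1. - ((X * Y) ^ i))"
      unfolding sum.lessThan_Suc_shift by (simp add: sum_distrib_left sum_negf)
    finally show ?thesis by (metis ideal_gen_base insertI1 insertI2)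
  qed
  show ?thesis
  proof
    show "pretzel_E2_cap_R k r m \<subseteq> ?I"
      using contract_extend[OF _ unit] EJ by (auto simp: pretzel_E2_cap_R_def)
    show "?I \<subseteq> pretzel_E2_cap_R k r m"
      using JE by (auto simp: pretzel_E2_cap_R_def)
  qed
qed

section \<open>Cyclotomic polynomials over the rationals\<close>

definition complex_poly :: "rat poly \<Rightarrow> complex poly" where "complex_poly = map_poly of_rat"

lemma coeff_complex_poly: "poly.coeff (complex_poly p) i = of_rat (poly.coeff p i)"
  by (simp add: complex_poly_def coeff_map_poly)

lemma complex_poly_simps [simp]:
  "complex_poly 0 = 0" "complex_poly 1 = 1" "complex_poly (p + q) = complex_poly p + complex_poly q" "complex_poly (p - q) = complex_poly p - complex_poly q"
  "complex_poly (p * q) = complex_poly p * complex_poly q"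
  by (rule poly_eqI; simp add: coeff_complex_poly of_rat_add of_rat_diff coeff_mult of_rat_sum of_rat_mult coeff_1)+

lemma complex_poly_power: "complex_poly (p ^ n) = complex_poly p ^ n"
  by (induction n) simp_all

lemma complex_poly_prod: "complex_poly (prod f A) = (\<Prod>a\<in>A. complex_poly (f a))"
  by (induction A rule: infinite_finite_induct) simp_all

lemma complex_poly_inj: "complex_poly p = complex_poly q \<longleftrightarrow> p = q"
  by (auto simp: poly_eq_iff coeff_complex_poly)

lemma degree_complex_poly [simp]: "degree (complex_poly p) = degree p"
  unfolding complex_poly_def by (rule degree_map_poly) simp

lemma complex_poly_var: "complex_poly [:0, 1:] = [:0, 1:]"
  by (rule poly_eqI) (simp add: coeff_complex_poly coeff_pCons split: nat.splits)

definition complex_cyclotomic :: "nat \<Rightarrow> complex poly" where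
  "complex_cyclotomic n = (\<Prod>k\<in>totatives n. [:- cis (2 * pi * real k / real n), 1:])"

lemma complex_cyclotomic_nz: "complex_cyclotomic n \<noteq> 0"
  by (simp add: complex_cyclotomic_def)

text \<open>Both sides are monic of degree \<open>n\<close> and vanish at the \<open>n\<close> roots of unity.\<close>

lemma prod_roots_unity:
  assumes "n > 0"
  shows "(\<Prod>k\<in>{0<..n}. [:- cis (2 * pi * real k / real n), 1:]) = [:0, 1:] ^ n - 1" (is "?P = ?Q")
proof -
  let ?f = "\<lambda>k. cis (2 * pi * real k / real n)"
  have shift: "?f n = ?f 0" using assms by simp
  have "?P = (\<Prod>k\<in>{..<n}. [:- ?f k, 1:])"
  proof -
    have "{0<..n} = insert n {0<..<n}" "{..<n} = insert 0 {0<..<n}" using assms by auto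
    then show ?thesis using shift by (simp add: prod.insert)
  qed
  also have "\<dots> = (\<Prod>z\<in>{z. z ^ n = 1}. [:- z, 1:])"
    by (rule prod.reindex_bij_betw[OF bij_betw_roots_unity[OF assms], of "\<lambda>z. [:- z, 1:]"])
  finally have P: "?P = (\<Prod>z\<in>{z. z ^ n = 1}. [:- z, 1:])" .
  have fin: "finite {z::complex. z ^ n = 1}" using assms by (intro finite_roots_unity) simp
  have card: "card {z::complex. z ^ n = 1} = n" using assms by (rule card_roots_unity_eq)
  have degP: "degree ?P = n" unfolding P by (subst degree_prod_eq_sum_degree) (auto simp: card)
  have "[:0, 1:] ^ j = (monom 1 j :: complex poly)" for j
    by (induction j) (simp_all add: monom_Suc one_pCons)
  then have Q: "?Q = monom 1 n - 1" by simp
  have degQ: "degree ?Q = n"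
    unfolding Q using assms degree_add_eq_left[of "- 1" "monom (1::complex) n"] by (simp add: degree_monom_eq)
  have "lead_coeff ?P = 1" unfolding P by (simp add: lead_coeff_prod)
  moreover have "lead_coeff ?Q = 1" unfolding degQ using assms by (simp add: Q)
  ultimately show ?thesis
    using degP degQ fin card
    by (intro poly_eqI_degree_lead_coeff[where A = "{z. z ^ n = 1}" and n = n]) (auto simp: P poly_prod)
qed

text \<open>The n-th roots of unity are sorted by the gcd of their exponent with \<open>n\<close>, which determines
  their order.\<close>

lemma prod_complex_cyclotomic:
  assumes "n > 0"
  shows "(\<Prod>d | d dvd n. complex_cyclotomic d) = [:0, 1:] ^ n - 1"
proof -
  let ?F = "\<lambda>n k. [:- cis (2 * pi * real k / real n), 1:]"
  have fin: "finite {d. d dvd n}" using assms by (intro finite_divisors_nat) simp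
  have "(\<Prod>d | d dvd n. complex_cyclotomic d) = (\<Prod>d | d dvd n. complex_cyclotomic (n div d))"
    by (rule prod.reindex_bij_witness[of _ "\<lambda>d. n div d" "\<lambda>d. n div d"]) (use assms in auto)
  also have "\<dots> = (\<Prod>d | d dvd n. \<Prod>k\<in>{k\<in>{0<..n}. gcd k n = d}. ?F n k)"
  proof (rule prod.cong)
    fix d assume "d \<in> {d. d dvd n}"
    then have d: "d dvd n" "d > 0" using assms by (auto intro: Nat.gr0I)
    have "?F (n div d) k = ?F n (k * d)" for k
      using d assms by (auto simp: field_simps real_of_nat_div)
    then have "complex_cyclotomic (n div d) = (\<Prod>k\<in>totatives (n div d). ?F n (k * d))"
      by (simp add: complex_cyclotomic_def)
    also have "\<dots> = (\<Prod>k\<in>{k\<in>{0<..n}. gcd k n = d}. ?F n k)"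
      by (rule prod.reindex_bij_betw[OF bij_betw_totatives_gcd_eq[OF d(1) assms]])
    finally show "complex_cyclotomic (n div d) = (\<Prod>k\<in>{k\<in>{0<..n}. gcd k n = d}. ?F n k)" .
  qed simp
  also have "\<dots> = (\<Prod>k\<in>{0<..n}. ?F n k)"
    by (rule prod.group) (use fin in auto)
  also have "\<dots> = [:0, 1:] ^ n - 1" by (rule prod_roots_unity[OF assms])
  finally show ?thesis .
qed

text \<open>By induction, \<open>x^n - 1\<close> can be divided over the rationals by the cyclotomic polynomials of the
  proper divisors of \<open>n\<close>.  Division with remainder is unique over the complex numbers, so the rational
  quotient is the cyclotomic polynomial of \<open>n\<close>.\<close>

lemma complex_cyclotomic_rational:
  assumes "n > 0"
  shows "\<exists>p. complex_poly p = complex_cyclotomic n"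
  using assms
proof (induction n rule: less_induct)
  case (less n)
  define E where "E = {d. d dvd n \<and> d \<noteq> n}"
  have "\<forall>d\<in>E. \<exists>p. complex_poly p = complex_cyclotomic d"
  proof
    fix d assume "d \<in> E"
    then have "d < n" "d > 0" using less.prems by (auto simp: E_def dest: dvd_imp_le intro: Nat.gr0I)
    then show "\<exists>p. complex_poly p = complex_cyclotomic d" by (rule less.IH)
  qed
  then obtain f where f: "\<And>d. d \<in> E \<Longrightarrow> complex_poly (f d) = complex_cyclotomic d" by metis
  define P where "P = prod f E"
  have P: "complex_poly P = prod complex_cyclotomic E" by (simp add: P_def complex_poly_prod f)
  have finE: "finite E" using finite_divisors_nat[of n] less.prems by (auto simp: E_def)
  have P0: "P \<noteq> 0"
  proof
    assume "P = 0"
    then have "prod complex_cyclotomic E = 0" using P by simp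
    then show False using complex_cyclotomic_nz finE by simp
  qed
  have "{d. d dvd n} = insert n E" by (auto simp: E_def)
  then have *: "[:0, 1:] ^ n - 1 = complex_cyclotomic n * complex_poly P"
    using prod_complex_cyclotomic[OF less.prems] finE by (simp add: P E_def)
  define T :: "rat poly" where "T = [:0, 1:] ^ n - 1"
  have T: "complex_poly T = complex_cyclotomic n * complex_poly P" by (simp add: T_def complex_poly_power complex_poly_var *)
  have "T = P * (T div P) + T mod P" by simp
  then have "complex_cyclotomic n * complex_poly P = complex_poly P * complex_poly (T div P) + complex_poly (T mod P)"
    unfolding T[symmetric] by (metis complex_poly_simps(3,5))
  then have r: "complex_poly (T mod P) = complex_poly P * (complex_cyclotomic n - complex_poly (T div P))" by (simp add: algebra_simps)
  have "complex_cyclotomic n - complex_poly (T div P) = 0"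
  proof (rule ccontr)
    assume nz: "complex_cyclotomic n - complex_poly (T div P) \<noteq> 0"
    have P0': "complex_poly P \<noteq> 0" using P0 complex_poly_inj[of P 0] by simp
    have "degree (complex_poly P * (complex_cyclotomic n - complex_poly (T div P))) = degree (complex_poly P) + degree (complex_cyclotomic n - complex_poly (T div P))"
      by (rule degree_mult_eq[OF P0' nz])
    then have "degree (T mod P) \<ge> degree P" using r by (metis degree_complex_poly le_add1)
    moreover have "T mod P \<noteq> 0" using r P0' nz by auto
    ultimately show False using degree_mod_less[OF P0, of T] by auto
  qed
  then show ?case by (intro exI[of _ "T div P"]) simp
qed

lemma complex_poly_cyclotomic:
  assumes "n > 0"
  shows "complex_poly (cyclotomic n) = complex_cyclotomic n"
proof -
  obtain p where p: "complex_poly p = complex_cyclotomic n" using complex_cyclotomic_rational[OF assms] by blast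
  have c: "(\<Prod>j\<in>{j. 1 \<le> j \<and> j \<le> n \<and> coprime j n}. [:- cis (2 * pi * real j / real n), 1:]) = complex_cyclotomic n"
    unfolding complex_cyclotomic_def by (rule prod.cong) (auto simp: totatives_def)
  have "cyclotomic n = p"
    unfolding cyclotomic_def c complex_poly_def[symmetric]
    by (rule the_equality) (use p in \<open>simp_all flip: complex_poly_inj\<close>)
  with p show ?thesis by simp
qed

lemma cyclotomic_nz [simp]: "n > 0 \<Longrightarrow> cyclotomic n \<noteq> 0"
  using complex_poly_cyclotomic[of n] complex_cyclotomic_nz[of n] by auto

lemma degree_cyclotomic: "n > 0 \<Longrightarrow> degree (cyclotomic n) = totient n"
  using degree_complex_poly[of "cyclotomic n"]
  by (simp add: complex_poly_cyclotomic complex_cyclotomic_def degree_prod_eq_sum_degree totient_def)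

lemma prod_cyclotomic:
  assumes "n > 0"
  shows "(\<Prod>d | d dvd n. cyclotomic d) = [:0, 1:] ^ n - 1"
proof -
  have "complex_poly (\<Prod>d | d dvd n. cyclotomic d) = (\<Prod>d | d dvd n. complex_cyclotomic d)"
    unfolding complex_poly_prod by (rule prod.cong) (use assms in \<open>auto intro!: complex_poly_cyclotomic intro: Nat.gr0I\<close>)
  also have "\<dots> = complex_poly ([:0, 1:] ^ n - 1)" by (simp add: prod_complex_cyclotomic[OF assms] complex_poly_power complex_poly_var)
  finally show ?thesis by (simp only: complex_poly_inj)
qed

lemma cyclotomic_dvd: "n > 0 \<Longrightarrow> cyclotomic n dvd [:0, 1:] ^ n - 1"
  unfolding prod_cyclotomic[symmetric] by (intro dvd_prodI) (auto intro: finite_divisors_nat)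

text \<open>A common divisor of positive degree would have a complex root.  That root would be a
  primitive n-th root of unity with trivial j-th power.\<close>

lemma coprime_cyclotomic_binomial:
  assumes "n > 0" "\<not> n dvd j"
  shows "coprime (cyclotomic n) ([:0, 1:] ^ j - 1)"
proof -
  define d where "d = gcd (cyclotomic n) ([:0, 1:] ^ j - 1)"
  have "degree d = 0"
  proof (rule ccontr)
    assume "degree d \<noteq> 0"
    then have "\<not> constant (poly (complex_poly d))" by (simp add: constant_degree)
    then obtain z where z: "poly (complex_poly d) z = 0" using fundamental_theorem_of_algebra by blast
    obtain a b where ab: "cyclotomic n = d * a" "[:0, 1:] ^ j - 1 = d * b"
      unfolding d_def by (meson dvdE gcd_dvd1 gcd_dvd2)
    have "poly (complex_cyclotomic n) z = 0" using z ab(1) complex_poly_cyclotomic[OF assms(1)] by (metis complex_poly_simps(5) mult_zero_left poly_mult)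
    then obtain i where i: "coprime i n" "z = cis (2 * pi * real i / real n)"
      by (auto simp: complex_cyclotomic_def poly_prod totatives_def)
    have "complex_poly ([:0, 1:] ^ j - 1) = [:0, 1:] ^ j - 1" by (simp add: complex_poly_power complex_poly_var)
    then have "poly ([:0, 1:] ^ j - 1) z = 0" using z ab(2) by (metis complex_poly_simps(5) mult_zero_left poly_mult)
    then have "cis (real j * (2 * pi * real i / real n)) = 1" by (simp add: i(2) DeMoivre)
    then have "cos (real j * (2 * pi * real i / real n)) = 1" by (metis cis.sel(1) one_complex.sel(1))
    then obtain t :: int where "real j * (2 * pi * real i / real n) = of_int t * 2 * pi"
      unfolding cos_one_2pi_int by blast
    then have "real j * real i = of_int t * real n" using assms(1) by (simp add: field_simps)
    then have "real_of_int (int (j * i)) = real_of_int (t * int n)" by simp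
    then have "int (j * i) = t * int n" by (simp only: of_int_eq_iff)
    then have "n dvd j * i" by (metis dvd_triv_right int_dvd_int_iff)
    then show False using i(1) assms(2) by (simp add: coprime_commute coprime_dvd_mult_left_iff)
  qed
  moreover have "d \<noteq> 0" using assms(1) by (simp add: d_def)
  ultimately have "is_unit d" by (simp add: is_unit_iff_degree)
  then show ?thesis by (simp add: d_def coprime_iff_gcd_eq_1 is_unit_gcd_iff)
qed

lemma coprime_cyclotomic:
  assumes "n > 0" "n' > 0" "n \<noteq> n'"
  shows "coprime (cyclotomic n) (cyclotomic n')"
proof -
  have *: "coprime (cyclotomic a) (cyclotomic b)" if "a > 0" "b > 0" "\<not> a dvd b" for a b
    using coprime_cyclotomic_binomial[OF that(1,3)] cyclotomic_dvd[OF that(2)] by (meson coprime_divisors dvd_refl)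
  show ?thesis
  proof (cases "n dvd n'")
    case True
    then have "\<not> n' dvd n" using assms by (auto dest: dvd_antisym)
    then show ?thesis using * assms coprime_commute by blast
  qed (use * assms in blast)
qed

text \<open>For odd \<open>q\<close> the divisors of \<open>2q\<close> are the \<open>\<delta>\<close> and \<open>2\<delta>\<close> with \<open>\<delta>\<close> dividing \<open>q\<close>.  Dividing
  \<open>x^(2q) - 1\<close> by \<open>x^q - 1\<close> leaves the \<open>\<Phi>\<^sub>2\<^sub>\<delta>\<close>, and \<open>\<delta> = 1\<close> contributes \<open>1 + x\<close>.\<close>

lemma A_poly_factorization:
  assumes "odd q"
  shows "A_poly q = (\<Prod>\<delta> | \<delta> > 1 \<and> \<delta> dvd q. cyclotomic (2 * \<delta>))"
proof -
  have q: "q > 0" using assms by (auto intro: Nat.gr0I)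
  have fin: "finite {d. d dvd q}" using q by (intro finite_divisors_nat) simp
  let ?x = "[:0, 1:] :: rat poly"
  have split: "{d. d dvd 2 * q} = {d. d dvd q} \<union> (*) 2 ` {d. d dvd q}" (is "?L = ?R")
  proof (intro equalityI subsetI)
    fix d assume d: "d \<in> ?L"
    show "d \<in> ?R"
    proof (cases "even d")
      case True
      then show ?thesis using d by (auto elim!: evenE)
    next
      case False
      then have "coprime d 2" by simp
      then show ?thesis using d by (simp add: coprime_dvd_mult_right_iff)
    qed
  qed auto
  have disj: "{d. d dvd q} \<inter> (*) 2 ` {d. d dvd q} = {}"
    using assms by (auto dest: dvd_trans[of 2 _ q])
  have "?x ^ (2 * q) - 1 = (\<Prod>d | d dvd q. cyclotomic d) * (\<Prod>d\<in>(*) 2 ` {d. d dvd q}. cyclotomic d)"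
    using prod_cyclotomic[of "2 * q"] q fin disj by (simp add: split prod.union_disjoint)
  also have "\<dots> = (?x ^ q - 1) * (\<Prod>d | d dvd q. cyclotomic (2 * d))"
    using prod_cyclotomic[OF q] by (subst prod.reindex) (auto simp: inj_on_def)
  finally have "(?x ^ q - 1) * (?x ^ q + 1) = (?x ^ q - 1) * (\<Prod>d | d dvd q. cyclotomic (2 * d))"
    by (simp add: power_mult power2_eq_square mult.commute[of 2] algebra_simps)
  moreover have nz: "?x ^ a - 1 \<noteq> 0" if "a > 0" for a
  proof
    assume "?x ^ a - 1 = 0"
    then have "poly (?x ^ a - 1) 0 = 0" by simp
    then show False using that by (simp add: zero_power)
  qed
  ultimately have *: "?x ^ q + 1 = (\<Prod>d | d dvd q. cyclotomic (2 * d))" using q by simp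
  have "{d::nat. d dvd 2} = {1, 2}" using two_is_prime_nat by (auto simp: prime_nat_iff)
  then have c12: "cyclotomic 1 * cyclotomic 2 = ?x ^ 2 - 1" using prod_cyclotomic[of 2] by simp
  have c1: "cyclotomic 1 = ?x - 1" using prod_cyclotomic[of 1] by simp
  have "(x - 1) * (1 + x) = x ^ 2 - 1" for x :: "rat poly" by (simp add: power2_eq_square algebra_simps)
  then have "(?x - 1) * cyclotomic 2 = (?x - 1) * (1 + ?x)" using c12 unfolding c1 by (simp only:)
  then have c2: "cyclotomic 2 = 1 + ?x" using nz[of 1] by (simp only: mult_cancel_left power_one_right) simp
  have "{d. d dvd q} = insert 1 {\<delta>. \<delta> > 1 \<and> \<delta> dvd q}" using q by (auto intro: Nat.gr0I simp: Suc_lessI)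
  then have "1 + ?x ^ q = (1 + ?x) * (\<Prod>\<delta> | \<delta> > 1 \<and> \<delta> dvd q. cyclotomic (2 * \<delta>))"
    using * fin c2 by (simp add: add.commute c2[unfolded numeral_2_eq_2])
  moreover have "1 + ?x \<noteq> 0" by (simp add: one_pCons)
  ultimately show ?thesis unfolding A_poly_def by (metis nonzero_mult_div_cancel_left)
qed

section \<open>Congruences modulo an ideal\<close>

definition icong :: "'a::comm_ring_1 set \<Rightarrow> 'a \<Rightarrow> 'a \<Rightarrow> bool" where
  "icong J a b \<longleftrightarrow> a - b \<in> J"

definition iunit :: "'a::comm_ring_1 set \<Rightarrow> 'a \<Rightarrow> bool" where
  "iunit J a \<longleftrightarrow> (\<exists>b. icong J (a * b) 1)"

lemma icong_refl: "is_ideal J \<Longrightarrow> icong J a a"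
  by (simp add: icong_def ideal_0)

lemma icong_sym: "is_ideal J \<Longrightarrow> icong J a b \<Longrightarrow> icong J b a"
  unfolding icong_def by (metis ideal_uminus minus_diff_eq)

lemma icong_trans: "is_ideal J \<Longrightarrow> icong J a b \<Longrightarrow> icong J b c \<Longrightarrow> icong J a c"
  unfolding icong_def using ideal_add[of J "a - b" "b - c"] by simp

lemma icong_diff: "is_ideal J \<Longrightarrow> icong J a b \<Longrightarrow> icong J c d \<Longrightarrow> icong J (a - c) (b - d)"
  unfolding icong_def using ideal_diff[of J "a - b" "c - d"] by (simp add: algebra_simps)

lemma icong_mult:
  assumes "is_ideal J" "icong J a b" "icong J c d"
  shows "icong J (a * c) (b * d)"
proof -
  have "c * (a - b) + b * (c - d) \<in> J"
    using assms unfolding icong_def by (intro ideal_add ideal_mult)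
  then show ?thesis by (simp add: icong_def algebra_simps)
qed

lemma icong_power: "is_ideal J \<Longrightarrow> icong J a b \<Longrightarrow> icong J (a ^ n) (b ^ n)"
  by (induction n) (simp_all add: icong_refl icong_mult)

lemma icong_mem: "is_ideal J \<Longrightarrow> icong J a b \<Longrightarrow> b \<in> J \<Longrightarrow> a \<in> J"
  unfolding icong_def using ideal_add[of J "a - b" b] by simp

lemma icong_mono: "icong J a b \<Longrightarrow> J \<subseteq> J' \<Longrightarrow> icong J' a b"
  by (auto simp: icong_def)

lemma iunit_cong: "is_ideal J \<Longrightarrow> icong J a b \<Longrightarrow> iunit J b \<Longrightarrow> iunit J a"
  unfolding iunit_def by (meson icong_mult icong_refl icong_trans)

lemma iunit_factor: "iunit J (a * b) \<Longrightarrow> iunit J a"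
  unfolding iunit_def by (metis mult.assoc)

lemma iunit_factor': "iunit J (a * b) \<Longrightarrow> iunit J b"
  using iunit_factor[of J b a] by (simp add: mult.commute)

lemma iunit_mult:
  assumes "is_ideal J" "iunit J a" "iunit J b"
  shows "iunit J (a * b)"
proof -
  obtain a' b' where "icong J (a * a') 1" "icong J (b * b') 1" using assms by (auto simp: iunit_def)
  then have "icong J ((a * a') * (b * b')) (1 * 1)" by (rule icong_mult[OF assms(1)])
  then show ?thesis unfolding iunit_def by (intro exI[of _ "a' * b'"]) (simp add: ac_simps)
qed

lemma iunit_cancel_mem:
  assumes "is_ideal J" "iunit J a" "a * c \<in> J"
  shows "c \<in> J"
proof -
  obtain b where b: "a * b - 1 \<in> J" using assms by (auto simp: iunit_def icong_def)
  have "b * (a * c) - c * (a * b - 1) \<in> J"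
    using assms(1) by (intro ideal_diff ideal_mult assms b)
  then show ?thesis by (simp add: algebra_simps)
qed

lemma iunit_cancel:
  assumes "is_ideal J" "iunit J a" "icong J (a * b) (a * c)"
  shows "icong J b c"
  using iunit_cancel_mem[of J a "b - c"] assms by (simp add: icong_def right_diff_distrib)

lemma iunit_mem: "is_ideal J \<Longrightarrow> iunit J a \<Longrightarrow> a \<in> J \<Longrightarrow> 1 \<in> J"
  using iunit_cancel_mem[of J a 1] by simp

lemma iunit_1: "is_ideal J \<Longrightarrow> iunit J 1"
  unfolding iunit_def by (intro exI[of _ 1]) (simp add: icong_refl)

lemma iunit_uminus: "iunit J a \<Longrightarrow> iunit J (- a)"
  unfolding iunit_def by (metis minus_mult_minus)

lemma ideal_gen_singleton: "a \<in> ideal_gen {f} \<longleftrightarrow> f dvd a"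
  by (auto simp: ring_module.span_singleton dvd_def mult.commute)

lemma ideal_gen_pair: "a \<in> ideal_gen {f, p} \<longleftrightarrow> (\<exists>s. f dvd a - p * s)"
proof
  assume "a \<in> ideal_gen {f, p}"
  moreover have "ideal_gen {f, p} \<subseteq> {a. \<exists>s. f dvd a - p * s}"
  proof (rule ideal_gen_least)
    show "is_ideal {a. \<exists>s. f dvd a - p * s}"
    proof (rule is_idealI)
      show "0 \<in> {a. \<exists>s. f dvd a - p * s}" by (auto intro!: exI[of _ 0])
    next
      fix a b assume "a \<in> {a. \<exists>s. f dvd a - p * s}" "b \<in> {a. \<exists>s. f dvd a - p * s}"
      then obtain s t where "f dvd a - p * s" "f dvd b - p * t" by blast
      then have "f dvd (a - p * s) + (b - p * t)" by (rule dvd_add)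
      then show "a + b \<in> {a. \<exists>s. f dvd a - p * s}"
        by (intro CollectI exI[of _ "s + t"]) (simp add: algebra_simps)
    next
      fix c a assume "a \<in> {a. \<exists>s. f dvd a - p * s}"
      then obtain s where "f dvd a - p * s" by blast
      then have "f dvd c * (a - p * s)" by (rule dvd_mult)
      then show "c * a \<in> {a. \<exists>s. f dvd a - p * s}"
        by (intro CollectI exI[of _ "c * s"]) (simp add: algebra_simps)
    qed
    show "{f, p} \<subseteq> {a. \<exists>s. f dvd a - p * s}"
      by (auto intro: exI[of _ 0] exI[of _ 1])
  qed
  ultimately show "\<exists>s. f dvd a - p * s" by blast
next
  assume "\<exists>s. f dvd a - p * s"
  then obtain s t where "a = s * p + t * f" by (metis add.commute diff_add_cancel dvdE mult.commute)
  then show "a \<in> ideal_gen {f, p}"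
    by (simp add: ideal_add[OF is_ideal_ideal_gen] ideal_mult[OF is_ideal_ideal_gen] ideal_gen_base)
qed

section \<open>Integer exponents\<close>

text \<open>This is the t-th power of an element \<open>x\<close> with \<open>x^M = 1\<close>; residues make negative exponents
  available without inverses.\<close>

definition ipow :: "nat \<Rightarrow> 'a::comm_ring_1 \<Rightarrow> int \<Rightarrow> 'a" where
  "ipow M x t = x ^ nat (t mod int M)"

lemma icong_power_mod:
  assumes J: "is_ideal J" and "icong J (x ^ M) 1" "a mod M = b mod M"
  shows "icong J (x ^ a) (x ^ b)"
proof -
  have *: "icong J (x ^ a) (x ^ (a mod M))" for a
  proof -
    have "icong J ((x ^ M) ^ (a div M) * x ^ (a mod M)) (1 ^ (a div M) * x ^ (a mod M))"
      by (intro icong_mult[OF J] icong_power[OF J] assms icong_refl[OF J])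
    then show ?thesis by (simp flip: power_mult power_add)
  qed
  show ?thesis using *[of a] *[of b] assms(3) by (metis J icong_sym icong_trans)
qed

context
  fixes J :: "'a::comm_ring_1 set" and x :: 'a and M :: nat
  assumes J: "is_ideal J" and M: "M > 0" and x: "icong J (x ^ M) 1"
begin

lemma ipow_nat: "int a mod int M = t mod int M \<Longrightarrow> icong J (x ^ a) (ipow M x t)"
  unfolding ipow_def
proof (rule icong_power_mod[OF J x])
  assume "int a mod int M = t mod int M"
  then show "a mod M = nat (t mod int M) mod M"
    using M by (metis mod_mod_trivial nat_int zmod_int)
qed

lemma ipow_add: "icong J (ipow M x s * ipow M x t) (ipow M x (s + t))"
proof -
  have "icong J (x ^ (nat (s mod int M) + nat (t mod int M))) (ipow M x (s + t))"
    by (rule ipow_nat) (use M in \<open>simp add: mod_simps\<close>)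
  then show ?thesis by (simp add: ipow_def power_add)
qed

lemma ipow_mult: "icong J (ipow M x s ^ n) (ipow M x (s * int n))"
proof -
  have "icong J (x ^ (nat (s mod int M) * n)) (ipow M x (s * int n))"
    by (rule ipow_nat) (use M in \<open>simp add: mod_simps\<close>)
  then show ?thesis by (simp add: ipow_def power_mult)
qed

lemma ipow_eqI: "int M dvd s - t \<Longrightarrow> ipow M x s = ipow M x t"
  unfolding ipow_def by (metis mod_eq_dvd_iff)

lemma ipow_0: "ipow M x 0 = 1"
  by (simp add: ipow_def)

lemma iunit_ipow: "iunit J (ipow M x t)"
  unfolding iunit_def using ipow_add[of t "- t"] by (auto simp: ipow_0)

end

section \<open>Reduction of coefficients\<close>

lemma cpoly_coeff: "poly.coeff (cpoly c * f) i = c * poly.coeff f i"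
  by (simp add: cpoly_def)

lemma cpoly_dvd: "cpoly c dvd f \<longleftrightarrow> (\<forall>i. c dvd poly.coeff f i)"
  by (simp add: cpoly_def const_poly_dvd_iff)

lemma coeff_K_red: "poly.coeff (K_red \<delta> f) i = poly.coeff f i mod cyclotomic (2 * \<delta>)"
  by (simp add: K_red_def coeff_map_poly)

lemma K_red_eq_iff: "K_red \<delta> f = K_red \<delta> g \<longleftrightarrow> cpoly (cyclotomic (2 * \<delta>)) dvd f - g"
  unfolding poly_eq_iff[of "K_red \<delta> f"] coeff_K_red cpoly_dvd coeff_diff mod_eq_dvd_iff ..

lemma K_red_idem [simp]: "K_red \<delta> (K_red \<delta> f) = K_red \<delta> f"
  by (simp add: poly_eq_iff coeff_K_red)

lemma K_red_cong: "cpoly (cyclotomic (2 * \<delta>)) dvd f - K_red \<delta> f"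
  using K_red_eq_iff[of \<delta> f "K_red \<delta> f"] by simp

lemma K_red_cong': "cpoly (cyclotomic (2 * \<delta>)) dvd K_red \<delta> f - f"
  using K_red_cong[of \<delta> f] dvd_minus_iff[of _ "f - K_red \<delta> f"] by simp

lemma K_red_0_iff: "K_red \<delta> f = 0 \<longleftrightarrow> cpoly (cyclotomic (2 * \<delta>)) dvd f"
  using K_red_eq_iff[of \<delta> f 0] by (simp add: K_red_def)

text \<open>Divisibility in \<open>K\<^sub>\<delta>[y]\<close> is membership in an ideal of \<open>\<rat>[x, y]\<close>.\<close>

lemma K_dvd_iff: "K_dvd \<delta> a (K_red \<delta> b) \<longleftrightarrow> b \<in> ideal_gen {cpoly (cyclotomic (2 * \<delta>)), a}"
proof
  assume "K_dvd \<delta> a (K_red \<delta> b)"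
  then show "b \<in> ideal_gen {cpoly (cyclotomic (2 * \<delta>)), a}"
    unfolding ideal_gen_pair K_dvd_def K_red_eq_iff by blast
next
  assume "b \<in> ideal_gen {cpoly (cyclotomic (2 * \<delta>)), a}"
  then obtain s where s: "cpoly (cyclotomic (2 * \<delta>)) dvd b - a * s" unfolding ideal_gen_pair by blast
  moreover have "cpoly (cyclotomic (2 * \<delta>)) dvd a * (s - K_red \<delta> s)"
    by (intro dvd_mult K_red_cong)
  ultimately have "cpoly (cyclotomic (2 * \<delta>)) dvd (b - a * s) + a * (s - K_red \<delta> s)" by (rule dvd_add)
  then show "K_dvd \<delta> a (K_red \<delta> b)"
    unfolding K_dvd_def K_red_eq_iff K_carrier_def
    by (intro bexI[of _ "K_red \<delta> s"]) (simp_all add: algebra_simps)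
qed

text \<open>Multiplication by a monic polynomial keeps the leading coefficient, and reduction does not
  touch it because it is reduced already.\<close>

lemma lead_coeff_carrier_product:
  assumes "\<delta> > 0" "lead_coeff p = 1" "c \<in> K_carrier \<delta>" "c \<noteq> 0"
  shows "degree (K_red \<delta> (p * c)) = degree p + degree c"
    "lead_coeff (K_red \<delta> (p * c)) = lead_coeff c"
proof -
  have p: "p \<noteq> 0" using assms(2) by auto
  have top: "poly.coeff (K_red \<delta> (p * c)) (degree p + degree c) = lead_coeff c"
    using assms(2,3) coeff_mult_degree_sum[of p c]
    by (metis (mono_tags, lifting) K_carrier_def coeff_K_red mem_Collect_eq mult_1)
  moreover have "degree (K_red \<delta> (p * c)) \<le> degree p + degree c"
  proof (rule degree_le, intro allI impI)
    fix i assume "degree p + degree c < i"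
    then have "poly.coeff (p * c) i = 0" using degree_mult_le[of p c] by (intro coeff_eq_0) simp
    then show "poly.coeff (K_red \<delta> (p * c)) i = 0" by (simp add: coeff_K_red)
  qed
  ultimately show *: "degree (K_red \<delta> (p * c)) = degree p + degree c"
    using assms(4) by (metis le_antisym le_degree leading_coeff_0_iff)
  show "lead_coeff (K_red \<delta> (p * c)) = lead_coeff c" using top * by simp
qed

text \<open>If the reduction of \<open>f\<close> were nonzero, so would be that of \<open>p f\<close>, because \<open>p\<close> is monic.\<close>

lemma monic_cancel_mod:
  assumes "\<delta> > 0" "lead_coeff p = 1" "cpoly (cyclotomic (2 * \<delta>)) dvd p * f"
  shows "cpoly (cyclotomic (2 * \<delta>)) dvd f"
proof (rule ccontr)
  assume "\<not> ?thesis"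
  then have nz: "K_red \<delta> f \<noteq> 0" by (simp add: K_red_0_iff)
  have c: "K_red \<delta> f \<in> K_carrier \<delta>" by (simp add: K_carrier_def)
  have "cpoly (cyclotomic (2 * \<delta>)) dvd p * (K_red \<delta> f - f)"
    by (intro dvd_mult K_red_cong')
  then have "cpoly (cyclotomic (2 * \<delta>)) dvd p * (K_red \<delta> f - f) + p * f" using assms(3) by (rule dvd_add)
  then have "K_red \<delta> (p * K_red \<delta> f) = 0" by (simp add: K_red_0_iff algebra_simps)
  then show False using lead_coeff_carrier_product(2)[OF assms(1,2) c nz] nz by simp
qed

lemma monic_K_dvd_antisym:
  assumes "\<delta> > 0" "p \<in> K_carrier \<delta>" "p' \<in> K_carrier \<delta>" "lead_coeff p = 1" "lead_coeff p' = 1"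
    "K_dvd \<delta> p p'" "K_dvd \<delta> p' p"
  shows "p = p'"
proof -
  obtain c where c: "c \<in> K_carrier \<delta>" "p' = K_red \<delta> (p * c)" using assms(6) by (auto simp: K_dvd_def)
  obtain c' where c': "c' \<in> K_carrier \<delta>" "p = K_red \<delta> (p' * c')" using assms(7) by (auto simp: K_dvd_def)
  have z: "K_red \<delta> 0 = 0" by (simp add: K_red_def)
  have nz: "c \<noteq> 0" "c' \<noteq> 0" using c(2) c'(2) assms(4,5) z by auto
  note 1 = lead_coeff_carrier_product[OF assms(1,4) c(1) nz(1), folded c(2)]
  note 2 = lead_coeff_carrier_product[OF assms(1,5) c'(1) nz(2), folded c'(2)]
  have "degree c = 0" using 1(1) 2(1) by linarith
  then obtain a where a: "c = [:a:]" by (rule degree_eq_zeroE)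
  moreover have "lead_coeff c = 1" using 1(2) assms(5) by simp
  ultimately have "c = 1" using a by (simp add: one_pCons)
  then have "p' = K_red \<delta> p" using c(2) by simp
  then show ?thesis using assms(2) by (simp add: K_carrier_def)
qed

text \<open>A generator of the ideal \<open>(G\<^sub>k, H\<^sub>m)\<close> is divisible by all common divisors; if it is monic, it is
  determined, since mutually divisible monic polynomials have the same degree.\<close>

lemma p_gcd_eqI:
  assumes \<delta>: "\<delta> > 0" and P: "lead_coeff P = 1"
    "G_poly k \<in> ideal_gen {cpoly (cyclotomic (2 * \<delta>)), P}" "H_poly m \<in> ideal_gen {cpoly (cyclotomic (2 * \<delta>)), P}"
    "P \<in> ideal_gen {cpoly (cyclotomic (2 * \<delta>)), G_poly k, H_poly m}"
  shows "p_gcd k m \<delta> = K_red \<delta> P" "degree (K_red \<delta> P) = degree P" "lead_coeff (K_red \<delta> P) = 1"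
proof -
  let ?F = "cpoly (cyclotomic (2 * \<delta>))" and ?Q = "K_red \<delta> P"
  have deg: "degree (cyclotomic (2 * \<delta>)) > 0" using \<delta> by (simp add: degree_cyclotomic)
  have one: "1 mod cyclotomic (2 * \<delta>) = 1" using deg by (simp add: mod_poly_less)
  have onec: "1 \<in> K_carrier \<delta>"
    by (auto simp: K_carrier_def poly_eq_iff coeff_K_red coeff_1 one)
  show d: "degree ?Q = degree P" and l: "lead_coeff ?Q = 1"
    using lead_coeff_carrier_product[OF \<delta> P(1) onec] by simp_all
  have PQ: "ideal_gen {?F, ?Q} = ideal_gen {?F, P}"
  proof (rule ideal_gen_eqI)
    have "?Q \<in> ideal_gen {?F, P}"
      unfolding ideal_gen_pair using K_red_cong'[of \<delta> P] by (intro exI[of _ 1]) simp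
    then show "{?F, ?Q} \<subseteq> ideal_gen {?F, P}" by (simp add: ideal_gen_base)
    have "P \<in> ideal_gen {?F, ?Q}"
      unfolding ideal_gen_pair using K_red_cong[of \<delta> P] by (intro exI[of _ 1]) simp
    then show "{?F, P} \<subseteq> ideal_gen {?F, ?Q}" by (simp add: ideal_gen_base)
  qed
  have "is_monic_gcd_K \<delta> ?Q (K_red \<delta> (G_poly k)) (K_red \<delta> (H_poly m))"
    unfolding is_monic_gcd_K_def
  proof (intro conjI ballI impI)
    fix c assume c: "K_dvd \<delta> c (K_red \<delta> (G_poly k))" "K_dvd \<delta> c (K_red \<delta> (H_poly m))"
    have "ideal_gen {?F, G_poly k, H_poly m} \<subseteq> ideal_gen {?F, c}"
      using c unfolding K_dvd_iff by (intro ideal_gen_least) (auto intro: ideal_gen_base)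
    then show "K_dvd \<delta> c ?Q" using P(4) unfolding K_dvd_iff by blast
  qed (use P l in \<open>simp_all add: K_dvd_iff PQ K_carrier_def\<close>)
  then show "p_gcd k m \<delta> = ?Q"
    unfolding p_gcd_def
  proof (rule the_equality)
    fix p assume p: "is_monic_gcd_K \<delta> p (K_red \<delta> (G_poly k)) (K_red \<delta> (H_poly m))"
    show "p = ?Q"
      using p \<open>is_monic_gcd_K \<delta> ?Q _ _\<close> \<delta> unfolding is_monic_gcd_K_def
      by (intro monic_K_dvd_antisym) auto
  qed
qed

section \<open>The gcd at a root of unity\<close>

lemma diff_dvd_power_diff: "x - y dvd x ^ n - y ^ n" for x y :: "'a::comm_ring_1"
  by (simp add: power_diff_sumr2)

lemma lin_factor: "Y - cpoly c = [:- c, 1:]"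
  by (simp add: Y_def cpoly_def)

lemma lin_factor_split: "f = (Y - cpoly c) * synthetic_div f c + cpoly (poly f c)"
  unfolding lin_factor unfolding cpoly_def by (simp only: synthetic_div_correct')

lemma synthetic_div_monic:
  fixes f :: bipoly
  assumes "lead_coeff f = 1" "degree f > 0"
  shows "lead_coeff (synthetic_div f c) = 1" "degree (synthetic_div f c) = degree f - 1"
proof -
  show d: "degree (synthetic_div f c) = degree f - 1" by (simp add: degree_synthetic_div)
  have s: "synthetic_div f c \<noteq> 0" using assms(2) by (simp add: synthetic_div_eq_0_iff)
  have "lead_coeff ([:- c, 1:] * synthetic_div f c) = lead_coeff (synthetic_div f c)"
    by (simp only: lead_coeff_mult) simp
  moreover have "lead_coeff f = lead_coeff ([:- c, 1:] * synthetic_div f c)"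
  proof -
    have deg: "degree ([:- c, 1:] * synthetic_div f c) = degree f"
      using s assms(2) by (subst degree_mult_eq) (auto simp: degree_synthetic_div)
    have "lead_coeff f = poly.coeff ([:- c, 1:] * synthetic_div f c + [:poly f c:]) (degree f)"
      by (simp only: synthetic_div_correct')
    also have "\<dots> = poly.coeff ([:- c, 1:] * synthetic_div f c) (degree f)"
    proof -
      have "poly.coeff [:poly f c:] (degree f) = 0" using assms(2) by (intro coeff_eq_0) simp
      then show ?thesis by (simp only: coeff_add add_0_right)
    qed
    finally show ?thesis unfolding deg .
  qed
  ultimately show "lead_coeff (synthetic_div f c) = 1" using assms(1) by simp
qed

text \<open>One fibre: \<open>x\<close> is a root of unity of order \<open>2\<delta>\<close>.\<close>

locale pretzel_root =
  fixes k m g \<delta> :: nat and u v e :: int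
  assumes k: "k \<ge> 1" and m: "m \<ge> 1" and g: "g = gcd m k" and \<delta>: "\<delta> > 1"
    and uv: "u * int m + v * int k = int g" and e: "e = u * int m - v * int k"
begin

abbreviation "Phi \<equiv> cyclotomic (2 * \<delta>)"
abbreviation "F \<equiv> cpoly Phi"

text \<open>Powers of \<open>x\<close> with integer exponents, first in \<open>\<rat>[x]\<close> and then in \<open>\<rat>[x, y]\<close>; in particular
  \<open>chi (-1)\<close> represents the inverse of \<open>x\<close>.\<close>

definition xp :: "int \<Rightarrow> rat poly" where "xp = ipow (2 * \<delta>) [:0, 1:]"
definition chi :: "int \<Rightarrow> bipoly" where "chi = ipow (2 * \<delta>) X"

lemma cpoly_xp: "cpoly (xp t) = chi t"
  by (simp add: xp_def chi_def ipow_def)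

lemma x_order: "icong (ideal_gen {Phi}) ([:0, 1:] ^ (2 * \<delta>)) 1"
  using cyclotomic_dvd[of "2 * \<delta>"] \<delta> by (simp add: icong_def ideal_gen_singleton)

lemma X_order: "is_ideal J \<Longrightarrow> F \<in> J \<Longrightarrow> icong J (X ^ (2 * \<delta>)) 1"
proof -
  assume J: "is_ideal J" "F \<in> J"
  have "F dvd cpoly ([:0, 1:] ^ (2 * \<delta>) - 1)"
    unfolding cpoly_dvd_iff using cyclotomic_dvd[of "2 * \<delta>"] \<delta> by simp
  then have "F dvd X ^ (2 * \<delta>) - 1" by simp
  then show ?thesis unfolding icong_def using J by (metis dvdE ideal_mult_right)
qed

lemma two_delta_pos: "2 * \<delta> > 0" using \<delta> by simp

lemma chi_0: "chi 0 = 1"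
  by (simp add: chi_def ipow_def)

context
  fixes J assumes J: "is_ideal J" and F: "F \<in> J"
begin

lemmas J_trans = icong_trans[OF J] and J_sym = icong_sym[OF J]
lemmas chi_nat = ipow_nat[OF J two_delta_pos X_order[OF J F], folded chi_def]
lemmas chi_add = ipow_add[OF J two_delta_pos X_order[OF J F], folded chi_def]
lemmas chi_mult = ipow_mult[OF J two_delta_pos X_order[OF J F], folded chi_def]
lemmas iunit_chi = iunit_ipow[OF J two_delta_pos X_order[OF J F], folded chi_def]

lemma chi_of_nat: "icong J (X ^ n) (chi (int n))"
  by (rule chi_nat) simp

lemma iunit_const: "c \<noteq> 0 \<Longrightarrow> iunit J (const_xy c)"
proof -
  assume "c \<noteq> 0"
  then have "const_xy c * const_xy (1 / c) = 1" by (simp add: const_xy_def one_pCons)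
  then show ?thesis unfolding iunit_def by (metis icong_refl[OF J])
qed

text \<open>Up to the unit \<open>x^t\<close> this is \<open>x^(s - t) - 1\<close>, which is coprime to \<open>\<Phi>\<^sub>2\<^sub>\<delta>\<close>.\<close>

lemma iunit_chi_diff:
  assumes "\<not> int (2 * \<delta>) dvd s - t"
  shows "iunit J (chi s - chi t)"
proof -
  define n where "n = nat ((s - t) mod int (2 * \<delta>))"
  have "\<not> 2 * \<delta> dvd n"
  proof
    assume "2 * \<delta> dvd n"
    then have "int (2 * \<delta>) dvd int n" by (simp only: int_dvd_int_iff)
    also have "int n = (s - t) mod int (2 * \<delta>)" using two_delta_pos by (simp add: n_def)
    finally have "int (2 * \<delta>) dvd (s - t) mod int (2 * \<delta>)" .
    then show False using assms by (simp add: dvd_mod_iff)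
  qed
  then have "coprime Phi ([:0, 1:] ^ n - 1)" using \<delta> by (intro coprime_cyclotomic_binomial) auto
  then obtain a b where ab: "a * Phi + b * ([:0, 1:] ^ n - 1) = 1"
    using bezout_coefficients_fst_snd[of Phi "[:0, 1:] ^ n - 1"] by (metis coprime_imp_gcd_eq_1)
  have "cpoly (a * Phi + b * ([:0, 1:] ^ n - 1)) = cpoly 1" unfolding ab ..
  then have "cpoly a * F + cpoly b * (X ^ n - 1) = 1"
    by (simp only: cpoly_hom cpoly_power cpoly_var)
  moreover have "X ^ n = chi (s - t)" by (simp add: chi_def ipow_def n_def)
  ultimately have "(chi (s - t) - 1) * cpoly b - 1 = (- cpoly a) * F" by (simp add: algebra_simps)
  then have "iunit J (chi (s - t) - 1)"
    unfolding iunit_def icong_def using ideal_mult[OF J F, of "- cpoly a"] by (intro exI[of _ "cpoly b"]) (simp only:)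
  then have "iunit J ((chi (s - t) - 1) * chi t)" by (intro iunit_mult[OF J] iunit_chi)
  moreover have "icong J (chi s - chi t) ((chi (s - t) - 1) * chi t)"
  proof -
    have "icong J (chi (s - t) * chi t - chi t) (chi s - chi t)"
      using chi_add[of "s - t" t] by (intro icong_diff[OF J] icong_refl[OF J]) simp
    then show ?thesis using icong_sym[OF J] by (simp add: algebra_simps)
  qed
  ultimately show ?thesis by (rule iunit_cong[OF J, rotated])
qed

text \<open>Since \<open>y\<close> is invertible modulo \<open>J\<close>, \<open>y^g = (y^m)^u (y^k)^v = x^(um) x^(-vk)\<close>.  As \<open>y\<close> has
  finite order too, \<open>u\<close> and \<open>v\<close> can be replaced by nonnegative residues \<open>a\<close> and \<open>b\<close>.\<close>

lemma Y_power_bezout: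
  assumes Ym: "icong J (Y ^ m) (X ^ m)" and XY: "icong J ((X * Y) ^ k) 1"
  shows "icong J (Y ^ g) (chi e)"
proof -
  define M where "M = 2 * \<delta> * m"
  have M: "M > 0" using \<delta> m by (simp add: M_def)
  have XM: "icong J (X ^ (a * m)) 1" if "2 * \<delta> dvd a" for a
    using that icong_power_mod[OF J X_order[OF J F], of "a * m" 0] by simp
  have "icong J ((Y ^ m) ^ (2 * \<delta>)) ((X ^ m) ^ (2 * \<delta>))" by (rule icong_power[OF J Ym])
  then have "icong J (Y ^ M) (X ^ (2 * \<delta> * m))"
    unfolding M_def by (simp add: mult.commute flip: power_mult)
  then have YM: "icong J (Y ^ M) 1" by (rule J_trans) (rule XM, simp)
  have Yk: "icong J (Y ^ k) (chi (- int k))"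
  proof (rule iunit_cancel[OF J, of "X ^ k"])
    show "iunit J (X ^ k)" using iunit_cong[OF J chi_of_nat iunit_chi] .
    have "icong J (X ^ k * chi (- int k)) (chi (int k) * chi (- int k))"
      by (intro icong_mult[OF J] chi_of_nat icong_refl[OF J])
    then have "icong J (X ^ k * chi (- int k)) 1"
      by (rule J_trans) (use chi_add[of "int k" "- int k"] in \<open>simp add: chi_0\<close>)
    then show "icong J (X ^ k * Y ^ k) (X ^ k * chi (- int k))"
      using J_trans[OF XY J_sym] by (simp add: power_mult_distrib)
  qed
  define a where "a = nat (u mod int M)"
  define b where "b = nat (v mod int M)"
  have a: "int a mod int M = u mod int M" and b: "int b mod int M = v mod int M"
    using M by (simp_all add: a_def b_def)
  have "icong J ((Y ^ m) ^ a * (Y ^ k) ^ b) ((X ^ m) ^ a * chi (- int k) ^ b)"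
    by (intro icong_mult[OF J] icong_power[OF J] Ym Yk)
  then have 1: "icong J (Y ^ (m * a + k * b)) (X ^ (m * a) * chi (- int k) ^ b)"
    by (simp add: power_mult power_add)
  have "(m * a + k * b) mod M = g mod M"
  proof -
    have "int M dvd int a - u" "int M dvd int b - v" using a b by (simp_all only: mod_eq_dvd_iff)
    then have "int M dvd int m * (int a - u) + int k * (int b - v)" by (intro dvd_add dvd_mult)
    also have "int m * (int a - u) + int k * (int b - v) = int (m * a + k * b) - int g"
      unfolding uv[symmetric] by (simp add: algebra_simps)
    finally have "int (m * a + k * b) mod int M = int g mod int M" by (simp only: mod_eq_dvd_iff)
    then show ?thesis by (simp only: zmod_int[symmetric] of_nat_eq_iff)
  qed
  then have 2: "icong J (Y ^ g) (Y ^ (m * a + k * b))"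
    by (intro icong_power_mod[OF J YM]) simp
  have dM: "int (2 * \<delta>) dvd int M" by (simp add: M_def)
  have "int (2 * \<delta>) dvd int a - u" "int (2 * \<delta>) dvd int b - v"
    using a b dvd_trans[OF dM] by (simp_all only: mod_eq_dvd_iff)
  then have "int (2 * \<delta>) dvd (int a - u) * int m" "int (2 * \<delta>) dvd (int b - v) * int k"
    by (simp_all only: dvd_mult2)
  then have ab: "int (2 * \<delta>) dvd int (m * a) - u * int m" "int (2 * \<delta>) dvd - int k * int b - (- v * int k)"
    by (simp add: algebra_simps, subst dvd_minus_iff[symmetric], simp add: algebra_simps)
  have 3: "icong J (X ^ (m * a)) (chi (u * int m))"
    by (rule chi_nat) (use ab(1) in \<open>simp only: mod_eq_dvd_iff\<close>)
  have 4: "icong J (chi (- int k) ^ b) (chi (- v * int k))"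
    using chi_mult[of "- int k" b] ipow_eqI[OF J two_delta_pos X_order[OF J F] ab(2)] by (simp add: chi_def)
  have "icong J (X ^ (m * a) * chi (- int k) ^ b) (chi (u * int m) * chi (- v * int k))"
    by (intro icong_mult[OF J] 3 4)
  moreover have "icong J (chi (u * int m) * chi (- v * int k)) (chi e)"
    using chi_add[of "u * int m" "- v * int k"] by (simp add: e)
  ultimately show ?thesis using J_trans[OF 2 J_trans[OF 1 J_trans]] by blast
qed

text \<open>The powers of \<open>y^g = x^e\<close> are \<open>y^m = x^(e m/g)\<close> and \<open>y^k = x^(e k/g)\<close>.  Here
  \<open>e m/g = m - 2 v lcm\<close> and \<open>e k/g = -k + 2 u lcm\<close>, and \<open>2 lcm\<close> is a multiple of \<open>2\<delta>\<close>.\<close>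

lemma Y_powers:
  assumes Yg: "icong J (Y ^ g) (chi e)" and l: "\<delta> dvd lcm m k"
  shows "icong J (Y ^ m) (X ^ m)" "icong J (Y ^ k) (chi (- int k))" "icong J ((X * Y) ^ k) 1"
proof -
  obtain m' k' where mk: "m = g * m'" "k = g * k'" unfolding g by (meson dvdE gcd_dvd1 gcd_dvd2)
  have g0: "g > 0" using g m by simp
  have "lcm m k = g * m' * k'"
  proof -
    have "g * lcm m k = m * k" unfolding g by (rule prod_gcd_lcm_nat[symmetric])
    also have "\<dots> = g * (g * m' * k')" by (subst mk(1), subst mk(2)) (simp only: ac_simps)
    finally show ?thesis using g0 by simp
  qed
  then have lk: "int (2 * \<delta>) dvd 2 * (int m * int k')" "int (2 * \<delta>) dvd 2 * (int k * int m')"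
  proof -
    have "int (2 * \<delta>) dvd int (2 * lcm m k)" using l by (simp only: int_dvd_int_iff) simp
    also have "int (2 * lcm m k) = 2 * (int m * int k')"
      unfolding \<open>lcm m k = g * m' * k'\<close> unfolding mk by simp
    finally show "int (2 * \<delta>) dvd 2 * (int m * int k')" .
    also have "2 * (int m * int k') = 2 * (int k * int m')" unfolding mk by simp
    finally show "int (2 * \<delta>) dvd 2 * (int k * int m')" .
  qed
  have gu: "u * int m' + v * int k' = 1"
  proof -
    have "int g * (u * int m' + v * int k') = int g * 1" using uv unfolding mk by (simp add: algebra_simps)
    then show ?thesis using g0 by simp
  qed
  have "icong J ((Y ^ g) ^ m') (chi e ^ m')" "icong J ((Y ^ g) ^ k') (chi e ^ k')"
    by (intro icong_power[OF J] Yg)+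
  then have 1: "icong J (Y ^ m) (chi (e * int m'))" "icong J (Y ^ k) (chi (e * int k'))"
    using J_trans[OF _ chi_mult] unfolding mk(1)[symmetric] mk(2)[symmetric] power_mult[symmetric] by blast+
  have "e * int m' - int m = - (v * (2 * (int k * int m')))"
  proof -
    have "e * int m' - int m = (u * int m - v * int k) * int m' - int m * (u * int m' + v * int k')"
      using gu by (simp add: e)
    also have "\<dots> = - (v * (int k * int m' + int m * int k'))" by (simp add: algebra_simps)
    also have "int m * int k' = int k * int m'" unfolding mk by simp
    finally show ?thesis by simp
  qed
  then have "int (2 * \<delta>) dvd e * int m' - int m" using lk by (metis dvd_minus_iff dvd_mult)
  then have "chi (e * int m') = chi (int m)" unfolding chi_def by (rule ipow_eqI[OF J two_delta_pos X_order[OF J F]])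
  then show "icong J (Y ^ m) (X ^ m)" using J_trans[OF 1(1) J_sym] chi_of_nat[of m] by simp
  have "e * int k' - (- int k) = u * (2 * (int m * int k'))"
  proof -
    have "e * int k' - (- int k) = (u * int m - v * int k) * int k' + int k * (u * int m' + v * int k')"
      using gu by (simp add: e)
    also have "\<dots> = u * (int m * int k' + int k * int m')" by (simp add: algebra_simps)
    also have "int k * int m' = int m * int k'" unfolding mk by simp
    finally show ?thesis by simp
  qed
  then have "int (2 * \<delta>) dvd e * int k' - (- int k)" using lk by (metis dvd_mult)
  then have "chi (e * int k') = chi (- int k)" unfolding chi_def by (rule ipow_eqI[OF J two_delta_pos X_order[OF J F]])
  then show Yk: "icong J (Y ^ k) (chi (- int k))" using 1(2) by simp
  have "icong J (X ^ k * Y ^ k) (chi (int k) * chi (- int k))"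
    by (intro icong_mult[OF J] chi_of_nat Yk)
  then show "icong J ((X * Y) ^ k) 1"
    using J_trans[OF _ chi_add[of "int k" "- int k"]] by (simp add: chi_0 power_mult_distrib)
qed

text \<open>Raising both relations to the exponent \<open>lcm m k\<close> gives \<open>x^(2 lcm) = 1\<close>, although
  \<open>x^(2 lcm) - 1\<close> is a unit.\<close>

lemma unit_ideal_if_not_dvd_lcm:
  assumes "icong J (Y ^ m) (X ^ m)" "icong J ((X * Y) ^ k) 1" and l: "\<not> \<delta> dvd lcm m k"
  shows "1 \<in> J"
proof -
  obtain a b where ab: "lcm m k = m * a" "lcm m k = k * b" by (meson dvdE dvd_lcm1 dvd_lcm2)
  let ?l = "lcm m k"
  have "icong J ((Y ^ m) ^ a) ((X ^ m) ^ a)" "icong J (((X * Y) ^ k) ^ b) (1 ^ b)"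
    by (intro icong_power[OF J] assms)+
  then have 1: "icong J (Y ^ ?l) (X ^ ?l)" "icong J ((X * Y) ^ ?l) 1"
    unfolding power_mult[symmetric] ab[symmetric] by simp_all
  then have "icong J (X ^ ?l * Y ^ ?l) (X ^ ?l * X ^ ?l)" by (intro icong_mult[OF J] icong_refl[OF J])
  then have "icong J (X ^ (2 * ?l)) 1"
    using J_trans[OF J_sym 1(2), of "X ^ (2 * ?l)"] by (simp add: mult_2 power_add power_mult_distrib)
  then have "icong J (chi (int (2 * ?l))) 1" by (rule J_trans[OF J_sym[OF chi_of_nat]])
  then have "chi (int (2 * ?l)) - chi 0 \<in> J" by (simp add: icong_def chi_0)
  moreover have "iunit J (chi (int (2 * ?l)) - chi 0)"
  proof (rule iunit_chi_diff)
    have "\<not> int (2 * \<delta>) dvd int (2 * ?l)" using l by (simp only: int_dvd_int_iff) simp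
    then show "\<not> int (2 * \<delta>) dvd int (2 * ?l) - 0" unfolding diff_0_right .
  qed
  ultimately show ?thesis by (rule iunit_mem[OF J, rotated])
qed

text \<open>The value of \<open>H\<^sub>m\<close> at \<open>y = x\<close> is the unit \<open>m x^(m - 1)\<close>.\<close>

lemma iunit_Y_minus_X:
  assumes "H_poly m \<in> J"
  shows "iunit J (Y - X)"
proof -
  have "Y - X dvd H_poly m - (\<Sum>i<m. X ^ (m - 1))"
    unfolding H_poly_eq sum_subtractf[symmetric]
  proof (rule dvd_sum)
    fix i assume "i \<in> {..<m}"
    then have "X ^ (m - 1) = X ^ (m - Suc i) * X ^ i" by (simp flip: power_add)
    then have "Y ^ (m - Suc i) * X ^ i - X ^ (m - 1) = (Y ^ (m - Suc i) - X ^ (m - Suc i)) * X ^ i"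
      by (simp add: algebra_simps)
    moreover have "Y - X dvd Y ^ (m - Suc i) - X ^ (m - Suc i)" by (rule diff_dvd_power_diff)
    ultimately show "Y - X dvd Y ^ (m - Suc i) * X ^ i - X ^ (m - 1)" by simp
  qed
  then obtain s where s: "H_poly m - of_nat m * X ^ (m - 1) = (Y - X) * s" by (auto elim: dvdE)
  have "iunit J (const_xy (of_nat m) * X ^ (m - 1))"
    using m by (intro iunit_mult[OF J] iunit_const iunit_cong[OF J chi_of_nat iunit_chi]) simp
  moreover have "const_xy (of_nat m) = of_nat m"
    by (simp add: const_xy_def of_nat_poly)
  ultimately have "iunit J (- (of_nat m * X ^ (m - 1)))" by (simp add: iunit_uminus)
  moreover have "icong J ((Y - X) * s) (- (of_nat m * X ^ (m - 1)))"
    unfolding s[symmetric] icong_def using assms by simp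
  ultimately have "iunit J ((Y - X) * s)" by (rule iunit_cong[OF J, rotated])
  then show ?thesis by (rule iunit_factor)
qed

lemma XY_1_factor: "icong J (1 - X * Y) (- X * (Y - chi (-1)))"
proof -
  have "icong J (X * chi (-1)) (chi (int 1) * chi (-1))"
    using chi_of_nat[of 1] by (intro icong_mult[OF J] icong_refl[OF J]) simp
  then have "icong J (X * chi (-1)) 1"
    by (rule J_trans) (use chi_add[of 1 "-1"] in \<open>simp add: chi_0\<close>)
  then have "icong J (X * chi (-1) - X * Y) (1 - X * Y)" by (intro icong_diff[OF J] icong_refl[OF J])
  then show ?thesis using icong_sym[OF J] by (simp add: algebra_simps)
qed

text \<open>The value of \<open>G\<^sub>k\<close> at \<open>xy = 1\<close> is the unit \<open>k\<close>.\<close>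

lemma iunit_Y_minus_X_inverse:
  assumes "G_poly k \<in> J"
  shows "iunit J (Y - chi (-1))"
proof -
  have "1 - X * Y dvd G_poly k - (\<Sum>i<k. 1)"
    unfolding G_poly_eq sum_subtractf[symmetric]
  proof (rule dvd_sum)
    fix i
    have "X * Y - 1 dvd (X * Y) ^ i - 1 ^ i" by (rule diff_dvd_power_diff)
    then show "1 - X * Y dvd (X * Y) ^ i - 1" using minus_dvd_iff[of "X * Y - 1" "(X * Y) ^ i - 1"] by simp
  qed
  then obtain s where s: "G_poly k - of_nat k = (1 - X * Y) * s" by (auto elim: dvdE)
  have "const_xy (of_nat k) = of_nat k"
    by (simp add: const_xy_def of_nat_poly)
  then have "iunit J (- of_nat k)"
    using k iunit_uminus[OF iunit_const, of "of_nat k"] by simp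
  moreover have "icong J ((1 - X * Y) * s) (- of_nat k)"
    unfolding s[symmetric] icong_def using assms by simp
  ultimately have "iunit J ((1 - X * Y) * s)" by (rule iunit_cong[OF J, rotated])
  then have "iunit J (1 - X * Y)" by (rule iunit_factor)
  then have "iunit J (- X * (Y - chi (-1)))" by (rule iunit_cong[OF J J_sym[OF XY_1_factor]])
  then show ?thesis by (rule iunit_factor')
qed

end

definition N :: bipoly where "N = Y ^ g - chi e"

text \<open>The pairs \<open>(n, s)\<close> that occur are \<open>(k, 1)\<close> and \<open>(m, -1)\<close>.  For \<open>\<delta>\<close> dividing \<open>lcm m k\<close>,
  the power \<open>x^s\<close> is a root of \<open>y^g - x^e\<close> exactly if \<open>\<delta>\<close> divides \<open>n\<close>.\<close>

definition root_factor :: "nat \<Rightarrow> int \<Rightarrow> bipoly" where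
  "root_factor n s = (if \<delta> dvd n then Y - chi s else 1)"

definition fibre_degree :: nat where
  "fibre_degree = (if \<delta> dvd lcm m k then g - (if \<delta> dvd k then 1 else 0) - (if \<delta> dvd m then 1 else 0) else 0)"

lemma chi_1: "chi 1 = X"
proof -
  have "(1::int) mod int (2 * \<delta>) = 1" using \<delta> by (intro mod_pos_pos_trivial) simp_all
  then show ?thesis by (simp add: chi_def ipow_def)
qed

lemma icong_if_F_dvd: "F \<in> J \<Longrightarrow> is_ideal J \<Longrightarrow> F dvd a - b \<Longrightarrow> icong J a b"
  unfolding icong_def by (metis dvdE ideal_mult_right)

lemma N_as_poly: "N = monom 1 g - [:xp e:]"
proof -
  have "Y ^ g = monom 1 g" by (rule Y_power)
  moreover have "chi e = [:xp e:]" unfolding cpoly_xp[symmetric] by (simp add: cpoly_def)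
  ultimately show ?thesis by (simp add: N_def)
qed

lemma g_pos: "g > 0" using g m by simp

lemma N_monic: "lead_coeff N = 1" "degree N = g"
proof -
  show d: "degree N = g"
    unfolding N_as_poly diff_conv_add_uminus using g_pos by (subst degree_add_eq_left) (auto simp: degree_monom_eq)
  show "lead_coeff N = 1"
    unfolding d using g_pos by (simp add: N_as_poly coeff_pCons split: nat.split)
qed

lemma N_root:
  assumes "int (2 * \<delta>) dvd s * int g - e"
  shows "Phi dvd poly N (xp s)"
proof -
  have J: "is_ideal (ideal_gen {Phi})" by simp
  have "xp (s * int g) = xp e" unfolding xp_def by (rule ipow_eqI[OF J two_delta_pos x_order assms])
  moreover have "icong (ideal_gen {Phi}) (xp s ^ g) (xp (s * int g))"
    unfolding xp_def by (rule ipow_mult[OF J two_delta_pos x_order])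
  ultimately show ?thesis by (simp add: N_as_poly poly_monom icong_def ideal_gen_singleton)
qed

lemma extract_root:
  assumes "lead_coeff f = 1" "degree f > 0" "Phi dvd poly f (xp s)"
  shows "\<exists>f'. lead_coeff f' = 1 \<and> degree f' = degree f - 1 \<and> F dvd f' * (Y - chi s) - f"
proof (intro exI conjI)
  let ?f = "synthetic_div f (xp s)"
  show "lead_coeff ?f = 1" "degree ?f = degree f - 1" using synthetic_div_monic[OF assms(1,2)] by auto
  have "F dvd - cpoly (poly f (xp s))" using assms(3) by (simp add: cpoly_dvd_iff)
  also have "- cpoly (poly f (xp s)) = ?f * (Y - chi s) - f"
    using lin_factor_split[of f "xp s"] by (simp add: cpoly_xp algebra_simps)
  finally show "F dvd ?f * (Y - chi s) - f" .
qed

text \<open>A second root \<open>x^t\<close> survives in the quotient, because \<open>x^t - x^s\<close> is a unit.\<close>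

lemma root_after_extraction:
  assumes "F dvd f' * (Y - chi s) - f" "Phi dvd poly f (xp t)" "\<not> int (2 * \<delta>) dvd t - s"
  shows "Phi dvd poly f' (xp t)"
proof -
  have J: "is_ideal (ideal_gen {F})" by simp
  obtain h where h: "f' * (Y - chi s) = f + F * h"
    using assms(1) by (metis add.commute diff_add_cancel dvdE)
  have "poly f' (xp t) * (xp t - xp s) = poly (f' * (Y - chi s)) (xp t)"
    by (simp add: Y_def flip: cpoly_xp) (simp add: cpoly_def)
  also have "\<dots> = poly f (xp t) + Phi * poly h (xp t)" unfolding h by (simp add: cpoly_def)
  finally have "Phi dvd poly f' (xp t) * (xp t - xp s)" using assms(2) by simp
  then have "F dvd cpoly (poly f' (xp t) * (xp t - xp s))" by (simp only: cpoly_dvd_iff)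
  then have "(chi t - chi s) * cpoly (poly f' (xp t)) \<in> ideal_gen {F}"
    by (simp add: ideal_gen_singleton cpoly_xp mult.commute)
  then have "cpoly (poly f' (xp t)) \<in> ideal_gen {F}"
    using iunit_cancel_mem[OF J iunit_chi_diff[OF J _ assms(3)]] by (simp add: ideal_gen_base)
  then show ?thesis by (simp add: ideal_gen_singleton cpoly_dvd_iff)
qed

lemma root_conditions:
  shows "\<delta> dvd k \<Longrightarrow> int (2 * \<delta>) dvd 1 * int g - e" "\<delta> dvd m \<Longrightarrow> int (2 * \<delta>) dvd (-1) * int g - e"
    "\<not> int (2 * \<delta>) dvd (-1) - 1"
proof -
  have "1 * int g - e = v * (2 * int k)" "(-1) * int g - e = - (u * (2 * int m))"
    unfolding uv[symmetric] e by (simp_all add: algebra_simps)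
  then show "\<delta> dvd k \<Longrightarrow> int (2 * \<delta>) dvd 1 * int g - e" "\<delta> dvd m \<Longrightarrow> int (2 * \<delta>) dvd (-1) * int g - e"
    by (simp_all add: dvd_mult mult_dvd_mono)
  show "\<not> int (2 * \<delta>) dvd (-1) - 1"
  proof
    assume "int (2 * \<delta>) dvd (-1) - 1"
    then have "int (2 * \<delta>) dvd 2" by simp
    then have "int (2 * \<delta>) \<le> 2" by (intro zdvd_imp_le) simp_all
    then show False using \<delta> by simp
  qed
qed

text \<open>If \<open>\<delta>\<close> divides both \<open>k\<close> and \<open>m\<close>, it divides \<open>g\<close>, so that \<open>g \<ge> 2\<close> and both roots can be split
  off.\<close>

lemma exists_quotient:
  "\<exists>P. lead_coeff P = 1 \<and> degree P = g - (if \<delta> dvd k then 1 else 0) - (if \<delta> dvd m then 1 else 0) \<and>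
     F dvd P * root_factor k 1 * root_factor m (-1) - N"
proof -
  have 1: "\<exists>P. lead_coeff P = 1 \<and> degree P = g - (if \<delta> dvd k then 1 else 0) \<and> F dvd P * root_factor k 1 - N"
  proof (cases "\<delta> dvd k")
    case True
    then show ?thesis
      using extract_root[of N 1] N_root[OF root_conditions(1)] N_monic g_pos by (simp add: root_factor_def)
  qed (use N_monic in \<open>auto simp: root_factor_def intro!: exI[of _ N]\<close>)
  then obtain P where P: "lead_coeff P = 1" "degree P = g - (if \<delta> dvd k then 1 else 0)" "F dvd P * root_factor k 1 - N"
    by blast
  show ?thesis
  proof (cases "\<delta> dvd m")
    case True
    have "Phi dvd poly P (xp (-1))"
    proof (cases "\<delta> dvd k")
      case dk: True
      show ?thesis
        using root_after_extraction[OF P(3)[unfolded root_factor_def if_P[OF dk]] N_root[OF root_conditions(2)[OF True]] root_conditions(3)] .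
    next
      case False
      then have "F dvd P - N" using P(3) by (simp add: root_factor_def)
      then obtain h where "P = N + F * h" by (metis add.commute diff_add_cancel dvdE)
      then have "poly P (xp (-1)) = poly N (xp (-1)) + Phi * poly h (xp (-1))" by (simp add: cpoly_def)
      then show ?thesis using N_root[OF root_conditions(2)[OF True]] by simp
    qed
    moreover have "degree P > 0"
    proof (cases "\<delta> dvd k")
      case dk: True
      then have "\<delta> dvd g" using True by (simp add: g)
      then have "g \<ge> \<delta>" using g_pos by (rule dvd_imp_le)
      then show ?thesis using P(2) dk \<delta> by simp
    qed (use P(2) g_pos in simp)
    ultimately obtain Q where Q: "lead_coeff Q = 1" "degree Q = degree P - 1" "F dvd Q * (Y - chi (-1)) - P"
      using extract_root[OF P(1)] by blast
    have "F dvd (Q * (Y - chi (-1)) - P) * root_factor k 1 + (P * root_factor k 1 - N)"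
      by (intro dvd_add dvd_mult2 Q(3) P(3))
    then have "F dvd Q * root_factor k 1 * root_factor m (-1) - N"
      using True by (simp add: root_factor_def[of m] algebra_simps)
    moreover have "degree Q = g - (if \<delta> dvd k then 1 else 0) - (if \<delta> dvd m then 1 else 0)"
      using Q(2) True unfolding P(2) by simp
    ultimately show ?thesis using Q(1) by blast
  next
    case False
    then have "F dvd P * root_factor k 1 * root_factor m (-1) - N"
      "degree P = g - (if \<delta> dvd k then 1 else 0) - (if \<delta> dvd m then 1 else 0)"
      using P by (simp_all add: root_factor_def[of m])
    then show ?thesis using P(1) by blast
  qed
qed

text \<open>Either \<open>y - x^s\<close> is one of the factors split off from \<open>N\<close>, and it cancels because it is
  monic; or \<open>\<delta>\<close> does not divide \<open>n\<close>, and it is a unit modulo \<open>P\<close>, because it divides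
  \<open>y^n - x^(sn)\<close>, which is congruent to the unit \<open>x^(-sn) - x^(sn)\<close>.\<close>

lemma cofactor_in_ideal:
  assumes P: "F dvd P * W * root_factor n s - N" and s: "s = 1 \<or> s = -1"
    and T: "(Y - chi s) * T \<in> ideal_gen {F, N}" and Yn: "icong (ideal_gen {F, N}) (Y ^ n) (chi (- s * int n))"
  shows "T \<in> ideal_gen {F, P}"
proof (cases "\<delta> dvd n")
  case True
  obtain t where "F dvd (Y - chi s) * T - N * t" using T unfolding ideal_gen_pair by blast
  then have "F dvd ((Y - chi s) * T - N * t) - (P * W * (Y - chi s) - N) * t"
  proof (rule dvd_diff)
    show "F dvd (P * W * (Y - chi s) - N) * t" using P True by (intro dvd_mult2) (simp add: root_factor_def)
  qed
  then have d: "F dvd (Y - chi s) * (T - P * (W * t))" by (simp add: algebra_simps)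
  have l: "lead_coeff (Y - chi s) = 1" unfolding cpoly_xp[symmetric] lin_factor by simp
  have "F dvd T - P * (W * t)"
    by (rule monic_cancel_mod[OF _ l d]) (use \<delta> in simp)
  then show ?thesis unfolding ideal_gen_pair by blast
next
  case False
  let ?J = "ideal_gen {F, P}"
  have J: "is_ideal ?J" and F: "F \<in> ?J" by (simp_all add: ideal_gen_base)
  have "N \<in> ?J"
  proof -
    have "F dvd N - P * W" using P False dvd_minus_iff[of F "P * W - N"] by (simp add: root_factor_def)
    then show ?thesis unfolding ideal_gen_pair by blast
  qed
  then have sub: "ideal_gen {F, N} \<subseteq> ?J" using F by (intro ideal_gen_least) auto
  have "icong ?J (chi s ^ n) (chi (s * int n))" by (rule chi_mult[OF J F])
  then have c: "icong ?J (Y ^ n - chi s ^ n) (chi (- s * int n) - chi (s * int n))"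
    by (intro icong_diff[OF J] icong_mono[OF Yn sub])
  have "\<not> int (2 * \<delta>) dvd - s * int n - s * int n"
  proof
    assume "int (2 * \<delta>) dvd - s * int n - s * int n"
    then have "2 * int \<delta> dvd 2 * int n" using s by auto
    then show False using False by simp
  qed
  then have "iunit ?J (Y ^ n - chi s ^ n)"
    using iunit_cong[OF J c iunit_chi_diff[OF J F]] by blast
  moreover obtain t where "Y ^ n - chi s ^ n = (Y - chi s) * t"
    using diff_dvd_power_diff[of Y "chi s" n] by (elim dvdE)
  ultimately have "iunit ?J (Y - chi s)" using iunit_factor by metis
  then show ?thesis using iunit_cancel_mem[OF J] T sub by blast
qed

lemma H_mult: "(Y - X) * H_poly m = Y ^ m - X ^ m"
proof -
  have "X ^ m - Y ^ m = (X - Y) * H_poly m" unfolding H_poly_eq by (rule power_diff_sumr2)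
  then show ?thesis by (simp add: algebra_simps)
qed

lemma G_mult: "(1 - X * Y) * G_poly k = 1 - (X * Y) ^ k"
  unfolding G_poly_eq by (rule one_diff_power_eq[symmetric])

text \<open>With \<open>W\<close> the product of the split-off factors, \<open>P W\<close> is congruent to \<open>N\<close>, which lies in the
  ideal of \<open>G\<^sub>k\<close> and \<open>H\<^sub>m\<close>; as \<open>W\<close> is a unit there, \<open>P\<close> lies in it too.  Conversely, \<open>G\<^sub>k\<close> and
  \<open>H\<^sub>m\<close> are cofactors of \<open>y - x^s\<close> in multiples of \<open>N\<close>.\<close>

lemma fibre_ideal:
  obtains P where "lead_coeff P = 1" "degree P = fibre_degree"
    "P \<in> ideal_gen {F, G_poly k, H_poly m}" "G_poly k \<in> ideal_gen {F, P}" "H_poly m \<in> ideal_gen {F, P}"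
    "N \<in> ideal_gen {F, P}"
proof -
  let ?I = "ideal_gen {F, G_poly k, H_poly m}"
  have I: "is_ideal ?I" and FI: "F \<in> ?I" and GI: "G_poly k \<in> ?I" and HI: "H_poly m \<in> ?I"
    by (simp_all add: ideal_gen_base)
  have Ym: "icong ?I (Y ^ m) (X ^ m)"
    unfolding icong_def H_mult[symmetric] by (rule ideal_mult[OF I HI])
  have "icong ?I 1 ((X * Y) ^ k)"
    unfolding icong_def G_mult[symmetric] by (rule ideal_mult[OF I GI])
  then have XY: "icong ?I ((X * Y) ^ k) 1" by (rule icong_sym[OF I])
  show ?thesis
  proof (cases "\<delta> dvd lcm m k")
    case False
    then have "1 \<in> ?I" by (rule unit_ideal_if_not_dvd_lcm[OF I FI Ym XY])
    moreover have "a \<in> ideal_gen {F, 1}" for a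
      using ideal_mult[of "ideal_gen {F, 1}" 1 a] by (simp add: ideal_gen_base)
    ultimately show ?thesis using False by (intro that[of 1]) (simp_all add: fibre_degree_def)
  next
    case True
    obtain P where P: "lead_coeff P = 1" "degree P = fibre_degree"
      "F dvd P * root_factor k 1 * root_factor m (-1) - N"
      using exists_quotient True unfolding fibre_degree_def by auto
    let ?N = "ideal_gen {F, N}"
    have J: "is_ideal ?N" and FJ: "F \<in> ?N" and NJ: "N \<in> ?N" by (simp_all add: ideal_gen_base)
    have "icong ?N (Y ^ g) (chi e)" using NJ by (simp add: icong_def N_def)
    note Yp = Y_powers[OF J FJ this True]
    have "icong ?I (Y ^ g) (chi e)" by (rule Y_power_bezout[OF I FI Ym XY])
    then have NI: "N \<in> ?I" by (simp add: icong_def N_def)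
    have PN: "icong ?I (root_factor k 1 * root_factor m (-1) * P) N"
      by (rule icong_if_F_dvd[OF FI I]) (use P(3) in \<open>simp add: ac_simps\<close>)
    have u: "iunit ?I (root_factor k 1 * root_factor m (-1))"
      unfolding root_factor_def chi_1
      using iunit_Y_minus_X[OF I FI HI] iunit_Y_minus_X_inverse[OF I FI GI]
      by (auto intro!: iunit_mult[OF I] iunit_1[OF I])
    have "P \<in> ?I" by (rule iunit_cancel_mem[OF I u icong_mem[OF I PN NI]])
    moreover have "N \<in> ideal_gen {F, P}"
      unfolding ideal_gen_pair using P(3) dvd_minus_iff[of F "P * root_factor k 1 * root_factor m (-1) - N"]
      by (intro exI[of _ "root_factor k 1 * root_factor m (-1)"]) (simp add: ac_simps)
    moreover have "H_poly m \<in> ideal_gen {F, P}"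
    proof (rule cofactor_in_ideal)
      show "F dvd P * root_factor m (-1) * root_factor k 1 - N" using P(3) by (simp add: ac_simps)
      show "(Y - chi 1) * H_poly m \<in> ?N" using Yp(1) by (simp add: chi_1 H_mult icong_def)
      show "icong ?N (Y ^ k) (chi (- 1 * int k))" using Yp(2) by simp
    qed simp
    moreover have "G_poly k \<in> ideal_gen {F, P}"
    proof (rule cofactor_in_ideal)
      show "F dvd P * root_factor k 1 * root_factor m (-1) - N" by (rule P(3))
      have "(1 - X * Y) * G_poly k \<in> ?N"
        using icong_sym[OF J Yp(3)] by (simp add: G_mult icong_def)
      moreover have "icong ?N ((1 - X * Y) * G_poly k) (- X * (Y - chi (-1)) * G_poly k)"
        by (intro icong_mult[OF J] icong_refl[OF J] XY_1_factor[OF J FJ])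
      ultimately have "(- X) * ((Y - chi (-1)) * G_poly k) \<in> ?N"
        using icong_mem[OF J icong_sym[OF J]] by (metis mult.assoc)
      moreover have "iunit ?N (- X)" using iunit_chi[OF J FJ, of 1] by (intro iunit_uminus) (simp add: chi_1)
      ultimately show "(Y - chi (-1)) * G_poly k \<in> ?N" using iunit_cancel_mem[OF J] by blast
      show "icong ?N (Y ^ m) (chi (- (-1) * int m))"
        using icong_trans[OF J Yp(1) chi_of_nat[OF J FJ]] by simp
    qed simp
    ultimately show ?thesis using P(1,2) by (intro that)
  qed
qed

text \<open>The gcd is the reduction of the polynomial just found, so it inherits all its properties.\<close>

theorem p_gcd_fibre:
  shows "p_gcd k m \<delta> \<in> K_carrier \<delta>" "lead_coeff (p_gcd k m \<delta>) = 1" "degree (p_gcd k m \<delta>) = fibre_degree"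
    "p_gcd k m \<delta> \<in> ideal_gen {F, G_poly k, H_poly m}"
    "G_poly k \<in> ideal_gen {F, p_gcd k m \<delta>}" "H_poly m \<in> ideal_gen {F, p_gcd k m \<delta>}"
    "N \<in> ideal_gen {F, p_gcd k m \<delta>}"
proof -
  obtain P where P: "lead_coeff P = 1" "degree P = fibre_degree"
    "P \<in> ideal_gen {F, G_poly k, H_poly m}" "G_poly k \<in> ideal_gen {F, P}" "H_poly m \<in> ideal_gen {F, P}"
    "N \<in> ideal_gen {F, P}" by (rule fibre_ideal)
  have \<delta>0: "\<delta> > 0" using \<delta> by simp
  note p = p_gcd_eqI[OF \<delta>0 P(1) P(4,5,3)]
  let ?p = "p_gcd k m \<delta>"
  show "?p \<in> K_carrier \<delta>" by (simp add: p K_carrier_def)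
  show "lead_coeff ?p = 1" "degree ?p = fibre_degree" using p P(2) by simp_all
  have sub: "ideal_gen {F, P} \<subseteq> ideal_gen {F, ?p}"
  proof (rule ideal_gen_least)
    have "P \<in> ideal_gen {F, ?p}"
      unfolding ideal_gen_pair p using K_red_cong[of \<delta> P] by (intro exI[of _ 1]) simp
    then show "{F, P} \<subseteq> ideal_gen {F, ?p}" by (simp add: ideal_gen_base)
  qed simp
  show "G_poly k \<in> ideal_gen {F, ?p}" "H_poly m \<in> ideal_gen {F, ?p}" "N \<in> ideal_gen {F, ?p}"
    using P(4-6) sub by blast+
  have "icong (ideal_gen {F, G_poly k, H_poly m}) ?p P"
    by (rule icong_if_F_dvd) (simp_all add: p K_red_cong' ideal_gen_base)
  then show "?p \<in> ideal_gen {F, G_poly k, H_poly m}" using icong_mem P(3) by blast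
qed

end

section \<open>Gluing the fibres\<close>

lemma coprime_prod_dvd:
  fixes \<phi> :: "'b \<Rightarrow> rat poly"
  assumes "finite S" "\<And>a b. a \<in> S \<Longrightarrow> b \<in> S \<Longrightarrow> a \<noteq> b \<Longrightarrow> coprime (\<phi> a) (\<phi> b)" "\<And>a. a \<in> S \<Longrightarrow> \<phi> a dvd c"
  shows "prod \<phi> S dvd c"
  using assms
proof (induction S)
  case (insert a S)
  have "coprime (\<phi> a) (prod \<phi> S)"
    using insert.prems(1) insert.hyps by (intro prod_coprime_right) auto
  moreover have "prod \<phi> S dvd c" by (rule insert.IH) (use insert.prems in auto)
  ultimately show ?case using insert by (simp add: divides_mult)
qed simp

lemma chinese_remainder_poly:
  fixes \<phi> :: "'b \<Rightarrow> rat poly"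
  assumes "finite S" "\<And>a b. a \<in> S \<Longrightarrow> b \<in> S \<Longrightarrow> a \<noteq> b \<Longrightarrow> coprime (\<phi> a) (\<phi> b)"
  shows "\<exists>c. \<forall>a\<in>S. \<phi> a dvd c - r a"
  using assms
proof (induction S)
  case (insert a S)
  obtain c where c: "\<And>b. b \<in> S \<Longrightarrow> \<phi> b dvd c - r b" using insert by blast
  have "coprime (\<phi> a) (prod \<phi> S)"
    using insert.prems(1) insert.hyps by (intro prod_coprime_right) auto
  then obtain s t where st: "s * \<phi> a + t * prod \<phi> S = 1"
    using bezout_coefficients_fst_snd[of "\<phi> a" "prod \<phi> S"] by (metis coprime_imp_gcd_eq_1)
  let ?c = "c + t * prod \<phi> S * (r a - c)"
  have "?c - r a = (t * prod \<phi> S - 1) * (r a - c)" by (simp add: algebra_simps)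
  also have "t * prod \<phi> S - 1 = \<phi> a * (- s)" using st by (simp add: algebra_simps)
  finally have "\<phi> a dvd ?c - r a" by simp
  moreover have "\<phi> b dvd ?c - r b" if "b \<in> S" for b
  proof -
    have "\<phi> b dvd (c - r b) + t * prod \<phi> S * (r a - c)"
      using c[OF that] dvd_prodI[OF insert.hyps(1) that, of \<phi>] by (intro dvd_add dvd_mult2 dvd_mult)
    then show ?thesis by (simp add: algebra_simps)
  qed
  ultimately show ?case by blast
qed simp

text \<open>In \<open>f = s a f + t b f\<close> both \<open>a f\<close> and \<open>b f\<close> lie in the ideal on the right.\<close>

lemma ideal_gen_coprime_product:
  fixes a b :: "'a::comm_ring_1"
  assumes "s * a + t * b = 1" and "f \<in> ideal_gen (insert a K)" "f \<in> ideal_gen (insert b K)"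
  shows "f \<in> ideal_gen (insert (a * b) K)"
proof -
  let ?J = "ideal_gen (insert (a * b) K)"
  have J: "is_ideal ?J" and ab: "a * b \<in> ?J" by (simp_all add: ideal_gen_base)
  have mult: "c * h \<in> ?J" if "h \<in> ideal_gen (insert d K)" "c * d = a * b" for c d h
  proof -
    have "is_ideal {h. c * h \<in> ?J}"
    proof (rule is_idealI)
      show "0 \<in> {h. c * h \<in> ?J}" using ideal_0[OF J] by simp
    next
      fix x y assume "x \<in> {h. c * h \<in> ?J}" "y \<in> {h. c * h \<in> ?J}"
      then show "x + y \<in> {h. c * h \<in> ?J}" using ideal_add[OF J] by (simp add: distrib_left)
    next
      fix z x assume "x \<in> {h. c * h \<in> ?J}"
      then have "z * (c * x) \<in> ?J" by (simp add: ideal_mult[OF J])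
      then show "z * x \<in> {h. c * h \<in> ?J}" by (simp add: ac_simps)
    qed
    moreover have "insert d K \<subseteq> {h. c * h \<in> ?J}"
      using ab that(2) ideal_mult[OF J] by (auto simp: ideal_gen_base)
    ultimately show ?thesis using ideal_gen_least that(1) by blast
  qed
  have "s * (a * f) + t * (b * f) \<in> ?J"
    by (rule ideal_add[OF J ideal_mult[OF J mult[OF assms(3)]] ideal_mult[OF J mult[OF assms(2)]]])
      (simp_all add: mult.commute)
  also have "s * (a * f) + t * (b * f) = (s * a + t * b) * f" by (simp add: algebra_simps)
  finally show ?thesis unfolding assms(1) by simp
qed

lemma ideal_gen_prod_coprime:
  fixes \<phi> :: "'b \<Rightarrow> rat poly"
  assumes "finite S" "\<And>a b. a \<in> S \<Longrightarrow> b \<in> S \<Longrightarrow> a \<noteq> b \<Longrightarrow> coprime (\<phi> a) (\<phi> b)"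
    and "\<And>a. a \<in> S \<Longrightarrow> f \<in> ideal_gen (insert (cpoly (\<phi> a)) K)"
  shows "f \<in> ideal_gen (insert (cpoly (prod \<phi> S)) K)"
  using assms
proof (induction S)
  case empty
  have "f * 1 \<in> ideal_gen (insert 1 K)" by (intro ideal_mult) (simp_all add: ideal_gen_base)
  then show ?case by simp
next
  case (insert a S)
  have "coprime (\<phi> a) (prod \<phi> S)"
    using insert.prems(1) insert.hyps by (intro prod_coprime_right) auto
  then obtain s t where "s * \<phi> a + t * prod \<phi> S = 1"
    using bezout_coefficients_fst_snd[of "\<phi> a" "prod \<phi> S"] by (metis coprime_imp_gcd_eq_1)
  then have "cpoly (s * \<phi> a + t * prod \<phi> S) = cpoly 1" by simp
  then have "cpoly s * cpoly (\<phi> a) + cpoly t * cpoly (prod \<phi> S) = 1" by (simp only: cpoly_hom)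
  moreover have "f \<in> ideal_gen (insert (cpoly (\<phi> a)) K)" using insert.prems by simp
  moreover have "f \<in> ideal_gen (insert (cpoly (prod \<phi> S)) K)" by (rule insert.IH) (use insert.prems in auto)
  ultimately have "f \<in> ideal_gen (insert (cpoly (\<phi> a) * cpoly (prod \<phi> S)) K)" by (rule ideal_gen_coprime_product)
  then show ?case using insert.hyps by simp
qed

text \<open>All fibres at once; \<open>\<Psi> n\<close> is the product \<open>\<Pi>\<^sub>n\<close>, and \<open>\<Delta>\<close> indexes the factors of \<open>A\<^sub>q\<close>.\<close>

locale pretzel =
  fixes k m q g :: nat and u v e :: int
  assumes k: "k \<ge> 1" and m: "m \<ge> 1" and q: "odd q" and g: "g = gcd m k" and g1: "g > 1"
    and uv: "u * int m + v * int k = int g" and e: "e = u * int m - v * int k"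
begin

abbreviation "\<Phi> \<delta> \<equiv> cyclotomic (2 * \<delta>)"
abbreviation "p \<equiv> p_gcd k m"
abbreviation "d \<equiv> d_deg k m"
abbreviation "D \<equiv> D_set q k m"
abbreviation "S \<equiv> S_set q k m"
abbreviation "\<Psi> \<equiv> Pi_poly q k m"

definition I :: "bipoly set" where "I = ideal_gen {cpoly (A_poly q), G_poly k, H_poly m}"

definition \<Delta> :: "nat set" where "\<Delta> = {\<delta>. \<delta> > 1 \<and> \<delta> dvd q}"

lemma root: "\<delta> \<in> \<Delta> \<Longrightarrow> pretzel_root k m g \<delta> u v e"
  using k m g uv e by unfold_locales (auto simp: \<Delta>_def)

lemma finite_\<Delta>: "finite \<Delta>"
proof -
  have "q > 0" using q by (auto intro: Nat.gr0I)
  then have "finite {\<delta>. \<delta> dvd q}" by (intro finite_divisors_nat) simp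
  then show ?thesis unfolding \<Delta>_def by (rule rev_finite_subset) auto
qed

lemma \<Delta>_pos: "\<delta> \<in> \<Delta> \<Longrightarrow> \<delta> > 0" by (auto simp: \<Delta>_def)

lemma coprime_\<Phi>: "\<delta> \<in> \<Delta> \<Longrightarrow> \<delta>' \<in> \<Delta> \<Longrightarrow> \<delta> \<noteq> \<delta>' \<Longrightarrow> coprime (\<Phi> \<delta>) (\<Phi> \<delta>')"
  by (rule coprime_cyclotomic) (auto simp: \<Delta>_def)

lemma A_eq: "A_poly q = prod \<Phi> \<Delta>"
  unfolding \<Delta>_def by (rule A_poly_factorization[OF q])

lemma p_carrier: "\<delta> \<in> \<Delta> \<Longrightarrow> p \<delta> \<in> K_carrier \<delta>"
  and p_monic: "\<delta> \<in> \<Delta> \<Longrightarrow> lead_coeff (p \<delta>) = 1"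
  and d_eq: "\<delta> \<in> \<Delta> \<Longrightarrow> d \<delta> = (if \<delta> dvd lcm m k then g - (if \<delta> dvd k then 1 else 0) - (if \<delta> dvd m then 1 else 0) else 0)"
  unfolding d_deg_def
  using pretzel_root.p_gcd_fibre(1-3)[OF root] pretzel_root.fibre_degree_def[OF root] by auto

text \<open>A fibre degree 0 with \<open>\<delta>\<close> dividing \<open>lcm m k\<close> would force \<open>g = 2\<close> and \<open>\<delta>\<close> to divide \<open>g\<close>, but
  \<open>\<delta> > 1\<close> is odd.\<close>

lemma D_eq: "D = {\<delta>. \<delta> > 1 \<and> \<delta> dvd q \<and> \<delta> dvd lcm m k}"
proof (intro equalityI subsetI)
  fix \<delta> assume "\<delta> \<in> D"
  then show "\<delta> \<in> {\<delta>. \<delta> > 1 \<and> \<delta> dvd q \<and> \<delta> dvd lcm m k}"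
    using d_eq[of \<delta>] by (auto simp: D_set_def \<Delta>_def split: if_splits)
next
  fix \<delta> assume \<delta>: "\<delta> \<in> {\<delta>. \<delta> > 1 \<and> \<delta> dvd q \<and> \<delta> dvd lcm m k}"
  then have \<delta>\<Delta>: "\<delta> \<in> \<Delta>" by (simp add: \<Delta>_def)
  have "d \<delta> > 0"
  proof (cases "\<delta> dvd k \<and> \<delta> dvd m")
    case True
    then have "\<delta> dvd g" by (simp add: g)
    then have "\<delta> \<le> g" using g1 by (intro dvd_imp_le) simp_all
    moreover have "odd \<delta>" using \<delta> q by (auto dest: dvd_trans)
    then have "\<delta> \<noteq> 2" by auto
    ultimately show ?thesis using d_eq[OF \<delta>\<Delta>] \<delta> by auto
  next
    case False
    then show ?thesis using d_eq[OF \<delta>\<Delta>] \<delta> g1 by auto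
  qed
  then show "\<delta> \<in> D" using \<delta> by (simp add: D_set_def)
qed

lemma D_sub: "D \<subseteq> \<Delta>" by (auto simp: D_set_def \<Delta>_def)

lemma finite_D: "finite D" using D_sub finite_\<Delta> by (rule finite_subset)

lemma d_D: "\<delta> \<in> D \<Longrightarrow> d \<delta> = g - (if \<delta> dvd k then 1 else 0) - (if \<delta> dvd m then 1 else 0)"
proof -
  assume \<delta>: "\<delta> \<in> D"
  then have "\<delta> \<in> \<Delta>" "\<delta> dvd lcm m k" using D_sub D_eq by blast+
  then show ?thesis by (simp add: d_eq)
qed

lemma d_le: "\<delta> \<in> D \<Longrightarrow> d \<delta> \<le> g" by (simp add: d_D)

lemma p_outside_D: "\<delta> \<in> \<Delta> \<Longrightarrow> \<delta> \<notin> D \<Longrightarrow> p \<delta> = 1"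
proof -
  assume \<delta>: "\<delta> \<in> \<Delta>" "\<delta> \<notin> D"
  then have "degree (p \<delta>) = 0" by (auto simp: D_set_def \<Delta>_def d_deg_def)
  then obtain a where "p \<delta> = [:a:]" by (rule degree_eq_zeroE)
  then show "p \<delta> = 1" using p_monic[OF \<delta>(1)] by (simp add: one_pCons)
qed

abbreviation "fibre \<delta> \<equiv> ideal_gen {cpoly (\<Phi> \<delta>), p \<delta>}"

lemma I_fibre: "\<delta> \<in> \<Delta> \<Longrightarrow> I \<subseteq> fibre \<delta>"
  unfolding I_def
proof (rule ideal_gen_least)
  assume \<delta>: "\<delta> \<in> \<Delta>"
  have "\<Phi> \<delta> dvd A_poly q" unfolding A_eq using finite_\<Delta> \<delta> by (rule dvd_prodI)
  then have "cpoly (\<Phi> \<delta>) dvd cpoly (A_poly q)" by (simp add: cpoly_dvd_iff)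
  then obtain c where "cpoly (A_poly q) = cpoly (\<Phi> \<delta>) * c" by (elim dvdE)
  then have "cpoly (A_poly q) \<in> fibre \<delta>"
    using ideal_mult_right[OF is_ideal_ideal_gen ideal_gen_base, of "cpoly (\<Phi> \<delta>)" "{cpoly (\<Phi> \<delta>), p \<delta>}" c] by simp
  then show "{cpoly (A_poly q), G_poly k, H_poly m} \<subseteq> fibre \<delta>"
    using pretzel_root.p_gcd_fibre(5,6)[OF root[OF \<delta>]] by simp
qed simp

text \<open>This is the Chinese remainder theorem for the factors of \<open>A\<^sub>q\<close>.\<close>

lemma I_iff: "f \<in> I \<longleftrightarrow> (\<forall>\<delta>\<in>\<Delta>. f \<in> fibre \<delta>)"
proof
  assume f: "\<forall>\<delta>\<in>\<Delta>. f \<in> fibre \<delta>"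
  show "f \<in> I"
    unfolding I_def A_eq
  proof (rule ideal_gen_prod_coprime)
    fix \<delta> assume \<delta>: "\<delta> \<in> \<Delta>"
    have "fibre \<delta> \<subseteq> ideal_gen {cpoly (\<Phi> \<delta>), G_poly k, H_poly m}"
      using pretzel_root.p_gcd_fibre(4)[OF root[OF \<delta>]] by (intro ideal_gen_least) (auto intro: ideal_gen_base)
    then show "f \<in> ideal_gen {cpoly (\<Phi> \<delta>), G_poly k, H_poly m}" using f \<delta> by blast
  qed (use finite_\<Delta> coprime_\<Phi> in auto)
qed (use I_fibre in blast)

lemma fibre_unit: "\<delta> \<in> \<Delta> \<Longrightarrow> \<delta> \<notin> D \<Longrightarrow> f \<in> fibre \<delta>"
  using ideal_mult[of "fibre \<delta>" "p \<delta>" f] by (simp add: p_outside_D ideal_gen_base)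

lemma I_iff_D: "f \<in> I \<longleftrightarrow> (\<forall>\<delta>\<in>D. f \<in> fibre \<delta>)"
  using I_iff fibre_unit D_sub by blast

lemma fibre_\<Phi>_multiple: "\<Phi> \<delta> dvd c \<Longrightarrow> cpoly c * f \<in> fibre \<delta>"
proof -
  assume "\<Phi> \<delta> dvd c"
  then obtain b where "c = \<Phi> \<delta> * b" by (elim dvdE)
  then have c: "cpoly c * f = (cpoly b * f) * cpoly (\<Phi> \<delta>)" by (simp add: ac_simps)
  show ?thesis unfolding c by (intro ideal_mult is_ideal_ideal_gen ideal_gen_base) simp
qed

lemma fibre_cong: "cpoly (\<Phi> \<delta>) dvd f - f' \<Longrightarrow> f' \<in> fibre \<delta> \<Longrightarrow> f \<in> fibre \<delta>"
proof -
  assume "cpoly (\<Phi> \<delta>) dvd f - f'" "f' \<in> fibre \<delta>"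
  then obtain s where "cpoly (\<Phi> \<delta>) dvd f - f'" "cpoly (\<Phi> \<delta>) dvd f' - p \<delta> * s"
    unfolding ideal_gen_pair by blast
  then have "cpoly (\<Phi> \<delta>) dvd (f - f') + (f' - p \<delta> * s)" by (rule dvd_add)
  then show ?thesis unfolding ideal_gen_pair by (intro exI[of _ s]) simp
qed

lemma is_ideal_I [simp]: "is_ideal I" by (simp add: I_def)

lemma I_unit: "D = {} \<Longrightarrow> 1 \<in> I"
  by (simp add: I_iff_D)

lemma \<Psi>_def': "\<Psi> n = prod \<Phi> {\<delta>\<in>D. d \<delta> > n}"
  by (simp add: Pi_poly_def)

lemma \<Psi>_nz: "\<Psi> n \<noteq> 0"
proof -
  have "finite {\<delta>\<in>D. d \<delta> > n}" using finite_D by simp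
  moreover have "\<Phi> \<delta> \<noteq> 0" if "\<delta> \<in> D" for \<delta> using that by (simp add: D_set_def)
  ultimately show ?thesis unfolding \<Psi>_def' by (simp only: prod_zero_iff) blast
qed

lemma \<Psi>_dvd:
  assumes "\<And>\<delta>. \<delta> \<in> D \<Longrightarrow> d \<delta> > n \<Longrightarrow> \<Phi> \<delta> dvd c"
  shows "\<Psi> n dvd c"
  unfolding \<Psi>_def' using assms finite_D coprime_\<Phi> D_sub by (intro coprime_prod_dvd) auto

lemma \<Phi>_dvd_\<Psi>: "\<delta> \<in> D \<Longrightarrow> d \<delta> > n \<Longrightarrow> \<Phi> \<delta> dvd \<Psi> n"
  unfolding \<Psi>_def' using finite_D by (intro dvd_prodI) auto

text \<open>Where the fibre degree exceeds \<open>n\<close>, a multiple of the monic \<open>p\<^sub>\<delta>\<close> of y-degree at most \<open>n\<close>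
  is 0.\<close>

lemma lead_coeff_dvd:
  assumes f: "f \<in> I" and n: "degree f = n"
  shows "\<Psi> n dvd lead_coeff f"
proof (rule \<Psi>_dvd)
  fix \<delta> assume \<delta>: "\<delta> \<in> D" "d \<delta> > n"
  then have \<delta>\<Delta>: "\<delta> \<in> \<Delta>" using D_sub by blast
  have "f \<in> fibre \<delta>" using f I_fibre[OF \<delta>\<Delta>] by blast
  then have "K_dvd \<delta> (p \<delta>) (K_red \<delta> f)" by (simp only: K_dvd_iff)
  then obtain c where c: "c \<in> K_carrier \<delta>" "K_red \<delta> f = K_red \<delta> (p \<delta> * c)" by (auto simp: K_dvd_def)
  have "c = 0"
  proof (rule ccontr)
    assume "c \<noteq> 0"
    then have "degree (K_red \<delta> f) = d \<delta> + degree c"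
      using lead_coeff_carrier_product(1)[OF \<Delta>_pos[OF \<delta>\<Delta>] p_monic[OF \<delta>\<Delta>] c(1)] by (simp add: c(2) d_deg_def)
    moreover have "degree (K_red \<delta> f) \<le> degree f"
      by (rule degree_le) (simp add: coeff_K_red coeff_eq_0)
    ultimately show False using \<delta>(2) n by simp
  qed
  then have "K_red \<delta> f = 0" unfolding c(2) by (simp add: K_red_def)
  then show "\<Phi> \<delta> dvd lead_coeff f" by (simp add: K_red_0_iff cpoly_dvd)
qed

section \<open>The polynomials h and Q\<close>

abbreviation "h \<equiv> h_poly q k m e"
abbreviation "Q \<equiv> Q_poly q k m"

lemma degree_\<Phi>: "\<delta> \<in> \<Delta> \<Longrightarrow> degree (\<Phi> \<delta>) > 0"
  using \<Delta>_pos by (simp add: degree_cyclotomic)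

lemma degree_prod_\<Phi>:
  assumes "A \<subseteq> D" "A \<noteq> {}"
  shows "degree (prod \<Phi> A) > 0"
proof -
  have fin: "finite A" using assms(1) finite_D by (rule finite_subset)
  obtain \<delta> where \<delta>: "\<delta> \<in> A" using assms(2) by blast
  have nz: "\<Phi> a \<noteq> 0" if "a \<in> A" for a using that assms(1) by (auto simp: D_set_def)
  have "degree (prod \<Phi> A) = (\<Sum>a\<in>A. degree (\<Phi> a))"
    by (rule degree_prod_eq_sum_degree) (use nz in blast)
  moreover have "degree (\<Phi> \<delta>) \<le> (\<Sum>a\<in>A. degree (\<Phi> a))"
    using fin \<delta> by (intro member_le_sum) auto
  ultimately show ?thesis using degree_\<Phi>[of \<delta>] \<delta> assms(1) D_sub by auto
qed

lemma D_pos: "{\<delta>\<in>D. d \<delta> > 0} = D"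
  by (auto simp: D_set_def)

lemma \<Psi>_0: "\<Psi> 0 = prod \<Phi> D"
  unfolding \<Psi>_def' D_pos ..

lemma degree_\<Psi>_0: "D \<noteq> {} \<Longrightarrow> degree (\<Psi> 0) > 0"
  unfolding \<Psi>_0 by (intro degree_prod_\<Phi>) auto

lemma coprime_x_\<Phi>: "\<delta> \<in> \<Delta> \<Longrightarrow> coprime [:0, 1:] (\<Phi> \<delta>)"
proof -
  assume \<delta>: "\<delta> \<in> \<Delta>"
  then have "\<Phi> \<delta> dvd [:0, 1:] ^ (2 * \<delta>) - 1" using \<Delta>_pos by (intro cyclotomic_dvd) simp
  moreover have "coprime [:0, 1:] ([:0, 1:] ^ (2 * \<delta>) - 1 :: rat poly)"
  proof (rule coprimeI)
    fix c assume c: "c dvd [:0, 1:]" "c dvd [:0, 1:] ^ (2 * \<delta>) - (1 :: rat poly)"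
    have "c dvd [:0, 1:] ^ (2 * \<delta>)" using c(1) \<Delta>_pos[OF \<delta>] by (meson dvd_power dvd_trans mult_pos_pos zero_less_numeral)
    then have "c dvd [:0, 1:] ^ (2 * \<delta>) - ([:0, 1:] ^ (2 * \<delta>) - 1)" using c(2) by (rule dvd_diff)
    then show "c dvd 1" by simp
  qed
  ultimately show ?thesis by (meson coprime_divisors dvd_refl)
qed

lemma coprime_x_\<Psi>_0: "coprime (\<Psi> 0) ([:0, 1:] ^ n)"
proof -
  have "coprime [:0, 1:] (\<Psi> 0)"
    unfolding \<Psi>_0 using coprime_x_\<Phi> D_sub by (intro prod_coprime_right) auto
  then show ?thesis by (metis coprime_commute coprime_power_left_iff)
qed

lemma dvd_small_degree:
  fixes a b :: "rat poly"
  assumes "M dvd a - b" "degree a < degree M" "degree b < degree M"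
  shows "a = b"
proof (rule ccontr)
  assume "a \<noteq> b"
  then have "degree M \<le> degree (a - b)" using assms(1) by (intro dvd_imp_degree_le) auto
  also have "\<dots> < degree M" using assms(2,3) by (rule degree_diff_less)
  finally show False by simp
qed

text \<open>Each factor of \<open>\<Pi>\<^sub>0\<close> divides some \<open>x^n - 1\<close> with \<open>n > 0\<close>, so \<open>x\<close> has an inverse modulo \<open>\<Pi>\<^sub>0\<close>.\<close>

lemma h_spec:
  assumes "D \<noteq> {}"
  shows "degree h < degree (\<Psi> 0)" "\<Psi> 0 dvd h * [:0, 1:] ^ nat (- e) - [:0, 1:] ^ nat e"
proof -
  let ?P = "\<lambda>h. degree h < degree (\<Psi> 0) \<and> [h * [:0, 1:] ^ nat (- e) = [:0, 1:] ^ nat e] (mod \<Psi> 0)"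
  let ?x = "[:0, 1:] :: rat poly"
  obtain s t where st: "s * \<Psi> 0 + t * ?x ^ nat (- e) = 1"
    using bezout_coefficients_fst_snd[of "\<Psi> 0" "?x ^ nat (- e)"] coprime_x_\<Psi>_0 by (metis coprime_imp_gcd_eq_1)
  define h0 where "h0 = (t * ?x ^ nat e) mod \<Psi> 0"
  have deg: "degree h0 < degree (\<Psi> 0)"
    unfolding h0_def using degree_mod_less'[OF \<Psi>_nz[of 0], of "t * ?x ^ nat e"] degree_\<Psi>_0[OF assms]
    by (cases "(t * ?x ^ nat e) mod \<Psi> 0 = 0") auto
  have "[h0 * ?x ^ nat (- e) = t * ?x ^ nat e * ?x ^ nat (- e)] (mod \<Psi> 0)"
    unfolding h0_def by (intro cong_mult) (simp_all add: cong_def)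
  also have "t * ?x ^ nat e * ?x ^ nat (- e) = ?x ^ nat e * (1 - s * \<Psi> 0)"
    using st by (simp add: algebra_simps flip: st)
  also have "[\<dots> = ?x ^ nat e] (mod \<Psi> 0)"
    by (simp add: cong_iff_dvd_diff algebra_simps)
  finally have h0: "?P h0" using deg by blast
  have uniq: "h' = h0" if "?P h'" for h'
  proof (rule dvd_small_degree)
    have "[h' * ?x ^ nat (- e) = h0 * ?x ^ nat (- e)] (mod \<Psi> 0)"
      using that h0 by (meson cong_sym cong_trans)
    then have "\<Psi> 0 dvd (h' - h0) * ?x ^ nat (- e)" by (simp add: cong_iff_dvd_diff algebra_simps)
    then show "\<Psi> 0 dvd h' - h0" by (rule iffD1[OF coprime_dvd_mult_left_iff[OF coprime_x_\<Psi>_0]])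
  qed (use that h0 in auto)
  have "h = h0"
    unfolding h_poly_def by (rule the_equality[of ?P, OF h0 uniq])
  with h0 show "degree h < degree (\<Psi> 0)" "\<Psi> 0 dvd h * ?x ^ nat (- e) - ?x ^ nat e"
    by (auto simp: cong_iff_dvd_diff)
qed

text \<open>In each fibre \<open>h\<close> is \<open>x^e\<close>, and \<open>p\<^sub>\<delta>\<close> divides \<open>y^g - x^e\<close>.\<close>

lemma binomial_in_I:
  assumes "D \<noteq> {}"
  shows "Y ^ g - cpoly h \<in> I"
  unfolding I_iff_D
proof
  fix \<delta> assume \<delta>: "\<delta> \<in> D"
  then have \<delta>\<Delta>: "\<delta> \<in> \<Delta>" using D_sub by blast
  interpret r: pretzel_root k m g \<delta> u v e by (rule root[OF \<delta>\<Delta>])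
  let ?J = "fibre \<delta>"
  have J: "is_ideal ?J" and F: "cpoly (\<Phi> \<delta>) \<in> ?J" by (simp_all add: ideal_gen_base)
  have "\<Phi> \<delta> dvd h * [:0, 1:] ^ nat (- e) - [:0, 1:] ^ nat e"
    using \<Phi>_dvd_\<Psi>[of \<delta> 0] \<delta> h_spec(2)[OF assms] by (auto simp: D_set_def intro: dvd_trans)
  then have "cpoly (\<Phi> \<delta>) dvd cpoly (h * [:0, 1:] ^ nat (- e) - [:0, 1:] ^ nat e)" by (simp only: cpoly_dvd_iff)
  then have "icong ?J (cpoly h * X ^ nat (- e)) (X ^ nat e)"
    using r.icong_if_F_dvd[OF F J] by simp
  moreover have "icong ?J (X ^ nat e) (r.chi e * X ^ nat (- e))"
  proof -
    have "icong ?J (r.chi e * X ^ nat (- e)) (r.chi e * r.chi (int (nat (- e))))"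
      by (intro icong_mult[OF J] r.chi_of_nat[OF J F] icong_refl[OF J])
    also have "icong ?J (r.chi e * r.chi (int (nat (- e)))) (r.chi (int (nat e)))"
    proof -
      have "e + int (nat (- e)) = int (nat e)" by simp
      then show ?thesis using r.chi_add[OF J F, of e "int (nat (- e))"] by (simp only:)
    qed
    finally (icong_trans[OF J]) show ?thesis
      using icong_trans[OF J r.chi_of_nat[OF J F] icong_sym[OF J]] by blast
  qed
  ultimately have "icong ?J (cpoly h * X ^ nat (- e)) (r.chi e * X ^ nat (- e))" by (rule icong_trans[OF J])
  then have "icong ?J (X ^ nat (- e) * cpoly h) (X ^ nat (- e) * r.chi e)" by (simp add: mult.commute)
  then have "icong ?J (cpoly h) (r.chi e)"
    by (rule iunit_cancel[OF J iunit_cong[OF J r.chi_of_nat[OF J F] r.iunit_chi[OF J F]]])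
  then have "icong ?J (Y ^ g - cpoly h) r.N"
    unfolding r.N_def by (intro icong_diff[OF J] icong_refl[OF J])
  then show "Y ^ g - cpoly h \<in> ?J" using r.p_gcd_fibre(7) by (rule icong_mem[OF J])
qed

lemma K_carrier_shift: "f \<in> K_carrier \<delta> \<Longrightarrow> Y ^ n * f \<in> K_carrier \<delta>"
proof -
  assume f: "f \<in> K_carrier \<delta>"
  note Yn = Y_power
  have "poly.coeff f i mod \<Phi> \<delta> = poly.coeff f i" for i
    using f by (metis (mono_tags, lifting) K_carrier_def coeff_K_red mem_Collect_eq)
  then show ?thesis by (auto simp: K_carrier_def poly_eq_iff[of "K_red \<delta> _"] coeff_K_red Yn coeff_monom_mult)
qed

text \<open>The quotient collects the fibres on which \<open>Q\<^sub>j\<close> is prescribed.\<close>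

lemma \<Psi>_split: "\<Psi> 0 div \<Psi> j = prod \<Phi> {\<delta>\<in>D. d \<delta> \<le> j}"
proof -
  have "D = {\<delta>\<in>D. d \<delta> > j} \<union> {\<delta>\<in>D. d \<delta> \<le> j}" by auto
  then have "prod \<Phi> D = \<Psi> j * prod \<Phi> {\<delta>\<in>D. d \<delta> \<le> j}"
    unfolding \<Psi>_def' using finite_D by (subst prod.union_disjoint[symmetric]) auto
  then show ?thesis unfolding \<Psi>_0 using \<Psi>_nz[of j] by simp
qed

text \<open>Every coefficient is found with the Chinese remainder theorem and then reduced modulo
  \<open>\<Pi>\<^sub>0 / \<Pi>\<^sub>j\<close>.  All prescribed polynomials are monic of degree \<open>j\<close>, hence so is the solution.\<close>

lemma Q_spec:
  assumes j: "j \<in> d ` D"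
  shows "degree (Q j) = j" "lead_coeff (Q j) = 1"
    "\<And>\<delta>. \<delta> \<in> D \<Longrightarrow> d \<delta> \<le> j \<Longrightarrow> K_red \<delta> (Q j) = Y ^ (j - d \<delta>) * p \<delta>"
proof -
  define A where "A = {\<delta>\<in>D. d \<delta> \<le> j}"
  define M where "M = prod \<Phi> A"
  let ?P = "\<lambda>Q. degree Q = j \<and> lead_coeff Q = 1 \<and>
     (\<forall>i. degree (poly.coeff Q i) < degree (\<Psi> 0 div \<Psi> j)) \<and>
     (\<forall>\<delta>\<in>D. d \<delta> \<le> j \<longrightarrow> K_red \<delta> Q = Y ^ (j - d \<delta>) * p \<delta>)"
  have M: "\<Psi> 0 div \<Psi> j = M" unfolding \<Psi>_split M_def A_def ..
  have "A \<noteq> {}" using j by (auto simp: A_def)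
  then have degM: "degree M > 0" unfolding M_def by (intro degree_prod_\<Phi>) (auto simp: A_def)
  have finA: "finite A" using finite_D by (simp add: A_def)
  have AD: "A \<subseteq> \<Delta>" using D_sub by (auto simp: A_def)
  have M_dvd: "M dvd c" if "\<And>\<delta>. \<delta> \<in> A \<Longrightarrow> \<Phi> \<delta> dvd c" for c
    unfolding M_def using that finA coprime_\<Phi> AD by (intro coprime_prod_dvd) auto
  have \<Phi>M: "\<Phi> \<delta> dvd M" if "\<delta> \<in> A" for \<delta> unfolding M_def using finA that by (rule dvd_prodI)
  define T where "T = (\<lambda>\<delta>. Y ^ (j - d \<delta>) * p \<delta>)"
  have T_deg: "degree (T \<delta>) = j" "lead_coeff (T \<delta>) = 1" if "\<delta> \<in> A" for \<delta>
  proof -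
    note Yn = Y_power
    have l: "lead_coeff (p \<delta>) = 1" using that AD p_monic by blast
    then have "p \<delta> \<noteq> 0" by auto
    then have "degree (T \<delta>) = (j - d \<delta>) + d \<delta>"
      unfolding T_def Yn d_deg_def by (subst degree_mult_eq) (auto simp: degree_monom_eq)
    then show "degree (T \<delta>) = j" using that by (simp add: A_def)
    show "lead_coeff (T \<delta>) = 1" unfolding T_def lead_coeff_mult l Yn by (simp add: degree_monom_eq)
  qed
  have T_carrier: "T \<delta> \<in> K_carrier \<delta>" if "\<delta> \<in> A" for \<delta>
    unfolding T_def using that AD p_carrier by (intro K_carrier_shift) blast
  have "\<forall>i. \<exists>c. \<forall>\<delta>\<in>A. \<Phi> \<delta> dvd c - poly.coeff (T \<delta>) i"
    using finA coprime_\<Phi> AD by (intro allI chinese_remainder_poly) auto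
  then obtain c where c: "\<And>i \<delta>. \<delta> \<in> A \<Longrightarrow> \<Phi> \<delta> dvd c i - poly.coeff (T \<delta>) i" by metis
  define b where "b = (\<lambda>i. c i mod M)"
  have b_deg: "degree (b i) < degree M" for i
  proof -
    have "M \<noteq> 0" using degM by auto
    then show ?thesis using degree_mod_less'[of M "c i"] degM by (cases "c i mod M = 0") (auto simp: b_def)
  qed
  have b: "\<Phi> \<delta> dvd b i - poly.coeff (T \<delta>) i" if "\<delta> \<in> A" for i \<delta>
  proof -
    have "M dvd b i - c i" unfolding b_def by (simp flip: mod_eq_dvd_iff)
    then have "\<Phi> \<delta> dvd b i - c i" by (rule dvd_trans[OF \<Phi>M[OF that]])
    then have "\<Phi> \<delta> dvd (b i - c i) + (c i - poly.coeff (T \<delta>) i)" using c[OF that] by (rule dvd_add)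
    then show ?thesis by simp
  qed
  have bj: "b j = 1"
  proof (rule dvd_small_degree[OF M_dvd])
    show "\<Phi> \<delta> dvd b j - 1" if "\<delta> \<in> A" for \<delta> using b[OF that, of j] T_deg[OF that] by simp
  qed (use b_deg degM in simp_all)
  define Q0 where "Q0 = (\<Sum>i\<le>j. monom (b i) i)"
  have coeff_Q0: "poly.coeff Q0 n = (if n \<le> j then b n else 0)" for n
  proof -
    have "poly.coeff Q0 n = (\<Sum>i\<le>j. if i = n then b i else 0)" unfolding Q0_def coeff_sum by simp
    then show ?thesis by (simp add: sum.delta)
  qed
  have degQ0: "degree Q0 = j"
    by (rule antisym[OF degree_le le_degree]) (auto simp: coeff_Q0 bj)
  have Q0: "?P Q0"
  proof (intro conjI allI ballI impI)
    show "degree Q0 = j" by (rule degQ0)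
    show "lead_coeff Q0 = 1" unfolding degQ0 by (simp add: coeff_Q0 bj)
    show "degree (poly.coeff Q0 i) < degree (\<Psi> 0 div \<Psi> j)" for i
      unfolding M coeff_Q0 using b_deg degM by simp
    fix \<delta> assume "\<delta> \<in> D" "d \<delta> \<le> j"
    then have \<delta>: "\<delta> \<in> A" by (simp add: A_def)
    have "cpoly (\<Phi> \<delta>) dvd Q0 - T \<delta>"
      unfolding cpoly_dvd coeff_diff coeff_Q0
      using b[OF \<delta>] T_deg(1)[OF \<delta>] by (auto simp: coeff_eq_0)
    then have "K_red \<delta> Q0 = K_red \<delta> (T \<delta>)" by (simp only: K_red_eq_iff)
    also have "\<dots> = T \<delta>" using T_carrier[OF \<delta>] by (simp add: K_carrier_def)
    finally show "K_red \<delta> Q0 = Y ^ (j - d \<delta>) * p \<delta>" unfolding T_def .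
  qed
  have uniq: "Q' = Q0" if Q': "?P Q'" for Q'
  proof (rule poly_eqI)
    fix i
    show "poly.coeff Q' i = poly.coeff Q0 i"
    proof (rule dvd_small_degree[OF M_dvd])
      fix \<delta> assume "\<delta> \<in> A"
      then have "K_red \<delta> Q' = K_red \<delta> Q0" using Q' Q0 by (simp add: A_def)
      then show "\<Phi> \<delta> dvd poly.coeff Q' i - poly.coeff Q0 i" by (simp add: K_red_eq_iff cpoly_dvd)
    qed (use Q' Q0 M in auto)
  qed
  have "Q j = Q0"
    unfolding Q_poly_def by (rule the_equality[of ?P, OF Q0 uniq])
  with Q0 show "degree (Q j) = j" "lead_coeff (Q j) = 1"
    "\<And>\<delta>. \<delta> \<in> D \<Longrightarrow> d \<delta> \<le> j \<Longrightarrow> K_red \<delta> (Q j) = Y ^ (j - d \<delta>) * p \<delta>" by auto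
qed

section \<open>The Groebner basis of the pretzel ideal\<close>

abbreviation "B \<equiv> B_set q k m e"

lemma B_eq: "B = {cpoly (\<Psi> 0), Y ^ g - cpoly h} \<union> (\<lambda>j. cpoly (\<Psi> j) * Q j) ` (S - {0, g})"
  unfolding B_set_def cpoly_def g ..

lemma S_eq: "S = {0, g} \<union> d ` D"
  unfolding S_set_def g ..

lemma inner_S: "j \<in> S - {0, g} \<Longrightarrow> j \<in> d ` D \<and> 0 < j \<and> j < g"
proof -
  assume j: "j \<in> S - {0, g}"
  then have "j \<in> d ` D" "0 < j" "j \<noteq> g" unfolding S_eq by blast+
  moreover from this(1) have "j \<le> g" using d_le by blast
  ultimately show ?thesis by simp
qed

text \<open>Fibres of degree above \<open>j\<close> are taken care of by \<open>\<Pi>\<^sub>j\<close>, the other ones by \<open>Q\<^sub>j\<close>.\<close>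

lemma \<Psi>_Q_in_I:
  assumes j: "j \<in> d ` D"
  shows "cpoly (\<Psi> j) * Q j \<in> I"
  unfolding I_iff_D
proof
  fix \<delta> assume \<delta>: "\<delta> \<in> D"
  show "cpoly (\<Psi> j) * Q j \<in> fibre \<delta>"
  proof (cases "d \<delta> > j")
    case True
    then show ?thesis using \<Phi>_dvd_\<Psi>[OF \<delta>] by (intro fibre_\<Phi>_multiple)
  next
    case False
    then have "K_red \<delta> (Q j) = Y ^ (j - d \<delta>) * p \<delta>" using Q_spec(3)[OF j \<delta>] by simp
    then have "cpoly (\<Phi> \<delta>) dvd Q j - Y ^ (j - d \<delta>) * p \<delta>" using K_red_cong[of \<delta> "Q j"] by simp
    moreover have "Y ^ (j - d \<delta>) * p \<delta> \<in> fibre \<delta>"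
      by (intro ideal_mult is_ideal_ideal_gen ideal_gen_base) simp
    ultimately have "Q j \<in> fibre \<delta>" by (rule fibre_cong)
    then show ?thesis by (intro ideal_mult is_ideal_ideal_gen)
  qed
qed

lemma lead_\<Psi>_0: "cpoly (\<Psi> 0) \<noteq> 0" "lead_exp (cpoly (\<Psi> 0)) = (0, degree (\<Psi> 0))"
proof -
  show nz: "cpoly (\<Psi> 0) \<noteq> 0" using \<Psi>_nz[of 0] by (simp add: cpoly_def)
  show "lead_exp (cpoly (\<Psi> 0)) = (0, degree (\<Psi> 0))"
    unfolding lead_exp_eq[OF nz] by (simp add: cpoly_def)
qed

lemma lead_binomial: "Y ^ g - cpoly c \<noteq> 0" "lead_exp (Y ^ g - cpoly c) = (g, 0)"
proof -
  note Yn = Y_power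
  have deg: "degree (Y ^ g - cpoly c) = g"
    unfolding Yn cpoly_def diff_conv_add_uminus using g1 by (subst degree_add_eq_left) (auto simp: degree_monom_eq)
  have lc: "poly.coeff (Y ^ g - cpoly c) g = 1"
    using g1 by (simp add: Yn cpoly_def coeff_pCons split: nat.split)
  then show nz: "Y ^ g - cpoly c \<noteq> 0" by auto
  show "lead_exp (Y ^ g - cpoly c) = (g, 0)"
    unfolding lead_exp_eq[OF nz] deg lc by simp
qed

lemma lead_\<Psi>_Q:
  assumes j: "j \<in> d ` D"
  shows "cpoly (\<Psi> j) * Q j \<noteq> 0" "lead_exp (cpoly (\<Psi> j) * Q j) = (j, degree (\<Psi> j))"
proof -
  note Q = Q_spec(1,2)[OF j]
  have nz: "cpoly (\<Psi> j) \<noteq> 0" "Q j \<noteq> 0" using \<Psi>_nz[of j] Q(2) by (auto simp: cpoly_def)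
  then show nz': "cpoly (\<Psi> j) * Q j \<noteq> 0" by simp
  have "degree (cpoly (\<Psi> j) * Q j) = j" using nz Q(1) by (simp add: degree_mult_eq) (simp add: cpoly_def)
  moreover have "poly.coeff (cpoly (\<Psi> j) * Q j) j = \<Psi> j" using Q by (simp add: cpoly_coeff)
  ultimately show "lead_exp (cpoly (\<Psi> j) * Q j) = (j, degree (\<Psi> j))"
    unfolding lead_exp_eq[OF nz'] by simp
qed

lemma B_nonzero: "0 \<notin> B"
proof
  assume "0 \<in> B"
  then consider "0 = cpoly (\<Psi> 0)" | "0 = Y ^ g - cpoly h"
    | j where "j \<in> S - {0, g}" "0 = cpoly (\<Psi> j) * Q j"
    unfolding B_eq by blast
  then show False
  proof cases
    case 1
    then show False using lead_\<Psi>_0(1) by metis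
  next
    case 2
    then show False using lead_binomial(1)[of h] by metis
  next
    case (3 j)
    then have "j \<in> d ` D" using inner_S by blast
    then show False using lead_\<Psi>_Q(1)[of j] 3(2) by metis
  qed
qed

text \<open>The y-degree \<open>n\<close> of a member of \<open>I\<close> selects the basis element: \<open>y^g - h\<close> if \<open>n \<ge> g\<close>, and otherwise
  the one that belongs to the largest fibre degree not exceeding \<open>n\<close>.\<close>

lemma groebner_B:
  assumes "D \<noteq> {}"
  shows "is_groebner_basis B I"
  unfolding groebner_basis_iff
proof (intro conjI ballI)
  show "finite B" unfolding B_eq S_eq using finite_D by simp
  have "cpoly (\<Psi> 0) * 1 \<in> fibre \<delta>" if "\<delta> \<in> D" for \<delta>
    by (rule fibre_\<Phi>_multiple[OF \<Phi>_dvd_\<Psi>[OF that]]) (use that in \<open>simp add: D_set_def\<close>)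
  then have "cpoly (\<Psi> 0) \<in> I" unfolding I_iff_D by simp
  then show "B \<subseteq> I"
    unfolding B_eq using binomial_in_I[OF assms] \<Psi>_Q_in_I inner_S by blast
  fix f assume "f \<in> I - {0}"
  then have f: "f \<in> I" "f \<noteq> 0" by auto
  define n where "n = degree f"
  have le: "lead_exp f = (n, degree (lead_coeff f))" unfolding n_def by (rule lead_exp_eq[OF f(2)])
  show "\<exists>b\<in>B - {0}. exp_dvd (lead_exp b) (lead_exp f)"
  proof (cases "g \<le> n")
    case True
    have "exp_dvd (lead_exp (Y ^ g - cpoly h)) (lead_exp f)"
      unfolding lead_binomial le using True by (simp add: exp_dvd_def)
    moreover have "Y ^ g - cpoly h \<in> B" unfolding B_eq by blast
    ultimately show ?thesis using B_nonzero by (metis DiffI singletonD)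
  next
    case False
    have "\<Psi> n dvd lead_coeff f" by (rule lead_coeff_dvd[OF f(1)]) (simp add: n_def)
    then have deg: "degree (\<Psi> n) \<le> degree (lead_coeff f)" using f(2) by (intro dvd_imp_degree_le) auto
    \<comment> \<open>no fibre degree lies strictly between \<open>j\<close> and \<open>n + 1\<close>, hence \<open>\<Pi>\<^sub>n = \<Pi>\<^sub>j\<close>\<close>
    define j where "j = Max (insert 0 {d \<delta> | \<delta>. \<delta> \<in> D \<and> d \<delta> \<le> n})"
    have fin: "finite (insert 0 {d \<delta> | \<delta>. \<delta> \<in> D \<and> d \<delta> \<le> n})" using finite_D by simp
    have jin: "j \<in> insert 0 {d \<delta> | \<delta>. \<delta> \<in> D \<and> d \<delta> \<le> n}" unfolding j_def using fin by (intro Max_in) auto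
    then have jn: "j \<le> n" by auto
    have "d \<delta> > n \<longleftrightarrow> d \<delta> > j" if "\<delta> \<in> D" for \<delta>
    proof (cases "d \<delta> \<le> n")
      case True
      then have "d \<delta> \<le> j" unfolding j_def using that by (intro Max_ge fin) blast
      then show ?thesis using True by simp
    next
      case False
      then show ?thesis using jn by simp
    qed
    then have "{\<delta>\<in>D. d \<delta> > n} = {\<delta>\<in>D. d \<delta> > j}" by blast
    then have \<Psi>: "\<Psi> n = \<Psi> j" unfolding \<Psi>_def' by simp
    have c: "exp_dvd (j, degree (\<Psi> j)) (lead_exp f)" unfolding le exp_dvd_def using jn deg by (simp add: \<Psi>)
    show ?thesis
    proof (cases "j = 0")
      case True
      have "cpoly (\<Psi> 0) \<in> B" unfolding B_eq by blast
      then show ?thesis using c lead_\<Psi>_0 unfolding True by (metis DiffI singletonD)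
    next
      case j0: False
      then have j: "j \<in> d ` D" using jin by auto
      then have "j \<in> S - {0, g}" using j0 jn False by (auto simp: S_eq)
      then have "cpoly (\<Psi> j) * Q j \<in> B" unfolding B_eq by blast
      then show ?thesis using c lead_\<Psi>_Q[OF j] by (metis DiffI singletonD)
    qed
  qed
qed

text \<open>Fibre degrees are \<open>g\<close>, \<open>g - 1\<close> or \<open>g - 2\<close>; for \<open>g = 2\<close> the last one is excluded as it is 0.\<close>

lemma inner_S_eq: "S - {0, g} = ({g - 1} \<inter> S) \<union> (if g \<ge> 3 then {g - 2} \<inter> S else {})"
proof -
  have "d \<delta> = g \<or> d \<delta> = g - 1 \<or> d \<delta> = g - 2" if "\<delta> \<in> D" for \<delta>
    using d_D[OF that] by auto
  then have cases: "j = 0 \<or> j = g \<or> j = g - 1 \<or> j = g - 2" if "j \<in> S" for j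
    using that unfolding S_eq by blast
  show ?thesis
  proof (intro equalityI subsetI)
    fix j assume j: "j \<in> S - {0, g}"
    then have "j = g - 1 \<or> j = g - 2 \<and> g \<ge> 3" using cases[of j] by auto
    then show "j \<in> ({g - 1} \<inter> S) \<union> (if g \<ge> 3 then {g - 2} \<inter> S else {})" using j by auto
  next
    fix j assume j: "j \<in> ({g - 1} \<inter> S) \<union> (if g \<ge> 3 then {g - 2} \<inter> S else {})"
    then have "j \<in> S" "j = g - 1 \<or> j = g - 2 \<and> g \<ge> 3" by (auto split: if_splits)
    moreover from this(2) have "j \<noteq> 0" "j \<noteq> g" using g1 by linarith+
    ultimately show "j \<in> S - {0, g}" by blast
  qed
qed

lemma B_explicit:
  "B = {cpoly (\<Psi> 0), Y ^ g - cpoly h} \<union>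
        (if g - 1 \<in> S then {cpoly (\<Psi> (g - 1)) * Q (g - 1)} else {}) \<union>
        (if g \<ge> 3 \<and> g - 2 \<in> S then {cpoly (\<Psi> (g - 2)) * Q (g - 2)} else {})"
  unfolding B_eq inner_S_eq by auto

lemma card_B: "card B \<le> 4"
proof -
  let ?L = "[cpoly (\<Psi> 0), Y ^ g - cpoly h, cpoly (\<Psi> (g - 1)) * Q (g - 1), cpoly (\<Psi> (g - 2)) * Q (g - 2)]"
  have "B \<subseteq> set ?L" unfolding B_explicit by auto
  then have "card B \<le> card (set ?L)" by (intro card_mono) simp_all
  also have "\<dots> \<le> length ?L" by (rule card_length)
  finally show ?thesis by simp
qed

lemma lead_mono_B: "lead_mono ` (B - {0}) =
  {Y ^ g, X ^ degree (\<Psi> 0)} \<union>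
        (if g - 1 \<in> S then {X ^ degree (\<Psi> (g - 1)) * Y ^ (g - 1)} else {}) \<union>
        (if g \<ge> 3 \<and> g - 2 \<in> S then {X ^ degree (\<Psi> (g - 2)) * Y ^ (g - 2)} else {})"
proof -
  have B0: "B - {0} = B" using B_nonzero by simp
  have 1: "lead_mono (cpoly (\<Psi> 0)) = X ^ degree (\<Psi> 0)"
    by (simp add: lead_mono_def lead_\<Psi>_0 mono_xy_def)
  have 2: "lead_mono (Y ^ g - cpoly h) = Y ^ g"
    by (simp add: lead_mono_def lead_binomial mono_xy_def)
  have 3: "lead_mono (cpoly (\<Psi> j) * Q j) = X ^ degree (\<Psi> j) * Y ^ j" if "j \<in> S - {0, g}" for j
  proof -
    have "j \<in> d ` D" using inner_S[OF that] by blast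
    then show ?thesis unfolding lead_mono_def lead_\<Psi>_Q(2)[OF \<open>j \<in> d ` D\<close>] by (simp add: mono_xy_def mult.commute)
  qed
  have "lead_mono ` B = {X ^ degree (\<Psi> 0), Y ^ g} \<union> (\<lambda>j. X ^ degree (\<Psi> j) * Y ^ j) ` (S - {0, g})"
    unfolding B_eq image_Un image_image using 3 by (simp add: 1 2)
  also have "\<dots> = {Y ^ g, X ^ degree (\<Psi> 0)} \<union>
        (if g - 1 \<in> S then {X ^ degree (\<Psi> (g - 1)) * Y ^ (g - 1)} else {}) \<union>
        (if g \<ge> 3 \<and> g - 2 \<in> S then {X ^ degree (\<Psi> (g - 2)) * Y ^ (g - 2)} else {})"
    unfolding inner_S_eq by auto
  finally show ?thesis unfolding B0 .
qed

lemma \<Psi>_top: "\<Psi> (g - 1) = (\<Prod>\<delta>\<in>{\<delta>\<in>D. \<not> \<delta> dvd m \<and> \<not> \<delta> dvd k}. \<Phi> \<delta>)"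
proof -
  have "d \<delta> > g - 1 \<longleftrightarrow> \<not> \<delta> dvd m \<and> \<not> \<delta> dvd k" if "\<delta> \<in> D" for \<delta>
    using d_D[OF that] g1 by auto
  then have "{\<delta>\<in>D. d \<delta> > g - 1} = {\<delta>\<in>D. \<not> \<delta> dvd m \<and> \<not> \<delta> dvd k}" by blast
  then show ?thesis unfolding \<Psi>_def' by simp
qed

lemma \<Psi>_second: "g \<ge> 3 \<Longrightarrow> \<Psi> (g - 2) = (\<Prod>\<delta>\<in>{\<delta>\<in>D. \<not> \<delta> dvd m \<or> \<not> \<delta> dvd k}. \<Phi> \<delta>)"
proof -
  assume "g \<ge> 3"
  then have "d \<delta> > g - 2 \<longleftrightarrow> \<not> \<delta> dvd m \<or> \<not> \<delta> dvd k" if "\<delta> \<in> D" for \<delta>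
    using d_D[OF that] by auto
  then have "{\<delta>\<in>D. d \<delta> > g - 2} = {\<delta>\<in>D. \<not> \<delta> dvd m \<or> \<not> \<delta> dvd k}" by blast
  then show ?thesis unfolding \<Psi>_def' by simp
qed

end

theorem theorem4p8:
  fixes k m r q g :: nat and u v e :: int and I :: "bipoly set"
  assumes "k \<ge> 1" and "m \<ge> 1" and "r \<ge> 2"
    and q: "q = 2 * r - 1"
    and g: "g = gcd m k" and "g > 1"
    and I: "I = ideal_gen {[:A_poly q:], G_poly k, H_poly m}"
    and uv: "u * int m + v * int k = int g"
    and e: "e = u * int m - v * int k"
  shows "pretzel_E2_cap_R k r m = I \<and>
    D_set q k m = {\<delta>. \<delta> > 1 \<and> \<delta> dvd q \<and> \<delta> dvd lcm m k} \<and>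
    (D_set q k m = {} \<longrightarrow> pretzel_AG2 k r m = {1}) \<and>
    (D_set q k m \<noteq> {} \<longrightarrow>
      is_groebner_basis (B_set q k m e) I \<and>
      B_set q k m e =
        {[:Pi_poly q k m 0:], Y ^ g - [:h_poly q k m e:]} \<union>
        (if g - 1 \<in> S_set q k m
         then {[:Pi_poly q k m (g - 1):] * Q_poly q k m (g - 1)} else {}) \<union>
        (if g \<ge> 3 \<and> g - 2 \<in> S_set q k m
         then {[:Pi_poly q k m (g - 2):] * Q_poly q k m (g - 2)} else {}) \<and>
      card (B_set q k m e) \<le> 4 \<and>
      initial_ideal I = ideal_gen (
        {Y ^ g, X ^ degree (Pi_poly q k m 0)} \<union>
        (if g - 1 \<in> S_set q k m
         then {X ^ degree (Pi_poly q k m (g - 1)) * Y ^ (g - 1)} else {}) \<union>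
        (if g \<ge> 3 \<and> g - 2 \<in> S_set q k m
         then {X ^ degree (Pi_poly q k m (g - 2)) * Y ^ (g - 2)} else {})) \<and>
      Pi_poly q k m (g - 1) =
        (\<Prod>\<delta>\<in>{\<delta>\<in>D_set q k m. \<not> \<delta> dvd m \<and> \<not> \<delta> dvd k}. cyclotomic (2 * \<delta>)) \<and>
      (g \<ge> 3 \<longrightarrow> Pi_poly q k m (g - 2) =
        (\<Prod>\<delta>\<in>{\<delta>\<in>D_set q k m. \<not> \<delta> dvd m \<or> \<not> \<delta> dvd k}. cyclotomic (2 * \<delta>))) \<and>
      interreduces_to (B_set q k m e) (pretzel_AG2 k r m) I)"
proof -
  interpret pretzel k m q g u v e
    using assms by unfold_locales (auto simp: q)
  have I': "I = local.I" unfolding I I_def cpoly_def ..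
  have E: "pretzel_E2_cap_R k r m = I"
    using pretzel_ideal[OF assms(1-3)] unfolding I' I_def unfolding assms(4) .
  have AG: "pretzel_AG2 k r m = reduced_groebner_basis I" unfolding pretzel_AG2_def E ..
  have Ii: "is_ideal I" unfolding I' by simp
  show ?thesis
  proof (intro conjI impI)
    show "pretzel_E2_cap_R k r m = I" by (rule E)
    show "D_set q k m = {\<delta>. \<delta> > 1 \<and> \<delta> dvd q \<and> \<delta> dvd lcm m k}" by (rule D_eq)
    show "pretzel_AG2 k r m = {1}" if "D_set q k m = {}"
      unfolding AG using I_unit[OF that] Ii by (intro reduced_groebner_basis_unit_ideal) (simp_all add: I')
    assume D: "D_set q k m \<noteq> {}"
    show GB: "is_groebner_basis (B_set q k m e) I" unfolding I' by (rule groebner_B[OF D])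
    show "interreduces_to (B_set q k m e) (pretzel_AG2 k r m) I"
      unfolding AG by (rule interreduces_to_reduced_groebner_basis[OF Ii GB B_nonzero])
    show "initial_ideal I = ideal_gen (
        {Y ^ g, X ^ degree (Pi_poly q k m 0)} \<union>
        (if g - 1 \<in> S_set q k m
         then {X ^ degree (Pi_poly q k m (g - 1)) * Y ^ (g - 1)} else {}) \<union>
        (if g \<ge> 3 \<and> g - 2 \<in> S_set q k m
         then {X ^ degree (Pi_poly q k m (g - 2)) * Y ^ (g - 2)} else {}))"
      using GB unfolding is_groebner_basis_def lead_mono_B by simp
  qed (use B_explicit[unfolded cpoly_def] card_B \<Psi>_top \<Psi>_second in blast)+
qed

end
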